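(* Let $T$ be a (possibly unbounded) self-adjoint operator on a Hilbert space $\mathcal{H}$, with bounded transform $S=T(I+T^2)^{-1/2}$, and for $f\in C(\sigma(T))$ let $f_0(T)$ be the operator defined in the context and $f(T)=f_0(T)^-$ its closure. If $f\in C(\sigma(T))$ is real-valued, then $f(T)$ is self-adjoint, i.e. $f_0(T)^-=f_0(T)^*$; more generally, $f(T)^*=f^*(T)$ for every $f\in C(\sigma(T))$, where $f^*(x)=\overline{f(x)}$. Furthermore, the continuous functional calculus $f\mapsto f(T)$ restricts to an isometric $*$-homomorphism from $C_0(\sigma(T))$ (with the supremum norm) to $C^*(S)$.
   Context: $\mathcal{H}$ is a complex Hilbert space and $T$ is a densely defined operator with $T^*=T$, not assumed bounded. Its bounded transform $S=T\sqrt{I+T^2}^{\,-1}$ is a bounded self-adjoint operator with $\|Sx\|<\|x\|$ for all $x\neq 0$, and $T=S\sqrt{I-S^2}^{\,-1}$. $C^*(S)$ is the $C^*$-algebra generated within $B(\mathcal{H})$ by $S$ and the unit $I$. Put $\tilde\sigma(S)=\sigma(S)\cap(-1,1)$ and $u:(-1,1)\to\mathbb{R}$, $u(x)=x/\sqrt{1-x^2}$; $u$ maps $\tilde\sigma(S)$ homeomorphically onto $\sigma(T)$. All functions are complex-valued; $C(X)$, $C_0(X)$, $C_c(X)$ denote the continuous functions on $X$, those vanishing at infinity, and those with compact support. Functions in $C_0(\tilde\sigma(S))$ are regarded as elements of $C(\sigma(S))$ by extending them by $0$ to $\sigma(S)\cap\{\pm1\}$, so that $g(S)$ is defined for $g\in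 C_0(\tilde\sigma(S))$ by the usual continuous functional calculus of $S$. For $h\in C_0(\sigma(T))$ (in particular for $h\in C_c(\sigma(T))$) set $h(T)=(h\circ u)(S)$. Let $C_c^*(S)\mathcal{H}$ be the linear span of all vectors $g(S)\psi$ with $g\in C_c(\tilde\sigma(S))$, $\psi\in\mathcal{H}$; equivalently, the linear span of all vectors $h(T)\psi$ with $h\in C_c(\sigma(T))$, $\psi\in\mathcal{H}$; this is a dense subspace of $\mathcal{H}$. For $f\in C(\sigma(T))$, the operator $f_0(T)$ has domain $C_c^*(S)\mathcal{H}$ and is defined by linear extension of $f_0(T)h(T)\psi=(fh)(T)\psi$, for $h\in C_c(\sigma(T))$ and $\psi\in\mathcal{H}$. It is closable, and $f(T)=f_0(T)^-$ denotes its closure. For $f\in C_0(\sigma(T))$ this agrees with $f(T)=(f\circ u)(S)$. *)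

theory Defs
  imports "HOL-Analysis.Analysis"
begin

section \<open>Complex Hilbert spaces\<close>

class scaleC =
  fixes scaleC :: "complex \<Rightarrow> 'a \<Rightarrow> 'a" (infixr \<open>*\<^sub>C\<close> 75)

class complex_vector = scaleC + real_vector +
  assumes scaleC_add_right: "a *\<^sub>C (x + y) = a *\<^sub>C x + a *\<^sub>C y"
    and scaleC_add_left: "(a + b) *\<^sub>C x = a *\<^sub>C x + b *\<^sub>C x"
    and scaleC_scaleC: "a *\<^sub>C b *\<^sub>C x = (a * b) *\<^sub>C x"
    and scaleR_scaleC: "r *\<^sub>R x = complex_of_real r *\<^sub>C x"

lemma scaleC_one: "1 *\<^sub>C x = (x :: 'a :: complex_vector)"
  using scaleR_scaleC[of 1 x] by simp

global_interpretation complex_vector: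
  vector_space "scaleC :: complex \<Rightarrow> 'a \<Rightarrow> 'a :: complex_vector"
  defines csubspace = complex_vector.subspace
    and cspan = complex_vector.span
  by unfold_locales
    (simp_all add: scaleC_add_right scaleC_add_left scaleC_scaleC scaleC_one)

instantiation prod :: (complex_vector, complex_vector) complex_vector
begin

definition scaleC_prod :: "complex \<Rightarrow> 'a \<times> 'b \<Rightarrow> 'a \<times> 'b" where
  "scaleC_prod c p = (c *\<^sub>C fst p, c *\<^sub>C snd p)"

instance
  by standard
    (simp_all add: scaleC_prod_def prod_eq_iff scaleC_add_right scaleC_add_left
      scaleC_scaleC scaleR_scaleC)

end

text \<open>The inner product is conjugate-linear in its first and linear in its second argument.\<close>

class complex_inner = complex_vector + real_normed_vector +
  fixes cinner :: "'a \<Rightarrow> 'a \<Rightarrow> complex"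
  assumes cinner_commute: "cinner x y = cnj (cinner y x)"
    and cinner_add_right: "cinner x (y + z) = cinner x y + cinner x z"
    and cinner_scaleC_right: "cinner x (c *\<^sub>C y) = c * cinner x y"
    and cinner_ge_zero: "0 \<le> Re (cinner x x)"
    and cinner_eq_zero_iff: "cinner x x = 0 \<longleftrightarrow> x = 0"
    and norm_eq_sqrt_cinner: "norm x = sqrt (Re (cinner x x))"

class complex_hilbert = complex_inner + complete_space

instantiation complex :: complex_hilbert
begin

definition scaleC_complex :: "complex \<Rightarrow> complex \<Rightarrow> complex" where
  "scaleC_complex c x = c * x"

definition cinner_complex :: "complex \<Rightarrow> complex \<Rightarrow> complex" where
  "cinner_complex x y = cnj x * y"

instance
  by standard
    (auto simp: scaleC_complex_def cinner_complex_def algebra_simps scaleR_conv_of_real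
      cmod_def power2_eq_square)

end

lemma norm_scaleC: "norm (c *\<^sub>C x) = cmod c * norm (x :: 'a :: complex_inner)"
proof -
  have "cinner (c *\<^sub>C x) (c *\<^sub>C x) = c * cnj (cinner x (c *\<^sub>C x))"
    by (metis cinner_commute cinner_scaleC_right)
  also have "\<dots> = (c * cnj c) * cnj (cinner x x)"
    by (simp add: cinner_scaleC_right)
  also have "\<dots> = complex_of_real ((cmod c)\<^sup>2) * cinner x x"
    by (metis cinner_commute complex_norm_square)
  finally show ?thesis
    by (simp add: norm_eq_sqrt_cinner[of "c *\<^sub>C x"] norm_eq_sqrt_cinner[of x] real_sqrt_mult)
qed

lemma bounded_linear_scaleC: "bounded_linear (\<lambda>x :: 'a :: complex_inner. c *\<^sub>C x)"
proof (rule bounded_linear_intro[where K = "cmod c"])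
  fix r :: real and x y :: 'a
  show "c *\<^sub>C (x + y) = c *\<^sub>C x + c *\<^sub>C y"
    by (rule scaleC_add_right)
  show "c *\<^sub>C (r *\<^sub>R x) = r *\<^sub>R (c *\<^sub>C x)"
    by (simp add: scaleR_scaleC scaleC_scaleC mult.commute)
  show "norm (c *\<^sub>C x) \<le> norm x * cmod c"
    by (simp add: norm_scaleC mult.commute)
qed


section \<open>Unbounded operators\<close>

text \<open>
  An operator is identified with its graph, a set of pairs (argument, value). Hence operators are
  equal iff they have the same domain and the same values; \<^const>\<open>Domain\<close>, \<^const>\<open>converse\<close>
  and \<^const>\<open>Id\<close> are domain, inverse and identity operator; and the closure of an operator is
  the topological \<^const>\<open>closure\<close> of its graph in the product space.
\<close>

type_synonym 'a operator = "('a \<times> 'a) set"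

definition linear_operator :: "'a :: complex_vector operator \<Rightarrow> bool" where
  "linear_operator A \<longleftrightarrow> csubspace A \<and> single_valued A"

definition densely_defined :: "'a :: complex_inner operator \<Rightarrow> bool" where
  "densely_defined A \<longleftrightarrow> closure (Domain A) = UNIV"

definition op_adjoint :: "'a :: complex_inner operator \<Rightarrow> 'a operator" where
  "op_adjoint A = {(y, z). \<forall>(x, w) \<in> A. cinner y w = cinner z x}"

definition self_adjoint :: "'a :: complex_inner operator \<Rightarrow> bool" where
  "self_adjoint A \<longleftrightarrow> linear_operator A \<and> densely_defined A \<and> op_adjoint A = A"

definition positive_operator :: "'a :: complex_inner operator \<Rightarrow> bool" where
  "positive_operator A \<longleftrightarrow> (\<forall>(x, y) \<in> A. cinner x y \<in> \<real>\<^sub>\<ge>\<^sub>0)"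

text \<open>Sum and composition on their natural domains; note the order of arguments of \<open>O\<close>.\<close>

definition op_plus :: "'a :: complex_vector operator \<Rightarrow> 'a operator \<Rightarrow> 'a operator" where
  "op_plus A B = {(x, y + z) | x y z. (x, y) \<in> A \<and> (x, z) \<in> B}"

definition op_comp :: "'a operator \<Rightarrow> 'a operator \<Rightarrow> 'a operator" where
  "op_comp A B = B O A"

definition op_sqrt :: "'a :: complex_inner operator \<Rightarrow> 'a operator" where
  "op_sqrt A = (THE B. self_adjoint B \<and> positive_operator B \<and> op_comp B B = A)"


section \<open>Bounded operators\<close>

text \<open>
  The library type of bounded operators consists of the real-linear ones, so \<open>B(H)\<close> is the
  subset of the complex-linear ones.
\<close>

definition bounded_operators :: "('a :: complex_inner \<Rightarrow>\<^sub>L 'a) set" where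
  "bounded_operators = {A. \<forall>c x. blinfun_apply A (c *\<^sub>C x) = c *\<^sub>C blinfun_apply A x}"

lift_definition scaleC_blinfun ::
    "complex \<Rightarrow> ('a :: complex_inner \<Rightarrow>\<^sub>L 'a) \<Rightarrow> ('a \<Rightarrow>\<^sub>L 'a)"
  is "\<lambda>c A x. c *\<^sub>C A x"
  by (rule bounded_linear_compose[OF bounded_linear_scaleC])

definition blinfun_adjoint :: "('a :: complex_inner \<Rightarrow>\<^sub>L 'a) \<Rightarrow> ('a \<Rightarrow>\<^sub>L 'a)" where
  "blinfun_adjoint A =
    (THE B. \<forall>x y. cinner (blinfun_apply A x) y = cinner x (blinfun_apply B y))"

definition blinfun_graph :: "('a :: complex_inner \<Rightarrow>\<^sub>L 'a) \<Rightarrow> 'a operator" where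
  "blinfun_graph A = {(x, blinfun_apply A x) | x. True}"

definition cstar_subalgebra :: "('a :: complex_inner \<Rightarrow>\<^sub>L 'a) set \<Rightarrow> bool" where
  "cstar_subalgebra M \<longleftrightarrow>
    M \<subseteq> bounded_operators \<and> closed M \<and> 0 \<in> M \<and>
    (\<forall>A\<in>M. \<forall>B\<in>M. A + B \<in> M) \<and>
    (\<forall>c. \<forall>A\<in>M. scaleC_blinfun c A \<in> M) \<and>
    (\<forall>A\<in>M. \<forall>B\<in>M. A o\<^sub>L B \<in> M) \<and>
    (\<forall>A\<in>M. blinfun_adjoint A \<in> M)"

text \<open>The C*-algebra generated by \<open>S\<close> and the identity operator.\<close>

definition cstar_algebra :: "('a :: complex_inner \<Rightarrow>\<^sub>L 'a) \<Rightarrow> ('a \<Rightarrow>\<^sub>L 'a) set" where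
  "cstar_algebra S = \<Inter>{M. cstar_subalgebra M \<and> S \<in> M \<and> id_blinfun \<in> M}"


section \<open>Spectrum\<close>

text \<open>
  \<open>z\<close> is in the resolvent set iff \<open>A - z\<close> is a bijection from its domain onto the whole space
  with bounded inverse. For a bounded operator \<open>S\<close>, use \<open>A = blinfun_graph S\<close>.
\<close>

definition spectrum :: "'a :: complex_inner operator \<Rightarrow> complex set" where
  "spectrum A = {z. \<not> (\<exists>B\<in>bounded_operators.
     blinfun_graph B = converse {(x, y - z *\<^sub>C x) | x y. (x, y) \<in> A})}"

text \<open>
  The spectrum as a subset of the real line. It is only used for self-adjoint operators, whose
  spectrum is contained in the reals.
\<close>

definition real_spectrum :: "'a :: complex_inner operator \<Rightarrow> real set" where
  "real_spectrum A = {x. complex_of_real x \<in> spectrum A}"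


section \<open>Function algebras\<close>

text \<open>
  A function on \<open>X\<close> is represented by any function on the reals that has the right values on \<open>X\<close>;
  the values outside \<open>X\<close> are irrelevant.
\<close>

definition C_fun :: "real set \<Rightarrow> (real \<Rightarrow> complex) set" where
  "C_fun X = {f. continuous_on X f}"

definition C0_fun :: "real set \<Rightarrow> (real \<Rightarrow> complex) set" where
  "C0_fun X = {f. continuous_on X f \<and> (\<forall>\<epsilon>>0. compact {x\<in>X. \<epsilon> \<le> cmod (f x)})}"

definition Cc_fun :: "real set \<Rightarrow> (real \<Rightarrow> complex) set" where
  "Cc_fun X = {f. continuous_on X f \<and> compact (X \<inter> closure {x\<in>X. f x \<noteq> 0})}"

text \<open>The inserted \<open>0\<close> only matters for empty \<open>X\<close>, i.e. for the zero Hilbert space.\<close>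

definition sup_norm :: "real set \<Rightarrow> (real \<Rightarrow> complex) \<Rightarrow> real" where
  "sup_norm X f = Sup (insert 0 ((\<lambda>x. cmod (f x)) ` X))"

definition isometric_star_hom ::
    "real set \<Rightarrow> (real \<Rightarrow> complex) set \<Rightarrow> ('a :: complex_inner \<Rightarrow>\<^sub>L 'a) set \<Rightarrow>
      ((real \<Rightarrow> complex) \<Rightarrow> ('a \<Rightarrow>\<^sub>L 'a)) \<Rightarrow> bool" where
  "isometric_star_hom X F M \<Phi> \<longleftrightarrow>
    (\<forall>f\<in>F. \<Phi> f \<in> M) \<and>
    (\<forall>f\<in>F. \<forall>g\<in>F. \<Phi> (\<lambda>x. f x + g x) = \<Phi> f + \<Phi> g) \<and>
    (\<forall>c. \<forall>f\<in>F. \<Phi> (\<lambda>x. c * f x) = scaleC_blinfun c (\<Phi> f)) \<and>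
    (\<forall>f\<in>F. \<forall>g\<in>F. \<Phi> (\<lambda>x. f x * g x) = \<Phi> f o\<^sub>L \<Phi> g) \<and>
    (\<forall>f\<in>F. \<Phi> (\<lambda>x. cnj (f x)) = blinfun_adjoint (\<Phi> f)) \<and>
    (\<forall>f\<in>F. norm (\<Phi> f) = sup_norm X f)"


section \<open>Functional calculus\<close>

text \<open>
  The continuous functional calculus of a bounded self-adjoint operator \<open>S\<close>: the unital isometric
  *-homomorphism from \<open>C(\<sigma>(S))\<close> to \<open>C*(S)\<close> that maps the identity function to \<open>S\<close>. Its value
  at \<open>f\<close> is uniquely determined if \<open>f\<close> is continuous on \<open>\<sigma>(S)\<close>, by the Weierstrass theorem, and
  depends only on the values of \<open>f\<close> on \<open>\<sigma>(S)\<close>, by isometry; so the choice operator only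
  chooses the irrelevant values at other functions.
\<close>

definition cfc :: "('a :: complex_inner \<Rightarrow>\<^sub>L 'a) \<Rightarrow> (real \<Rightarrow> complex) \<Rightarrow> ('a \<Rightarrow>\<^sub>L 'a)" where
  "cfc S = (SOME \<Phi>.
     isometric_star_hom (real_spectrum (blinfun_graph S))
       (C_fun (real_spectrum (blinfun_graph S))) (cstar_algebra S) \<Phi> \<and>
     \<Phi> (\<lambda>x. 1) = id_blinfun \<and> \<Phi> complex_of_real = S)"

text \<open>\<open>S = T (\<surd>(I + T\<^sup>2))\<^sup>-\<^sup>1\<close>\<close>

definition bounded_transform :: "'a :: complex_inner operator \<Rightarrow> ('a \<Rightarrow>\<^sub>L 'a)" where
  "bounded_transform T = (THE S. blinfun_graph S =
     op_comp T (converse (op_sqrt (op_plus Id (op_comp T T)))))"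

definition u_fun :: "real \<Rightarrow> real" where
  "u_fun x = x / sqrt (1 - x\<^sup>2)"

text \<open>\<open>h(T) = (h \<circ> u)(S)\<close> for \<open>h \<in> C\<^sub>0(\<sigma>(T))\<close>, where \<open>h \<circ> u\<close> is extended by \<open>0\<close> to \<open>\<plusminus>1\<close>.\<close>

definition C0_calculus ::
    "'a :: complex_inner operator \<Rightarrow> (real \<Rightarrow> complex) \<Rightarrow> ('a \<Rightarrow>\<^sub>L 'a)" where
  "C0_calculus T h =
    cfc (bounded_transform T) (\<lambda>x. if x \<in> {-1<..<1} then h (u_fun x) else 0)"

text \<open>
  The operator \<open>f\<^sub>0(T)\<close>: the linear extension of \<open>h(T)\<psi> \<mapsto> (fh)(T)\<psi>\<close> has as its graph the
  complex linear span of all pairs \<open>(h(T)\<psi>, (fh)(T)\<psi>)\<close>.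
\<close>

definition calculus0 ::
    "'a :: complex_inner operator \<Rightarrow> (real \<Rightarrow> complex) \<Rightarrow> 'a operator" where
  "calculus0 T f = cspan
    {(blinfun_apply (C0_calculus T h) \<psi>, blinfun_apply (C0_calculus T (\<lambda>x. f x * h x)) \<psi>)
      | h \<psi>. h \<in> Cc_fun (real_spectrum T)}"

lemma Domain_calculus0:
  "Domain (calculus0 T f) =
    cspan {blinfun_apply (C0_calculus T h) \<psi> | h \<psi>. h \<in> Cc_fun (real_spectrum T)}"
    (is "_ = cspan ?D")
proof -
  have hom: "module_hom scaleC scaleC (fst :: 'a \<times> 'a \<Rightarrow> 'a)"
    by (intro module_hom.intro module_hom_axioms.intro complex_vector.module_axioms)
      (simp_all add: scaleC_prod_def)
  let ?G = "{(blinfun_apply (C0_calculus T h) \<psi>, blinfun_apply (C0_calculus T (\<lambda>x. f x * h x)) \<psi>)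
      | h \<psi>. h \<in> Cc_fun (real_spectrum T)}"
  have "?D = fst ` ?G"
    by (force simp: image_iff)
  then show ?thesis
    using module_hom.span_image[OF hom, of ?G]
    by (simp add: calculus0_def cspan_def Domain_fst)
qed

definition calculus ::
    "'a :: complex_inner operator \<Rightarrow> (real \<Rightarrow> complex) \<Rightarrow> 'a operator" where
  "calculus T f = closure (calculus0 T f)"

end

(*
Write S for the bounded transform of T. Since the relevant functions vanish at the points 1 and -1,
h(T) = (h o u)(S) reduces everything to the continuous functional calculus of S. The key point is
that f(T) has a description without closures: (x, y) lies in f(T) iff (fg)(T) x = g(T) y for all
compactly supported g. Unfolding the definition, the adjoint of f_0(T) is the operator that
satisfies this test for the conjugate of f; and the closure of f_0(T) satisfies the test for f,
because cutoff functions e_n give e_n(T) x --> x strongly (the range of I - S^2 is dense and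
(e_n o u)(1 - x^2) --> 1 - x^2 uniformly).

The bounded transform is built from R = (I + T^2)^-1 and Q = R^(1/2) as S = T Q; then
S^2 = I - R, and T - t is bounded below iff S - t/sqrt(1 + t^2) is, which identifies the spectra.
*)
theory Submission
  imports Defs "HOL-Computational_Algebra.Fundamental_Theorem_Algebra"
begin

text \<open>The spectrum is handled through lower bounds only: for a self-adjoint operator and real
  \<open>t\<close>, a lower bound for \<open>A - t\<close> already yields a bounded inverse, since
  the orthogonal complement of the range is the kernel of the adjoint. For bounded \<open>S\<close>
  the norm of \<open>p(S)\<close> is matched with the values of \<open>p\<close> on the spectrum by
  splitting polynomials into linear factors and by the fact that the squared norm of a Hermitian
  operator is an approximate eigenvalue of its square.

  Two objects are known only by a description and have to be pinned down before anything can be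
  computed. \<open>cfc\<close> is a chosen homomorphism, so it is identified with limits of
  polynomials. \<open>bounded_transform\<close> contains an unbounded square root; its uniqueness is
  moved to the bounded inverse, where any positive root of \<open>R\<close> must agree with the root
  \<open>Q\<close> that commutes with everything commuting with \<open>R\<close>.

  Functions live on all reals with irrelevant values off the spectrum, so a function that is real on
  the spectrum may still differ from its conjugate; congruence lemmas bridge this.\<close>

instance complex_hilbert \<subseteq> banach ..

section \<open>Complex inner product spaces\<close>

lemma cinner_add_left: "cinner (x + y) z = cinner x z + cinner (y :: 'a :: complex_inner) z"
  by (metis cinner_add_right cinner_commute complex_cnj_add)

lemma cinner_scaleC_left: "cinner (c *\<^sub>C x) y = cnj c * cinner (x :: 'a :: complex_inner) y"
  by (metis cinner_commute cinner_scaleC_right complex_cnj_mult)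

lemma scaleC_minus_one: "(-1) *\<^sub>C x = - (x :: 'a :: complex_vector)"
  using scaleR_scaleC[of "-1" x] by simp

lemma scaleC_zero_right: "c *\<^sub>C (0 :: 'a :: complex_vector) = 0"
  using scaleC_add_right[of c 0 0] by simp

lemma scaleC_minus_right: "c *\<^sub>C (- x) = - (c *\<^sub>C (x :: 'a :: complex_vector))"
  by (metis scaleC_minus_one scaleC_scaleC mult.commute)

lemma scaleC_diff_right: "c *\<^sub>C (x - y) = c *\<^sub>C x - c *\<^sub>C (y :: 'a :: complex_vector)"
  using scaleC_add_right[of c x "- y"] by (simp add: scaleC_minus_right)

lemma scaleC_zero_left: "0 *\<^sub>C x = (0 :: 'a :: complex_vector)"
  using scaleR_scaleC[of 0 x] by simp

lemma scaleC_minus_left: "(- c) *\<^sub>C x = - (c *\<^sub>C (x :: 'a :: complex_vector))"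
  by (metis scaleC_minus_one scaleC_scaleC mult_minus1)

lemma cinner_minus_right: "cinner x (- y) = - cinner x (y :: 'a :: complex_inner)"
  by (metis cinner_scaleC_right mult_minus1 scaleC_minus_one)

lemma cinner_minus_left: "cinner (- x) y = - cinner x (y :: 'a :: complex_inner)"
  by (metis cinner_commute cinner_minus_right complex_cnj_minus)

lemma cinner_diff_right: "cinner x (y - z) = cinner x y - cinner x (z :: 'a :: complex_inner)"
  using cinner_add_right[of x y "- z"] by (simp add: cinner_minus_right)

lemma cinner_diff_left: "cinner (x - y) z = cinner x z - cinner y (z :: 'a :: complex_inner)"
  using cinner_add_left[of x "- y" z] by (simp add: cinner_minus_left)

lemma cinner_zero_right [simp]: "cinner x (0 :: 'a :: complex_inner) = 0"
  using cinner_diff_right[of x 0 0] by simp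

lemma cinner_zero_left [simp]: "cinner (0 :: 'a :: complex_inner) x = 0"
  using cinner_diff_left[of 0 0 x] by simp

lemma cinner_self: "cinner x x = complex_of_real ((norm (x :: 'a :: complex_inner))\<^sup>2)"
proof -
  have "Im (cinner x x) = 0"
    using arg_cong[OF cinner_commute[of x x], of Im] by simp
  then show ?thesis
    by (simp add: norm_eq_sqrt_cinner cinner_ge_zero complex_eq_iff)
qed

lemma norm_sq_eq: "(norm x)\<^sup>2 = Re (cinner x (x :: 'a :: complex_inner))"
  by (simp add: cinner_self)

lemma norm_add_sq:
  "(norm (x + y))\<^sup>2 = (norm x)\<^sup>2 + 2 * Re (cinner x y) + (norm (y :: 'a :: complex_inner))\<^sup>2"
proof -
  have "Re (cinner y x) = Re (cinner x y)"
    by (metis cinner_commute complex_cnj(1) complex_surj complex.sel(1))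
  then show ?thesis
    by (simp add: norm_sq_eq cinner_add_left cinner_add_right)
qed

lemma norm_diff_sq:
  "(norm (x - y))\<^sup>2 = (norm x)\<^sup>2 - 2 * Re (cinner x y) + (norm (y :: 'a :: complex_inner))\<^sup>2"
  using norm_add_sq[of x "- y"] by (simp add: cinner_minus_right)

text \<open>The subtracted vector is the orthogonal projection of \<open>y\<close> onto the line
  through \<open>x\<close>, so this is Pythagoras. It serves twice: nonnegativity of the left side
  gives Cauchy-Schwarz, and the decrease on the right shows that a nearest point yields
  orthogonality.\<close>

lemma norm_diff_projection_sq:
  assumes "x \<noteq> (0 :: 'a :: complex_inner)"
  shows "(norm (y - (cinner x y / cinner x x) *\<^sub>C x))\<^sup>2
    = (norm y)\<^sup>2 - (cmod (cinner x y))\<^sup>2 / (norm x)\<^sup>2"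
proof -
  define c where "c = cinner x y / cinner x x"
  define n where "n = (norm x)\<^sup>2"
  have n: "n > 0" using assms by (simp add: n_def)
  have c: "c = cinner x y / complex_of_real n"
    by (simp add: c_def n_def cinner_self)
  have *: "cinner y x = cnj (cinner x y)" by (rule cinner_commute)
  have "c * cinner y x = complex_of_real ((cmod (cinner x y))\<^sup>2 / n)"
    by (simp add: c * complex_norm_square flip: of_real_power)
  moreover have "(norm (c *\<^sub>C x))\<^sup>2 = (cmod (cinner x y))\<^sup>2 / n"
    using n by (simp add: norm_scaleC c norm_divide power_mult_distrib power_divide
      flip: n_def) (simp add: power2_eq_square)
  ultimately show ?thesis
    by (simp add: norm_diff_sq cinner_scaleC_right flip: c_def n_def)
qed

lemma cinner_cauchy_schwarz: "cmod (cinner x y) \<le> norm x * norm (y :: 'a :: complex_inner)"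
proof (cases "x = 0")
  case False
  then have "0 \<le> (norm y)\<^sup>2 - (cmod (cinner x y))\<^sup>2 / (norm x)\<^sup>2"
    by (metis norm_diff_projection_sq zero_le_power2)
  then have "(cmod (cinner x y))\<^sup>2 \<le> (norm x * norm y)\<^sup>2"
    using False by (simp add: field_simps power_mult_distrib)
  then show ?thesis
    by (rule power2_le_imp_le) simp
qed simp

lemma cinner_bounded_bilinear: "bounded_bilinear (cinner :: 'a :: complex_inner \<Rightarrow> _)"
proof
  fix r :: real and a b :: 'a
  show "cinner (r *\<^sub>R a) b = r *\<^sub>R cinner a b"
    by (simp add: scaleR_scaleC[of r a] cinner_scaleC_left scaleR_conv_of_real)
  show "cinner a (r *\<^sub>R b) = r *\<^sub>R cinner a b"
    by (simp add: scaleR_scaleC[of r b] cinner_scaleC_right scaleR_conv_of_real)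
  show "\<exists>K. \<forall>(a::'a) b. norm (cinner a b) \<le> norm a * norm b * K"
    using cinner_cauchy_schwarz by (metis mult.right_neutral)
qed (simp_all add: cinner_add_left cinner_add_right)

lemmas tendsto_cinner = bounded_bilinear.tendsto[OF cinner_bounded_bilinear]
lemmas tendsto_scaleC = bounded_linear.tendsto[OF bounded_linear_scaleC]

lemma continuous_on_cinner:
  "continuous_on X f \<Longrightarrow> continuous_on X g \<Longrightarrow>
    continuous_on X (\<lambda>x. cinner (f x) (g x :: 'a :: complex_inner))"
  by (rule bounded_bilinear.continuous_on[OF cinner_bounded_bilinear])

lemma cinner_ext_left:
  assumes "\<And>y. cinner x y = cinner x' (y :: 'a :: complex_inner)"
  shows "x = x'"
proof -
  have "cinner (x - x') (x - x') = 0"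
    using assms by (simp add: cinner_diff_left)
  then show ?thesis by (simp add: cinner_eq_zero_iff)
qed

lemma cinner_ext_right:
  assumes "\<And>y. cinner y x = cinner (y :: 'a :: complex_inner) x'"
  shows "x = x'"
  by (rule cinner_ext_left) (metis assms cinner_commute)

lemma parallelogram:
  "(norm (x + y))\<^sup>2 + (norm (x - y))\<^sup>2 = 2 * (norm x)\<^sup>2 + 2 * (norm (y :: 'a :: complex_inner))\<^sup>2"
  by (simp add: norm_add_sq norm_diff_sq)

section \<open>Complex subspaces, nearest points and density\<close>

lemma csubspace_iff:
  "csubspace M \<longleftrightarrow> 0 \<in> M \<and> (\<forall>x\<in>M. \<forall>y\<in>M. x + y \<in> M) \<and> (\<forall>c. \<forall>x\<in>M. c *\<^sub>C x \<in> M)"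
  by (rule complex_vector.subspace_def)

lemma csubspace_diff: "csubspace M \<Longrightarrow> x \<in> M \<Longrightarrow> y \<in> M \<Longrightarrow> x - y \<in> M"
  by (rule complex_vector.subspace_diff)

text \<open>The parallelogram law makes a minimizing sequence Cauchy, so completeness supplies the
  minimizer.\<close>

lemma exists_nearest_point:
  fixes M :: "'a :: complex_hilbert set"
  assumes M: "csubspace M" "closed M"
  obtains m where "m \<in> M" "\<And>x. x \<in> M \<Longrightarrow> norm (w - m) \<le> norm (w - x)"
proof -
  define d where "d = infdist w M"
  have ne: "M \<noteq> {}" using M by (auto simp: csubspace_iff)
  have le: "d \<le> norm (w - x)" if "x \<in> M" for x
    using that by (simp add: d_def infdist_le dist_norm[symmetric])
  have d0: "0 \<le> d" by (simp add: d_def infdist_nonneg)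
  have "\<exists>x\<in>M. norm (w - x) < d + 1 / real (Suc n)" for n
  proof -
    have "(INF x\<in>M. dist w x) < d + 1 / real (Suc n)"
      using ne by (simp add: d_def infdist_notempty)
    then show ?thesis
      using ne by (subst (asm) cINF_less_iff) (auto simp: dist_norm intro!: bdd_belowI2[of _ 0])
  qed
  then obtain x where x: "x n \<in> M" "norm (w - x n) < d + 1 / real (Suc n)" for n
    by metis
  \<comment> \<open>The midpoint of \<open>x m\<close> and \<open>x n\<close> lies in
    \<open>M\<close> and so has distance at least \<open>d\<close> from \<open>w\<close>; the
    parallelogram law then leaves \<open>4(d + e)^2 - 4d^2 = 8de + 4e^2\<close>, and
    \<open>e \<le> 1\<close> makes this linear in \<open>e\<close>.\<close>
  have close: "(norm (x m - x n))\<^sup>2 \<le> (8 * d + 4) / real (Suc N)" if "N \<le> m" "N \<le> n" for m n N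
  proof -
    define e where "e = 1 / real (Suc N)"
    have e: "0 < e" "e \<le> 1" by (auto simp: e_def)
    have mem: "(1/2) *\<^sub>C (x m + x n) \<in> M"
      using M x unfolding csubspace_iff by blast
    have half: "(w - x m) + (w - x n) = 2 *\<^sub>C (w - (1/2) *\<^sub>C (x m + x n))"
    proof -
      have "2 *\<^sub>C w = w + w"
        using scaleR_scaleC[of 2 w] by (simp add: scaleR_2)
      then show ?thesis by (simp add: scaleC_diff_right scaleC_scaleC scaleC_one)
    qed
    have lower: "2 * d \<le> norm ((w - x m) + (w - x n))"
      unfolding half norm_scaleC using le[OF mem] by simp
    have upper: "norm (w - x k) \<le> d + e" if "N \<le> k" for k
    proof -
      have "1 / real (Suc k) \<le> e" using that by (simp add: e_def frac_le)
      then show ?thesis using x(2)[of k] by linarith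
    qed
    have "(norm (x m - x n))\<^sup>2 = (norm ((w - x n) - (w - x m)))\<^sup>2" by simp
    also have "\<dots> = 2 * (norm (w - x n))\<^sup>2 + 2 * (norm (w - x m))\<^sup>2 - (norm ((w - x m) + (w - x n)))\<^sup>2"
      using parallelogram[of "w - x n" "w - x m"] by (simp add: add.commute)
    also have "\<dots> \<le> 2 * (d + e)\<^sup>2 + 2 * (d + e)\<^sup>2 - (2 * d)\<^sup>2"
      using upper[OF that(1)] upper[OF that(2)] lower d0
      by (intro add_mono diff_mono mult_left_mono power_mono) auto
    also have "\<dots> = 8 * d * e + 4 * e * e"
      by (simp add: power2_eq_square algebra_simps)
    also have "\<dots> \<le> 8 * d * e + 4 * e * 1"
      using e by (intro add_left_mono mult_left_mono) auto
    finally show ?thesis by (simp add: e_def add_divide_distrib)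
  qed
  have "Cauchy x"
  proof (rule metric_CauchyI)
    fix r :: real assume r: "0 < r"
    obtain N where N: "(8 * d + 4) / r\<^sup>2 < real N" using reals_Archimedean2 by blast
    have "(8 * d + 4) < real (Suc N) * r\<^sup>2"
      using N r by (simp add: field_simps) (smt (verit) zero_le_power2)
    then have N': "(8 * d + 4) / real (Suc N) < r\<^sup>2"
      by (simp add: field_simps)
    have "dist (x m) (x n) < r" if "N \<le> m" "N \<le> n" for m n
    proof (rule power2_less_imp_less)
      show "(dist (x m) (x n))\<^sup>2 < r\<^sup>2"
        using close[OF that] N' by (simp add: dist_norm)
    qed (use r in simp)
    then show "\<exists>M. \<forall>m\<ge>M. \<forall>n\<ge>M. dist (x m) (x n) < r" by blast
  qed
  then obtain m where m: "x \<longlonglongrightarrow> m"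
    by (auto simp: Cauchy_convergent_iff convergent_def)
  have "m \<in> M"
    using M(2) m x(1) closed_sequentially by blast
  moreover have "norm (w - m) \<le> d"
  proof (rule LIMSEQ_le)
    show "(\<lambda>n. norm (w - x n)) \<longlonglongrightarrow> norm (w - m)" by (intro tendsto_intros m)
    show "(\<lambda>n. d + 1 / real (Suc n)) \<longlonglongrightarrow> d"
      using tendsto_add[OF tendsto_const LIMSEQ_inverse_real_of_nat, of d]
      by (simp add: inverse_eq_divide)
    show "\<exists>N. \<forall>n\<ge>N. norm (w - x n) \<le> d + 1 / real (Suc n)"
      using x(2) less_imp_le by blast
  qed
  ultimately show ?thesis using le that by force
qed

text \<open>A vector minus its nearest point in \<open>M\<close> is orthogonal to \<open>M\<close>,
  and by assumption only 0 is.\<close>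

lemma closed_csubspace_eq_UNIV:
  fixes M :: "'a :: complex_hilbert set"
  assumes M: "csubspace M" "closed M" and orth: "\<And>y. (\<And>x. x \<in> M \<Longrightarrow> cinner x y = 0) \<Longrightarrow> y = 0"
  shows "M = UNIV"
proof -
  have "w \<in> M" for w
  proof -
    obtain m where m: "m \<in> M" "\<And>x. x \<in> M \<Longrightarrow> norm (w - m) \<le> norm (w - x)"
      using exists_nearest_point[OF M] by blast
    have "cinner x (w - m) = 0" if x: "x \<in> M" for x
    proof (cases "x = 0")
      case False
      \<comment> \<open>The best correction of \<open>m\<close> in the direction of
        \<open>x\<close>. Since \<open>m\<close> is already nearest, the correction cannot shorten
        the distance, so the inner product vanishes.\<close>
      define c where "c = cinner x (w - m) / cinner x x"
      have "m + c *\<^sub>C x \<in> M" using M x m unfolding csubspace_iff by blast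
      then have "norm (w - m) \<le> norm (w - m - c *\<^sub>C x)"
        using m(2) by (metis diff_diff_eq)
      then have "(norm (w - m))\<^sup>2 \<le> (norm (w - m - c *\<^sub>C x))\<^sup>2"
        by (intro power_mono) auto
      then have "(cmod (cinner x (w - m)))\<^sup>2 / (norm x)\<^sup>2 \<le> 0"
        using norm_diff_projection_sq[OF False, of "w - m"] by (simp add: c_def)
      then show ?thesis using False by (simp add: divide_le_0_iff)
    qed simp
    then show ?thesis using orth[of "w - m"] m(1) by auto
  qed
  then show ?thesis by blast
qed

lemma csubspace_closure:
  fixes M :: "'a :: complex_inner set"
  assumes "csubspace M"
  shows "csubspace (closure M)"
  unfolding csubspace_iff
proof (intro conjI ballI allI)
  show "0 \<in> closure M" using assms closure_subset by (auto simp: csubspace_iff)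
next
  fix x y assume "x \<in> closure M" "y \<in> closure M"
  then obtain f g where "\<And>n. f n \<in> M" "f \<longlonglongrightarrow> x" "\<And>n. g n \<in> M" "g \<longlonglongrightarrow> y"
    unfolding closure_sequential by metis
  then show "x + y \<in> closure M"
    using assms unfolding closure_sequential csubspace_iff
    by (intro exI[of _ "\<lambda>n. f n + g n"]) (auto intro: tendsto_add)
next
  fix x c assume "x \<in> closure M"
  then obtain f where "\<And>n. f n \<in> M" "f \<longlonglongrightarrow> x"
    unfolding closure_sequential by metis
  then show "c *\<^sub>C x \<in> closure M"
    using assms unfolding closure_sequential csubspace_iff
    by (intro exI[of _ "\<lambda>n. c *\<^sub>C f n"]) (auto intro: tendsto_scaleC)
qed

lemma csubspace_dense:
  fixes M :: "'a :: complex_hilbert set"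
  assumes "csubspace M" "\<And>y. (\<And>x. x \<in> M \<Longrightarrow> cinner x y = 0) \<Longrightarrow> y = 0"
  shows "closure M = UNIV"
  by (rule closed_csubspace_eq_UNIV)
    (use assms in \<open>auto intro: csubspace_closure simp: closure_subset[THEN subsetD]\<close>)

section \<open>Self-adjoint operators and their spectrum\<close>

lemma self_adjoint_csubspace: "self_adjoint A \<Longrightarrow> csubspace A"
  by (simp add: self_adjoint_def linear_operator_def)

lemma self_adjoint_single_valued: "self_adjoint A \<Longrightarrow> (x, y) \<in> A \<Longrightarrow> (x, z) \<in> A \<Longrightarrow> y = z"
  by (auto simp: self_adjoint_def linear_operator_def single_valued_def)

lemma self_adjoint_symmetric:
  "self_adjoint A \<Longrightarrow> (x, y) \<in> A \<Longrightarrow> (x', y') \<in> A \<Longrightarrow> cinner x y' = cinner y x'"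
  unfolding self_adjoint_def op_adjoint_def by (blast dest: equalityD2)

lemma self_adjoint_memI:
  "self_adjoint A \<Longrightarrow> (\<And>x w. (x, w) \<in> A \<Longrightarrow> cinner y w = cinner z x) \<Longrightarrow> (y, z) \<in> A"
  by (auto simp: self_adjoint_def op_adjoint_def)

lemma csubspace_graphI:
  assumes "(0, 0) \<in> A"
    and "\<And>x y x' y'. (x, y) \<in> A \<Longrightarrow> (x', y') \<in> A \<Longrightarrow> (x + x', y + y') \<in> A"
    and "\<And>c x y. (x, y) \<in> A \<Longrightarrow> (c *\<^sub>C x, c *\<^sub>C y) \<in> A"
  shows "csubspace A"
  using assms unfolding csubspace_iff
  by (simp add: zero_prod_def scaleC_prod_def Ball_def split_paired_all)

lemma op_adjoint_eq_INT:
  "op_adjoint A = (\<Inter>(x, w) \<in> A. {p. cinner (fst p) w = cinner (snd p) x})"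
  by (auto simp: op_adjoint_def)

lemma closed_op_adjoint: "closed (op_adjoint A)"
  unfolding op_adjoint_eq_INT
  by (intro closed_INT) (auto intro!: closed_Collect_eq continuous_on_cinner continuous_intros)

lemma csubspace_op_adjoint: "csubspace (op_adjoint A)"
  by (rule csubspace_graphI)
    (auto simp: op_adjoint_def cinner_add_left cinner_scaleC_left split: prod.splits)

lemma self_adjoint_closed: "self_adjoint A \<Longrightarrow> closed A"
  using closed_op_adjoint[of A] by (simp add: self_adjoint_def)

lemma csubspace_graph:
  assumes "csubspace A"
  shows "(0, 0) \<in> A"
    and "(x, y) \<in> A \<Longrightarrow> (x', y') \<in> A \<Longrightarrow> (x + x', y + y') \<in> A"
    and "(x, y) \<in> A \<Longrightarrow> (c *\<^sub>C x, c *\<^sub>C y) \<in> A"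
    and "(x, y) \<in> A \<Longrightarrow> (x', y') \<in> A \<Longrightarrow> (x - x', y - y') \<in> A"
proof -
  note * = assms[unfolded csubspace_iff]
  show "(0, 0) \<in> A" using * by (simp add: zero_prod_def)
  show "(x, y) \<in> A \<Longrightarrow> (x', y') \<in> A \<Longrightarrow> (x + x', y + y') \<in> A"
    using * by (metis add_Pair)
  show "(x, y) \<in> A \<Longrightarrow> (c *\<^sub>C x, c *\<^sub>C y) \<in> A"
    using * by (metis scaleC_prod_def fst_conv snd_conv)
  show "(x, y) \<in> A \<Longrightarrow> (x', y') \<in> A \<Longrightarrow> (x - x', y - y') \<in> A"
    using csubspace_diff[OF assms, of "(x, y)" "(x', y')"] by simp
qed

section \<open>Bounded operators as graphs, resolvents and the real spectrum\<close>

lemma blinfun_graph_iff [simp]: "(x, y) \<in> blinfun_graph B \<longleftrightarrow> y = blinfun_apply B x"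
  by (auto simp: blinfun_graph_def)

lemma blinfun_graph_inject: "blinfun_graph A = blinfun_graph B \<Longrightarrow> A = B"
  by (metis blinfun_eqI blinfun_graph_iff)

lemma bounded_operators_scaleC:
  "B \<in> bounded_operators \<Longrightarrow> blinfun_apply B (c *\<^sub>C x) = c *\<^sub>C blinfun_apply B x"
  by (simp add: bounded_operators_def)

lemma scaleC_blinfun_apply [simp]:
  "blinfun_apply (scaleC_blinfun c A) x = c *\<^sub>C blinfun_apply A x"
  by (simp add: scaleC_blinfun.rep_eq)

text \<open>The bound applied to \<open>(0, y - y')\<close> forces single-valuedness, and linearity
  of the graph becomes linearity of the chosen function. Resolvents, the transform \<open>S\<close>
  and inverses of unbounded square roots are all obtained as bounded operators in this way.\<close>

lemma everywhere_defined_blinfun: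
  fixes G :: "'a :: complex_inner operator"
  assumes lin: "csubspace G" and dom: "\<And>x. \<exists>y. (x, y) \<in> G"
    and bound: "\<And>x y. (x, y) \<in> G \<Longrightarrow> norm y \<le> K * norm x"
  obtains B where "B \<in> bounded_operators" "blinfun_graph B = G"
proof -
  note G = csubspace_graph[OF lin]
  have uniq: "y = y'" if "(x, y) \<in> G" "(x, y') \<in> G" for x y y'
    using bound[OF G(4)[OF that]] by simp
  define b where "b x = (SOME y. (x, y) \<in> G)" for x
  have b: "(x, b x) \<in> G" for x
    unfolding b_def by (rule someI_ex[OF dom])
  have bC: "b (c *\<^sub>C x) = c *\<^sub>C b x" for c x
    using uniq b G(3) by blast
  have "bounded_linear b"
  proof (rule bounded_linear_intro[where K = K])
    show "b (x + y) = b x + b y" for x y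
      using uniq b G(2) by blast
    show "b (r *\<^sub>R x) = r *\<^sub>R b x" for r x
      using bC by (simp add: scaleR_scaleC)
    show "norm (b x) \<le> norm x * K" for x
      using bound[OF b] by (simp add: mult.commute)
  qed
  then have "blinfun_apply (Blinfun b) = b"
    by (rule bounded_linear_Blinfun_apply)
  then have "Blinfun b \<in> bounded_operators" "blinfun_graph (Blinfun b) = G"
    using bC b uniq by (auto simp: bounded_operators_def)
  then show ?thesis using that by blast
qed

text \<open>The lower bound makes the range of \<open>A - z\<close> closed, and a vector orthogonal
  to that range lies in the kernel of \<open>A - cnj z\<close> because \<open>A\<close> is its own
  adjoint; \<open>inj\<close> reduces this kernel to 0, so the range is everything. The inverse is
  then bounded by \<open>1 / \<delta>\<close>.\<close>

lemma self_adjoint_resolvent: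
  fixes A :: "'a :: complex_hilbert operator"
  assumes A: "self_adjoint A" and \<delta>: "0 < \<delta>"
    and below: "\<And>x y. (x, y) \<in> A \<Longrightarrow> \<delta> * norm x \<le> norm (y - z *\<^sub>C x)"
    and inj: "\<And>x. (x, cnj z *\<^sub>C x) \<in> A \<Longrightarrow> x = 0"
  obtains B where "B \<in> bounded_operators"
    "blinfun_graph B = converse {(x, y - z *\<^sub>C x) | x y. (x, y) \<in> A}"
proof -
  note A' = csubspace_graph[OF self_adjoint_csubspace[OF A]]
  define M where "M = {y - z *\<^sub>C x | x y. (x, y) \<in> A}"
  define G where "G = converse {(x, y - z *\<^sub>C x) | x y. (x, y) \<in> A}"
  have G_iff: "(w, x) \<in> G \<longleftrightarrow> (x, w + z *\<^sub>C x) \<in> A" for w x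
  proof -
    have "w = y - z *\<^sub>C x \<longleftrightarrow> y = w + z *\<^sub>C x" for y
      by (metis add_diff_cancel diff_add_cancel)
    then show ?thesis by (simp add: G_def)
  qed
  have M_iff: "w \<in> M \<longleftrightarrow> (\<exists>x. (x, w + z *\<^sub>C x) \<in> A)" for w
  proof -
    have "w = y - z *\<^sub>C x \<longleftrightarrow> y = w + z *\<^sub>C x" for x y
      by (metis add_diff_cancel diff_add_cancel)
    then show ?thesis by (simp add: M_def)
  qed
  have G: "csubspace G"
  proof (rule csubspace_graphI; unfold G_iff)
    show "(0, 0 + z *\<^sub>C 0) \<in> A" using A'(1) by (simp add: scaleC_zero_right)
  next
    fix w x w' x' assume "(x, w + z *\<^sub>C x) \<in> A" "(x', w' + z *\<^sub>C x') \<in> A"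
    from A'(2)[OF this] show "(x + x', w + w' + z *\<^sub>C (x + x')) \<in> A"
      by (simp add: scaleC_add_right ac_simps)
  next
    fix c w x assume "(x, w + z *\<^sub>C x) \<in> A"
    from A'(3)[OF this, of c] show "(c *\<^sub>C x, c *\<^sub>C w + z *\<^sub>C c *\<^sub>C x) \<in> A"
      by (simp add: scaleC_add_right scaleC_scaleC mult.commute)
  qed
  have G_bound: "\<delta> * norm x \<le> norm w" if "(w, x) \<in> G" for w x
    using below[of x "w + z *\<^sub>C x"] that by (simp add: G_iff)
  have "M = UNIV"
  proof (rule closed_csubspace_eq_UNIV)
    have "w \<in> M \<longleftrightarrow> (\<exists>x. (w, x) \<in> G)" for w by (simp add: M_iff G_iff)
    then show "csubspace M"
      unfolding csubspace_iff using csubspace_graph[OF G] by meson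
  next
    show "closed M"
      unfolding closed_sequential_limits
    proof (intro allI impI, elim conjE)
      fix w l assume w: "\<forall>n. w n \<in> M" "w \<longlonglongrightarrow> l"
      then obtain x where x: "(w n, x n) \<in> G" for n
        unfolding M_iff G_iff by metis
      \<comment> \<open>The lower bound turns convergence of the images into convergence of the
        preimages; closedness of the graph of \<open>A\<close> then puts the limit pair into
        \<open>A\<close>.\<close>
      have "Cauchy x"
      proof (rule metric_CauchyI)
        fix e :: real assume "0 < e"
        moreover have "Cauchy w" using w(2) by (auto intro: LIMSEQ_imp_Cauchy)
        ultimately obtain N where N: "\<And>m n. N \<le> m \<Longrightarrow> N \<le> n \<Longrightarrow> dist (w m) (w n) < \<delta> * e"
          using \<delta> by (metis metric_CauchyD mult_pos_pos)
        have "\<delta> * dist (x m) (x n) \<le> dist (w m) (w n)" for m n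
          using G_bound[OF csubspace_graph(4)[OF G x x]] by (simp add: dist_norm)
        with N have "\<delta> * dist (x m) (x n) < \<delta> * e" if "N \<le> m" "N \<le> n" for m n
          using that by (meson le_less_trans)
        then show "\<exists>M. \<forall>m\<ge>M. \<forall>n\<ge>M. dist (x m) (x n) < e" using \<delta> by auto
      qed
      then obtain u where u: "x \<longlonglongrightarrow> u" by (auto simp: Cauchy_convergent_iff convergent_def)
      have "(\<lambda>n. (x n, w n + z *\<^sub>C x n)) \<longlonglongrightarrow> (u, l + z *\<^sub>C u)"
        by (intro tendsto_Pair tendsto_add w(2) u tendsto_scaleC)
      then have "(u, l + z *\<^sub>C u) \<in> A"
        using self_adjoint_closed[OF A] x unfolding G_iff by (rule_tac closed_sequentially) auto
      then show "l \<in> M" by (auto simp: M_iff)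
    qed
  next
    fix y assume orth: "\<And>w. w \<in> M \<Longrightarrow> cinner w y = 0"
    have "(y, cnj z *\<^sub>C y) \<in> A"
    proof (rule self_adjoint_memI[OF A])
      fix x w assume "(x, w) \<in> A"
      then have "cinner (w - z *\<^sub>C x) y = 0" by (intro orth) (auto simp: M_def)
      then have "cinner y w = cinner y (z *\<^sub>C x)"
        by (metis cinner_commute cinner_diff_left eq_iff_diff_eq_0)
      then show "cinner y w = cinner (cnj z *\<^sub>C y) x"
        by (simp add: cinner_scaleC_left cinner_scaleC_right)
    qed
    then show "y = 0" by (rule inj)
  qed
  then have dom: "\<exists>x. (w, x) \<in> G" for w
    unfolding G_iff using M_iff by blast
  have "norm x \<le> (1 / \<delta>) * norm w" if "(w, x) \<in> G" for w x
    using G_bound[OF that] \<delta> by (simp add: field_simps)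
  from everywhere_defined_blinfun[OF G dom this] show ?thesis
    using that unfolding G_def by blast
qed

text \<open>A real \<open>t\<close> is its own conjugate, so the lower bound also gives the
  injectivity that \<open>self_adjoint_resolvent\<close> asks for. Real spectral points are thus
  exactly the real approximate eigenvalues.\<close>

lemma real_spectrum_iff:
  fixes A :: "'a :: complex_hilbert operator"
  assumes A: "self_adjoint A"
  shows "t \<in> real_spectrum A \<longleftrightarrow>
    \<not> (\<exists>\<delta>>0. \<forall>x y. (x, y) \<in> A \<longrightarrow> \<delta> * norm x \<le> norm (y - t *\<^sub>R x))"
proof -
  have "(\<exists>B\<in>bounded_operators.
     blinfun_graph B = converse {(x, y - complex_of_real t *\<^sub>C x) | x y. (x, y) \<in> A}) \<longleftrightarrow>
    (\<exists>\<delta>>0. \<forall>x y. (x, y) \<in> A \<longrightarrow> \<delta> * norm x \<le> norm (y - t *\<^sub>R x))"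
  proof
    assume "\<exists>B\<in>bounded_operators.
      blinfun_graph B = converse {(x, y - complex_of_real t *\<^sub>C x) | x y. (x, y) \<in> A}"
    then obtain B where
      B: "blinfun_graph B = converse {(x, y - complex_of_real t *\<^sub>C x) | x y. (x, y) \<in> A}"
      by blast
    \<comment> \<open>The summand 1 keeps the constant meaningful when \<open>B\<close> is
      0.\<close>
    have "1 / (norm B + 1) * norm x \<le> norm (y - t *\<^sub>R x)" if "(x, y) \<in> A" for x y
    proof -
      have "(y - t *\<^sub>R x, x) \<in> blinfun_graph B"
        unfolding B using that by (auto simp: scaleR_scaleC)
      then have "norm x \<le> norm B * norm (y - t *\<^sub>R x)"
        using norm_blinfun[of B "y - t *\<^sub>R x"] by simp
      also have "\<dots> \<le> (norm B + 1) * norm (y - t *\<^sub>R x)"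
        by (intro mult_right_mono) auto
      finally show ?thesis by (simp add: pos_divide_le_eq add_nonneg_pos mult.commute)
    qed
    moreover have "0 < 1 / (norm B + 1)" by (simp add: add_nonneg_pos)
    ultimately show "\<exists>\<delta>>0. \<forall>x y. (x, y) \<in> A \<longrightarrow> \<delta> * norm x \<le> norm (y - t *\<^sub>R x)" by blast
  next
    assume "\<exists>\<delta>>0. \<forall>x y. (x, y) \<in> A \<longrightarrow> \<delta> * norm x \<le> norm (y - t *\<^sub>R x)"
    then obtain \<delta> where \<delta>: "0 < \<delta>" "\<And>x y. (x, y) \<in> A \<Longrightarrow> \<delta> * norm x \<le> norm (y - t *\<^sub>R x)"
      by blast
    have "x = 0" if "(x, cnj (complex_of_real t) *\<^sub>C x) \<in> A" for x
      using \<delta>(2)[OF that] \<delta>(1) by (simp add: scaleR_scaleC mult_le_0_iff)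
    from self_adjoint_resolvent[OF A \<delta>(1) \<delta>(2)[unfolded scaleR_scaleC] this]
    show "\<exists>B\<in>bounded_operators.
      blinfun_graph B = converse {(x, y - complex_of_real t *\<^sub>C x) | x y. (x, y) \<in> A}"
      by blast
  qed
  then show ?thesis unfolding real_spectrum_def spectrum_def mem_Collect_eq by (rule arg_cong)
qed

section \<open>Bounded Hermitian operators and compactness of their spectrum\<close>

definition hermitian :: "('a :: complex_inner \<Rightarrow>\<^sub>L 'a) \<Rightarrow> bool" where
  "hermitian S \<longleftrightarrow> (\<forall>x y. cinner (blinfun_apply S x) y = cinner x (blinfun_apply S y))"

lemma hermitianD: "hermitian S \<Longrightarrow> cinner (blinfun_apply S x) y = cinner x (blinfun_apply S y)"
  by (simp add: hermitian_def)

text \<open>Moving \<open>S\<close> to the other side of the inner product reduces complex linearity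
  to that of the inner product.\<close>

lemma hermitian_bounded_operators: "hermitian S \<Longrightarrow> S \<in> bounded_operators"
  unfolding bounded_operators_def
proof clarify
  fix c x assume S: "hermitian S"
  show "blinfun_apply S (c *\<^sub>C x) = c *\<^sub>C blinfun_apply S x"
    by (rule cinner_ext_left) (simp add: hermitianD[OF S] cinner_scaleC_left)
qed

lemma self_adjoint_blinfun_graph:
  assumes "hermitian S"
  shows "self_adjoint (blinfun_graph S)"
  unfolding self_adjoint_def
proof (intro conjI)
  note scale = bounded_operators_scaleC[OF hermitian_bounded_operators[OF assms]]
  show "linear_operator (blinfun_graph S)"
    unfolding linear_operator_def
    by (auto intro!: csubspace_graphI simp: single_valued_def blinfun.add_right scale)
  have "Domain (blinfun_graph S) = UNIV" by (auto simp: blinfun_graph_def)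
  then show "densely_defined (blinfun_graph S)" by (simp add: densely_defined_def)
  show "op_adjoint (blinfun_graph S) = blinfun_graph S"
  proof (intro set_eqI, clarify)
    fix y z
    have "(y, z) \<in> op_adjoint (blinfun_graph S) \<longleftrightarrow>
        (\<forall>x. cinner y (blinfun_apply S x) = cinner z x)"
      by (auto simp: op_adjoint_def blinfun_graph_def)
    also have "\<dots> \<longleftrightarrow> (\<forall>x. cinner (blinfun_apply S y) x = cinner z x)"
      by (simp add: hermitianD[OF assms])
    also have "\<dots> \<longleftrightarrow> z = blinfun_apply S y"
      using cinner_ext_left by metis
    finally show "(y, z) \<in> op_adjoint (blinfun_graph S) \<longleftrightarrow> (y, z) \<in> blinfun_graph S"
      by simp
  qed
qed

definition bspec :: "('a :: complex_inner \<Rightarrow>\<^sub>L 'a) \<Rightarrow> real set" where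
  "bspec S = real_spectrum (blinfun_graph S)"

lemma bspec_iff:
  fixes S :: "'a :: complex_hilbert \<Rightarrow>\<^sub>L 'a"
  assumes "hermitian S"
  shows "t \<in> bspec S \<longleftrightarrow>
    \<not> (\<exists>\<delta>>0. \<forall>x. \<delta> * norm x \<le> norm (blinfun_apply S x - t *\<^sub>R x))"
  unfolding bspec_def real_spectrum_iff[OF self_adjoint_blinfun_graph[OF assms]] blinfun_graph_iff
  by (simp only: simp_thms)


lemma bspec_abs_le:
  fixes S :: "'a :: complex_hilbert \<Rightarrow>\<^sub>L 'a"
  assumes "hermitian S" "t \<in> bspec S"
  shows "\<bar>t\<bar> \<le> norm S"
proof (rule ccontr)
  assume "\<not> \<bar>t\<bar> \<le> norm S"
  then have pos: "0 < \<bar>t\<bar> - norm S" by linarith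
  have below: "(\<bar>t\<bar> - norm S) * norm x \<le> norm (blinfun_apply S x - t *\<^sub>R x)" for x
    using norm_triangle_ineq3[of "blinfun_apply S x" "t *\<^sub>R x"] norm_blinfun[of S x]
    by (simp add: left_diff_distrib)
  have "t \<notin> bspec S"
    unfolding bspec_iff[OF assms(1)] not_not by (intro exI conjI allI) (rule pos, rule below)
  then show False using assms(2) by contradiction
qed

text \<open>A lower bound \<open>\<delta>\<close> for \<open>S - t\<close> leaves the lower bound
  \<open>\<delta> - \<bar>s - t\<bar>\<close> for \<open>S - s\<close>, so the complement is open;
  boundedness comes from the norm of \<open>S\<close>.\<close>

lemma compact_bspec:
  fixes S :: "'a :: complex_hilbert \<Rightarrow>\<^sub>L 'a"
  assumes S: "hermitian S"
  shows "compact (bspec S)"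
proof (rule compact_eq_bounded_closed[THEN iffD2, OF conjI])
  show "bounded (bspec S)"
    unfolding bounded_iff using bspec_abs_le[OF S] by (metis real_norm_def)
  have "open (- bspec S)"
    unfolding open_dist
  proof clarify
    fix t assume "t \<notin> bspec S"
    then have "\<exists>\<delta>>0. \<forall>x. \<delta> * norm x \<le> norm (blinfun_apply S x - t *\<^sub>R x)"
      by (simp only: bspec_iff[OF S] not_not)
    then obtain \<delta> where \<delta>: "0 < \<delta>" "\<And>x. \<delta> * norm x \<le> norm (blinfun_apply S x - t *\<^sub>R x)"
      by blast
    have "s \<notin> bspec S" if s: "dist s t < \<delta>" for s
    proof -
      have "(\<delta> - \<bar>s - t\<bar>) * norm x \<le> norm (blinfun_apply S x - s *\<^sub>R x)" for x
      proof -
        have "blinfun_apply S x - t *\<^sub>R x - (s - t) *\<^sub>R x = blinfun_apply S x - s *\<^sub>R x"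
          by (simp add: scaleR_left_diff_distrib)
        moreover have "norm ((s - t) *\<^sub>R x) = \<bar>s - t\<bar> * norm x" by simp
        ultimately show ?thesis
          using \<delta>(2)[of x]
            norm_triangle_ineq2[of "blinfun_apply S x - t *\<^sub>R x" "(s - t) *\<^sub>R x"]
          by (simp only: left_diff_distrib)
      qed
      moreover have "0 < \<delta> - \<bar>s - t\<bar>" using s by (simp add: dist_real_def)
      ultimately show ?thesis
        unfolding bspec_iff[OF S] not_not by (intro exI conjI allI)
    qed
    then show "\<exists>e>0. \<forall>y. dist y t < e \<longrightarrow> y \<in> - bspec S" using \<delta>(1) by blast
  qed
  then show "closed (bspec S)" by (simp add: closed_def)
qed

section \<open>Polynomials of a bounded self-adjoint operator\<close>

text \<open>Horner's scheme for \<open>p(S)\<close>; its recursion over \<open>pCons\<close> drives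
  the inductions below.\<close>

definition pop :: "('a :: complex_inner \<Rightarrow>\<^sub>L 'a) \<Rightarrow> complex poly \<Rightarrow> ('a \<Rightarrow>\<^sub>L 'a)" where
  "pop S p = fold_coeffs (\<lambda>a B. scaleC_blinfun a id_blinfun + (S o\<^sub>L B)) p 0"

lemma pop_0 [simp]: "pop S 0 = 0"
  by (simp add: pop_def)

lemma pop_pCons: "pop S (pCons a p) = scaleC_blinfun a id_blinfun + (S o\<^sub>L pop S p)"
proof (cases "a = 0 \<and> p = 0")
  case True
  then show ?thesis
    by (auto intro!: blinfun_eqI simp: blinfun.bilinear_simps scaleC_zero_left)
next
  case False
  then show ?thesis
    by (auto simp: pop_def fold_coeffs_pCons_coeff_not_0_eq)
qed

lemma pop_pCons_apply [simp]:
  "blinfun_apply (pop S (pCons a p)) x = a *\<^sub>C x + blinfun_apply S (blinfun_apply (pop S p) x)"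
  by (simp add: pop_pCons blinfun.bilinear_simps)

lemma pop_add: "pop S (p + q) = pop S p + pop S q"
proof (rule blinfun_eqI)
  fix x
  show "blinfun_apply (pop S (p + q)) x = blinfun_apply (pop S p + pop S q) x"
    by (induction p q rule: poly_induct2)
      (simp_all add: blinfun.bilinear_simps scaleC_add_left algebra_simps)
qed

lemma pop_smult:
  assumes "S \<in> bounded_operators"
  shows "pop S (smult c p) = scaleC_blinfun c (pop S p)"
proof (rule blinfun_eqI)
  fix x
  show "blinfun_apply (pop S (smult c p)) x = blinfun_apply (scaleC_blinfun c (pop S p)) x"
    by (induction p) (simp_all add: blinfun.bilinear_simps scaleC_add_right scaleC_scaleC
      bounded_operators_scaleC[OF assms] scaleC_zero_right)
qed

lemma pop_diff:
  assumes "S \<in> bounded_operators"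
  shows "pop S (p - q) = pop S p - pop S q"
  using pop_add[of S "p - q" q] by simp

lemma pop_mult:
  assumes "S \<in> bounded_operators"
  shows "pop S (p * q) = pop S p o\<^sub>L pop S q"
proof (rule blinfun_eqI)
  fix x
  show "blinfun_apply (pop S (p * q)) x = blinfun_apply (pop S p o\<^sub>L pop S q) x"
    by (induction p) (simp_all add: mult_pCons_left pop_add pop_smult[OF assms]
      blinfun.bilinear_simps scaleC_zero_left)
qed

lemma pop_commute:
  assumes A: "A \<in> bounded_operators" "A o\<^sub>L S = S o\<^sub>L A"
  shows "A o\<^sub>L pop S p = pop S p o\<^sub>L A"
proof (rule blinfun_eqI)
  fix x
  have *: "blinfun_apply A (blinfun_apply S y) = blinfun_apply S (blinfun_apply A y)" for y
    using arg_cong[OF A(2), of "\<lambda>B. blinfun_apply B y"] by simp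
  show "blinfun_apply (A o\<^sub>L pop S p) x = blinfun_apply (pop S p o\<^sub>L A) x"
    by (induction p) (simp_all add: blinfun.bilinear_simps bounded_operators_scaleC[OF A(1)] *)
qed

lemma pop_const: "pop S [:c:] = scaleC_blinfun c id_blinfun"
  by (rule blinfun_eqI) (simp add: blinfun.bilinear_simps)

lemma pop_linear_apply: "blinfun_apply (pop S [:c, 1:]) x = blinfun_apply S x + c *\<^sub>C x"
  by (simp add: blinfun.bilinear_simps scaleC_one scaleC_zero_right)

lemma pop_id: "pop S [:0, 1:] = S"
  by (rule blinfun_eqI) (simp add: pop_linear_apply scaleC_zero_left)

lemma poly_map_cnj: "poly (map_poly cnj p) (complex_of_real t) = cnj (poly p (complex_of_real t))"
  by (induction p) (simp_all add: map_poly_pCons)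

section \<open>Lower bounds and norms of polynomials in \<open>S\<close>\<close>

lemma cinner_pop:
  assumes S: "hermitian S"
  shows "cinner (blinfun_apply (pop S p) x) y = cinner x (blinfun_apply (pop S (map_poly cnj p)) y)"
proof (induction p arbitrary: y)
  case 0
  then show ?case by simp
next
  case (pCons a p)
  have "blinfun_apply (pop S q) (blinfun_apply S y) = blinfun_apply S (blinfun_apply (pop S q) y)" for q
    using pop_commute[OF hermitian_bounded_operators[OF S] refl, of q]
    by (metis blinfun_apply_blinfun_compose)
  then show ?case
    using pCons
    by (simp add: map_poly_pCons cinner_add_left cinner_add_right cinner_scaleC_left
      cinner_scaleC_right hermitianD[OF S])
qed

text \<open>Complex polynomials may have nonreal roots, hence the complex \<open>z\<close>. For
  nonreal \<open>z\<close> the number \<langle>x, S x\<rangle> is real, so the imaginary part of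
  \<langle>x, (S - z) x\<rangle> is \<open>Im z\<close> times the squared norm of \<open>x\<close>
  up to sign, and Cauchy-Schwarz gives the bound \<open>\<bar>Im z\<bar>\<close>.\<close>

lemma hermitian_shift_bounded_below:
  fixes S :: "'a :: complex_hilbert \<Rightarrow>\<^sub>L 'a"
  assumes S: "hermitian S" and z: "z \<in> \<real> \<Longrightarrow> Re z \<notin> bspec S"
  obtains \<delta> where "0 < \<delta>" "\<And>x. \<delta> * norm x \<le> norm (blinfun_apply S x - z *\<^sub>C x)"
proof (cases "z \<in> \<real>")
  case True
  then have "Re z \<notin> bspec S" "z = complex_of_real (Re z)" using z by auto
  then show ?thesis
    using that bspec_iff[OF S, of "Re z"] by (metis (no_types, lifting) scaleR_scaleC)
next
  case False
  have "\<bar>Im z\<bar> * norm x \<le> norm (blinfun_apply S x - z *\<^sub>C x)" for x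
  proof (cases "x = 0")
    case False
    have "cinner x (blinfun_apply S x) = cnj (cinner x (blinfun_apply S x))"
      by (metis hermitianD[OF S] cinner_commute)
    then have "Im (cinner x (blinfun_apply S x)) = 0"
      by (simp add: complex_eq_iff)
    then have "Im (cinner x (blinfun_apply S x - z *\<^sub>C x)) = - (Im z * (norm x)\<^sup>2)"
      by (simp add: cinner_diff_right cinner_scaleC_right cinner_self)
    then have "\<bar>Im z\<bar> * (norm x)\<^sup>2 \<le> norm x * norm (blinfun_apply S x - z *\<^sub>C x)"
      using cinner_cauchy_schwarz[of x "blinfun_apply S x - z *\<^sub>C x"]
        abs_Im_le_cmod[of "cinner x (blinfun_apply S x - z *\<^sub>C x)"]
      by (simp add: abs_mult)
    then show ?thesis
      using False by (simp add: power2_eq_square mult.left_commute)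
  qed (simp add: scaleC_zero_right blinfun.bilinear_simps)
  moreover have "0 < \<bar>Im z\<bar>" using False by (auto simp: complex_is_Real_iff)
  ultimately show ?thesis using that by blast
qed

text \<open>By the fundamental theorem of algebra \<open>p\<close> has a factor \<open>X - z\<close>
  whose root is nonreal or off the spectrum, so that this factor is bounded below at
  \<open>S\<close>; the bounds multiply along the induction on the degree.\<close>

lemma pop_bounded_below:
  fixes S :: "'a :: complex_hilbert \<Rightarrow>\<^sub>L 'a"
  assumes S: "hermitian S"
  shows "p \<noteq> 0 \<Longrightarrow> (\<And>t. t \<in> bspec S \<Longrightarrow> poly p (complex_of_real t) \<noteq> 0) \<Longrightarrow>
    \<exists>\<delta>>0. \<forall>x. \<delta> * norm x \<le> norm (blinfun_apply (pop S p) x)"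
proof (induction "degree p" arbitrary: p)
  case 0
  then obtain c where c: "p = [:c:]" "c \<noteq> 0" by (metis degree_eq_zeroE pCons_0_0)
  then show ?case
    by (intro exI[of _ "cmod c"]) (simp add: norm_scaleC blinfun.bilinear_simps)
next
  case (Suc n)
  then have "\<not> constant (poly p)" by (simp add: constant_degree)
  then obtain z where z: "poly p z = 0" using fundamental_theorem_of_algebra by blast
  then obtain q where q: "p = [:- z, 1:] * q" by (metis poly_eq_0_iff_dvd dvdE)
  have "Re z \<notin> bspec S" if "z \<in> \<real>"
    using that z Suc.prems(2)[of "Re z"] by auto
  then obtain \<delta> where \<delta>: "0 < \<delta>" "\<And>x. \<delta> * norm x \<le> norm (blinfun_apply S x - z *\<^sub>C x)"
    using hermitian_shift_bounded_below[OF S] by metis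
  have "q \<noteq> 0" using q Suc.prems(1) by auto
  moreover from this have "degree q = n"
    using Suc.hyps(2) unfolding q by (subst (asm) degree_mult_eq) auto
  moreover have "poly q (complex_of_real t) \<noteq> 0" if "t \<in> bspec S" for t
    using Suc.prems(2)[OF that] by (auto simp: q)
  ultimately obtain \<epsilon> where \<epsilon>: "0 < \<epsilon>" "\<And>x. \<epsilon> * norm x \<le> norm (blinfun_apply (pop S q) x)"
    using Suc.hyps(1)[of q] by blast
  have "(\<delta> * \<epsilon>) * norm x \<le> norm (blinfun_apply (pop S p) x)" for x
  proof -
    have "\<delta> * (\<epsilon> * norm x) \<le> \<delta> * norm (blinfun_apply (pop S q) x)"
      using \<epsilon> \<delta>(1) by simp
    also have "\<dots> \<le> norm (blinfun_apply (pop S p) x)"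
      using \<delta>(2)[of "blinfun_apply (pop S q) x"]
      unfolding q pop_mult[OF hermitian_bounded_operators[OF S]] blinfun_apply_blinfun_compose
        pop_linear_apply scaleC_minus_left by simp
    finally show ?thesis by (simp add: mult.assoc)
  qed
  then show ?case using \<delta>(1) \<epsilon>(1) by (intro exI[of _ "\<delta> * \<epsilon>"]) simp
qed

text \<open>If \<open>A^2 - N^2\<close> with \<open>N = norm A\<close> were bounded below by
  \<open>\<delta>\<close>, expanding the square and using
  \<open>norm (A (A x)) \<le> N * norm (A x)\<close> would give
  \<open>norm (A x) ^ 2 \<le> (N^2 - \<delta>^2 / N^2) * norm x ^ 2\<close>, hence a norm below
  \<open>N\<close>. Passing to the square avoids deciding whether \<open>N\<close> or
  \<open>- N\<close> is the approximate eigenvalue.\<close>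

lemma hermitian_norm_approx_eigenvalue:
  fixes A :: "'a :: complex_hilbert \<Rightarrow>\<^sub>L 'a"
  assumes A: "hermitian A" and pos: "0 < norm A" and \<delta>: "0 < \<delta>"
  obtains x where
    "norm (blinfun_apply A (blinfun_apply A x) - (norm A)\<^sup>2 *\<^sub>R x) < \<delta> * norm x"
proof (rule ccontr)
  assume "\<not> thesis"
  then have below: "\<delta> * norm x \<le> norm (blinfun_apply A (blinfun_apply A x) - (norm A)\<^sup>2 *\<^sub>R x)" for x
    using that by (meson not_le)
  define N where "N = norm A"
  have N: "0 < N" using pos by (simp add: N_def)
  have Ax: "(norm (blinfun_apply A x))\<^sup>2 \<le> (N\<^sup>2 - \<delta>\<^sup>2 / N\<^sup>2) * (norm x)\<^sup>2" for x
  proof -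
    have "cinner (blinfun_apply A (blinfun_apply A x)) (N\<^sup>2 *\<^sub>R x)
        = complex_of_real (N\<^sup>2 * (norm (blinfun_apply A x))\<^sup>2)"
      by (simp add: scaleR_scaleC cinner_scaleC_right hermitianD[OF A, of "blinfun_apply A x"] cinner_self)
    then have eq: "(norm (blinfun_apply A (blinfun_apply A x) - N\<^sup>2 *\<^sub>R x))\<^sup>2
        = (norm (blinfun_apply A (blinfun_apply A x)))\<^sup>2 - 2 * (N\<^sup>2 * (norm (blinfun_apply A x))\<^sup>2)
          + (N\<^sup>2 * norm x)\<^sup>2"
      by (simp add: norm_diff_sq)
    have "(norm (blinfun_apply A (blinfun_apply A x)))\<^sup>2 \<le> (N * norm (blinfun_apply A x))\<^sup>2"
      using norm_blinfun[of A "blinfun_apply A x"] by (intro power_mono) (auto simp: N_def)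
    moreover have "(\<delta> * norm x)\<^sup>2 \<le> (norm (blinfun_apply A (blinfun_apply A x) - N\<^sup>2 *\<^sub>R x))\<^sup>2"
      using below[of x] \<delta> by (intro power_mono) (auto simp: N_def)
    ultimately have "(\<delta> * norm x)\<^sup>2 \<le> N\<^sup>2 * (N\<^sup>2 * (norm x)\<^sup>2 - (norm (blinfun_apply A x))\<^sup>2)"
      unfolding eq by (simp add: power_mult_distrib power2_eq_square algebra_simps)
    then have "(\<delta> * norm x)\<^sup>2 / N\<^sup>2 \<le> N\<^sup>2 * (norm x)\<^sup>2 - (norm (blinfun_apply A x))\<^sup>2"
      using N by (simp add: divide_le_eq mult.commute)
    then show ?thesis by (simp add: power_mult_distrib algebra_simps)
  qed
  define c where "c = N\<^sup>2 - \<delta>\<^sup>2 / N\<^sup>2"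
  \<comment> \<open>A root of \<open>c\<close> is about to be taken; \<open>c\<close> is nonnegative
    because \<open>A x\<close> is nonzero for some \<open>x\<close>.\<close>
  have c0: "0 \<le> c"
  proof -
    obtain x where "blinfun_apply A x \<noteq> 0" using pos by (metis blinfun_eqI norm_zero less_irrefl zero_blinfun.rep_eq)
    then have "0 < (norm (blinfun_apply A x))\<^sup>2" "x \<noteq> 0" by (auto simp: blinfun.bilinear_simps)
    with Ax[of x] show ?thesis by (smt (verit) c_def mult_nonpos_nonneg zero_le_power2)
  qed
  have "norm A \<le> sqrt c"
  proof (rule norm_blinfun_bound)
    show "norm (blinfun_apply A x) \<le> sqrt c * norm x" for x
    proof (rule power2_le_imp_le)
      show "(norm (blinfun_apply A x))\<^sup>2 \<le> (sqrt c * norm x)\<^sup>2"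
        using Ax[of x] c0 by (simp add: power_mult_distrib c_def)
    qed (simp add: c0)
  qed (simp add: c0)
  then have "N\<^sup>2 \<le> c" using N c0 by (metis N_def less_imp_le power_mono real_sqrt_pow2)
  then have "\<delta>\<^sup>2 / N\<^sup>2 \<le> 0" unfolding c_def by linarith
  moreover have "0 < \<delta>\<^sup>2 / N\<^sup>2" using \<delta> N by simp
  ultimately show False by linarith
qed

text \<open>Over an empty spectrum the polynomial \<open>X^2 - norm S ^ 2\<close> has vacuously no
  zero, so it would be bounded below at \<open>S\<close>, against
  \<open>hermitian_norm_approx_eigenvalue\<close>. The vector \<open>x\<close> excludes the zero
  space, whose spectrum is empty.\<close>

lemma bspec_nonempty:
  fixes S :: "'a :: complex_hilbert \<Rightarrow>\<^sub>L 'a"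
  assumes S: "hermitian S" and x: "(x :: 'a) \<noteq> 0"
  shows "bspec S \<noteq> {}"
proof (cases "S = 0")
  case True
  have "0 \<in> bspec S"
    unfolding bspec_iff[OF S] using x by (auto simp: True mult_le_0_iff intro!: exI[of _ x])
  then show ?thesis by blast
next
  case False
  show ?thesis
  proof
    assume empty: "bspec S = {}"
    define q where "q = [:0, 1:] * [:0, 1:] - [:complex_of_real ((norm S)\<^sup>2):]"
    have "coeff q 2 = 1" by (simp add: q_def numeral_2_eq_2)
    then have "q \<noteq> 0" by auto
    then obtain \<delta> where \<delta>: "0 < \<delta>" "\<And>x. \<delta> * norm x \<le> norm (blinfun_apply (pop S q) x)"
      using pop_bounded_below[OF S, of q] empty by auto
    have "blinfun_apply (pop S q) x = blinfun_apply S (blinfun_apply S x) - (norm S)\<^sup>2 *\<^sub>R x" for x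
      unfolding q_def pop_diff[OF hermitian_bounded_operators[OF S]]
        pop_mult[OF hermitian_bounded_operators[OF S]] pop_id pop_const
      by (simp add: blinfun.bilinear_simps scaleR_scaleC)
    with hermitian_norm_approx_eigenvalue[OF S _ \<delta>(1)] \<delta>(2) False show False
      by (metis not_le zero_less_norm_iff)
  qed
qed

text \<open>If the norm \<open>N\<close> exceeded \<open>C\<close>, then \<open>p^2 - N^2\<close>
  would have no zero on the spectrum and would be bounded below at \<open>S\<close>, although
  \<open>N^2\<close> is an approximate eigenvalue of the square of \<open>pop S p\<close>.\<close>

lemma norm_pop_hermitian_le:
  fixes S :: "'a :: complex_hilbert \<Rightarrow>\<^sub>L 'a"
  assumes S: "hermitian S" and p: "hermitian (pop S p)" and C: "0 \<le> C"
    and bound: "\<And>t. t \<in> bspec S \<Longrightarrow> cmod (poly p (complex_of_real t)) \<le> C"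
  shows "norm (pop S p) \<le> C"
proof (rule ccontr)
  note bo = hermitian_bounded_operators[OF S]
  define N where "N = norm (pop S p)"
  assume "\<not> norm (pop S p) \<le> C"
  then have N: "C < N" "0 < N" using C by (auto simp: N_def)
  define q where "q = p * p - [:complex_of_real (N\<^sup>2):]"
  have nz: "poly q (complex_of_real t) \<noteq> 0" if "t \<in> bspec S" for t
  proof
    assume "poly q (complex_of_real t) = 0"
    then have "(poly p (complex_of_real t))\<^sup>2 = complex_of_real (N\<^sup>2)"
      by (simp add: q_def power2_eq_square)
    then have "cmod (poly p (complex_of_real t)) ^ 2 = N\<^sup>2"
      by (metis norm_power norm_of_real abs_power2)
    then show False using bound[OF that] N by (simp add: power2_eq_iff_nonneg)
  qed
  \<comment> \<open>A nonzero vector provides a spectral point, and \<open>q\<close> is not the zero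
    polynomial because it does not vanish there.\<close>
  obtain x where "blinfun_apply (pop S p) x \<noteq> 0"
    using N(2) unfolding N_def by (metis blinfun_eqI norm_zero less_irrefl zero_blinfun.rep_eq)
  then have "x \<noteq> 0" by (auto simp: blinfun.bilinear_simps)
  then obtain t where "t \<in> bspec S" using bspec_nonempty[OF S] by blast
  then have "q \<noteq> 0" using nz by fastforce
  then obtain \<delta> where \<delta>: "0 < \<delta>" "\<And>x. \<delta> * norm x \<le> norm (blinfun_apply (pop S q) x)"
    using pop_bounded_below[OF S, of q] nz by blast
  have "blinfun_apply (pop S q) x
      = blinfun_apply (pop S p) (blinfun_apply (pop S p) x) - (norm (pop S p))\<^sup>2 *\<^sub>R x" for x
    unfolding q_def pop_diff[OF bo] pop_mult[OF bo] pop_const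
    by (simp add: blinfun.bilinear_simps scaleR_scaleC N_def)
  with hermitian_norm_approx_eigenvalue[OF p _ \<delta>(1)] \<delta>(2) N(2) show False
    by (metis not_le N_def)
qed

text \<open>The C-star identity reduces this to the Hermitian case: with \<open>q\<close> the
  product of \<open>p\<close> and its conjugate polynomial, \<langle>x, q(S) x\<rangle> is the
  squared norm of \<open>p(S) x\<close>, and \<open>q\<close> is bounded by \<open>C^2\<close> on
  the spectrum.\<close>

lemma norm_pop_le:
  fixes S :: "'a :: complex_hilbert \<Rightarrow>\<^sub>L 'a"
  assumes S: "hermitian S" and C: "0 \<le> C"
    and bound: "\<And>t. t \<in> bspec S \<Longrightarrow> cmod (poly p (complex_of_real t)) \<le> C"
  shows "norm (pop S p) \<le> C"
proof (rule norm_blinfun_bound[OF C])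
  fix x
  note bo = hermitian_bounded_operators[OF S]
  define q where "q = map_poly cnj p * p"
  have herm: "hermitian (pop S q)"
    unfolding hermitian_def
  proof (intro allI)
    fix x y
    have "cinner (blinfun_apply (pop S q) x) y
        = cinner (blinfun_apply (pop S p) x) (blinfun_apply (pop S p) y)" for x y
    proof -
      have "map_poly cnj (map_poly cnj p) = p"
        by (simp add: map_poly_map_poly o_def)
      then show ?thesis
        by (simp add: q_def pop_mult[OF bo] cinner_pop[OF S, of "map_poly cnj p"])
    qed
    then show "cinner (blinfun_apply (pop S q) x) y = cinner x (blinfun_apply (pop S q) y)"
      by (metis cinner_commute)
  qed
  have "norm (pop S q) \<le> C\<^sup>2"
  proof (rule norm_pop_hermitian_le[OF S herm])
    fix t assume "t \<in> bspec S"
    from mult_mono[OF bound[OF this] bound[OF this]]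
    show "cmod (poly q (complex_of_real t)) \<le> C\<^sup>2"
      by (simp add: q_def poly_map_cnj norm_mult power2_eq_square C)
  qed simp
  moreover have "(norm (blinfun_apply (pop S p) x))\<^sup>2 \<le> norm (pop S q) * norm x * norm x"
  proof -
    have "(norm (blinfun_apply (pop S p) x))\<^sup>2 = Re (cinner x (blinfun_apply (pop S q) x))"
      by (simp add: norm_sq_eq q_def pop_mult[OF bo] cinner_pop[OF S])
    also have "\<dots> \<le> norm x * norm (blinfun_apply (pop S q) x)"
      using cinner_cauchy_schwarz complex_Re_le_cmod order_trans by blast
    also have "\<dots> \<le> norm x * (norm (pop S q) * norm x)"
      by (intro mult_left_mono norm_blinfun) simp
    finally show ?thesis by (simp add: ac_simps)
  qed
  ultimately have "(norm (blinfun_apply (pop S p) x))\<^sup>2 \<le> C\<^sup>2 * norm x * norm x"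
    by (meson mult_right_mono norm_ge_zero order_trans)
  then have "(norm (blinfun_apply (pop S p) x))\<^sup>2 \<le> (C * norm x)\<^sup>2"
    by (simp add: power2_eq_square ac_simps)
  then show "norm (blinfun_apply (pop S p) x) \<le> C * norm x"
    by (rule power2_le_imp_le) (simp add: C)
qed

text \<open>\<open>p - p(t)\<close> is divisible by \<open>X - t\<close>. If the modulus of
  \<open>p(t)\<close> exceeded the norm of \<open>p(S)\<close>, then \<open>p(S) - p(t)\<close>
  would be bounded below, and hence so would be its factor \<open>S - t\<close>.\<close>

lemma norm_pop_ge:
  fixes S :: "'a :: complex_hilbert \<Rightarrow>\<^sub>L 'a"
  assumes S: "hermitian S" and t: "t \<in> bspec S"
  shows "cmod (poly p (complex_of_real t)) \<le> norm (pop S p)"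
proof (rule ccontr)
  note bo = hermitian_bounded_operators[OF S]
  define c where "c = poly p (complex_of_real t)"
  assume "\<not> cmod (poly p (complex_of_real t)) \<le> norm (pop S p)"
  then have pos: "0 < cmod c - norm (pop S p)" by (simp add: c_def)
  have "poly (p - [:c:]) (complex_of_real t) = 0" by (simp add: c_def)
  then obtain q where q: "p - [:c:] = q * [:- complex_of_real t, 1:]"
    by (metis poly_eq_0_iff_dvd dvdE mult.commute)
  \<comment> \<open>The added 1 keeps \<open>K\<close> positive if \<open>pop S q\<close>
    vanishes.\<close>
  define K where "K = norm (pop S q) + 1"
  have K: "0 < K" by (simp add: K_def add_nonneg_pos)
  have "(cmod c - norm (pop S p)) / K * norm x \<le> norm (blinfun_apply S x - t *\<^sub>R x)" for x
  proof -
    have eq: "blinfun_apply (pop S p) x - c *\<^sub>C x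
        = blinfun_apply (pop S q) (blinfun_apply S x - t *\<^sub>R x)"
      using arg_cong[OF q, of "\<lambda>p. blinfun_apply (pop S p) x"]
      unfolding pop_diff[OF bo] pop_mult[OF bo] pop_const blinfun_apply_blinfun_compose
        pop_linear_apply blinfun.diff_left scaleC_blinfun_apply
      by (simp add: scaleC_minus_left scaleR_scaleC)
    have "cmod c * norm x - norm (pop S p) * norm x \<le> norm (c *\<^sub>C x) - norm (blinfun_apply (pop S p) x)"
      using norm_blinfun[of "pop S p" x] by (simp add: norm_scaleC)
    also have "\<dots> \<le> norm (blinfun_apply (pop S p) x - c *\<^sub>C x)"
      by (metis norm_minus_commute norm_triangle_ineq2)
    also have "\<dots> \<le> norm (pop S q) * norm (blinfun_apply S x - t *\<^sub>R x)"
      unfolding eq by (rule norm_blinfun)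
    also have "\<dots> \<le> K * norm (blinfun_apply S x - t *\<^sub>R x)"
      by (intro mult_right_mono) (simp_all add: K_def)
    finally show ?thesis using K by (simp add: field_simps)
  qed
  moreover have "0 < (cmod c - norm (pop S p)) / K" using pos K by simp
  ultimately have "t \<notin> bspec S"
    unfolding bspec_iff[OF S] not_not by (intro exI conjI allI)
  then show False using t by contradiction
qed

section \<open>Continuous functional calculus of a bounded self-adjoint operator\<close>

definition cpoly_fun :: "complex poly \<Rightarrow> real \<Rightarrow> complex" where
  "cpoly_fun p t = poly p (complex_of_real t)"

lemma continuous_on_cpoly_fun: "continuous_on X (cpoly_fun p)"
  unfolding cpoly_fun_def by (intro continuous_intros)

text \<open>A relation instead of a function: the algebraic rules follow by passing to the limit
  along polynomials, and the chosen function \<open>cfc\<close> can afterwards be shown to satisfy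
  it.\<close>

definition represents ::
    "('a :: complex_inner \<Rightarrow>\<^sub>L 'a) \<Rightarrow> (real \<Rightarrow> complex) \<Rightarrow> ('a \<Rightarrow>\<^sub>L 'a) \<Rightarrow> bool" where
  "represents S f B \<longleftrightarrow> (\<exists>p. uniform_limit (bspec S) (\<lambda>n. cpoly_fun (p n)) f sequentially \<and>
     (\<lambda>n. pop S (p n)) \<longlonglongrightarrow> B)"

lemma represents_poly: "represents S (cpoly_fun p) (pop S p)"
  unfolding represents_def by (intro exI[of _ "\<lambda>_. p"]) (simp add: uniform_limit_const)

text \<open>\<open>norm_pop_le\<close> turns a uniformly Cauchy sequence on the spectrum into a
  Cauchy sequence of operators.\<close>

lemma pop_convergent:
  fixes S :: "'a :: complex_hilbert \<Rightarrow>\<^sub>L 'a"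
  assumes S: "hermitian S" and lim: "uniform_limit (bspec S) (\<lambda>n. cpoly_fun (p n)) f sequentially"
  obtains B where "(\<lambda>n. pop S (p n)) \<longlonglongrightarrow> B"
proof -
  have "Cauchy (\<lambda>n. pop S (p n))"
  proof (rule metric_CauchyI)
    fix e :: real assume "0 < e"
    then have "0 < e / 3" by simp
    then obtain N where N: "\<And>n t. N \<le> n \<Longrightarrow> t \<in> bspec S \<Longrightarrow> dist (cpoly_fun (p n) t) (f t) < e / 3"
      using uniform_limitD[OF lim] by (metis (no_types, lifting) eventually_sequentially)
    have "dist (pop S (p m)) (pop S (p n)) < e" if "N \<le> m" "N \<le> n" for m n
    proof -
      have "norm (pop S (p m - p n)) \<le> 2 * e / 3"
      proof (rule norm_pop_le[OF S])
        fix t assume t: "t \<in> bspec S"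
        from dist_triangle3[of "cpoly_fun (p m) t" "cpoly_fun (p n) t" "f t"]
          N[OF that(1) t] N[OF that(2) t]
        have "dist (cpoly_fun (p m) t) (cpoly_fun (p n) t) \<le> 2 * e / 3"
          by (simp add: dist_commute)
        then show "cmod (poly (p m - p n) (complex_of_real t)) \<le> 2 * e / 3"
          by (simp add: cpoly_fun_def dist_norm)
      qed (use \<open>0 < e\<close> in simp)
      then show ?thesis
        using \<open>0 < e\<close> by (simp add: dist_norm pop_diff[OF hermitian_bounded_operators[OF S]])
    qed
    then show "\<exists>M. \<forall>m\<ge>M. \<forall>n\<ge>M. dist (pop S (p m)) (pop S (p n)) < e" by blast
  qed
  then show ?thesis using that by (auto simp: Cauchy_convergent_iff convergent_def)
qed

lemma real_continuous_approx_poly: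
  assumes "compact X" "continuous_on X f" "0 < e"
  obtains p where "\<And>t. t \<in> X \<Longrightarrow> cmod (complex_of_real (f t) - cpoly_fun p t) < e"
proof -
  obtain g where g: "real_polynomial_function g" "\<And>t. t \<in> X \<Longrightarrow> \<bar>f t - g t\<bar> < e"
    using Stone_Weierstrass_real_polynomial_function[OF assms] by blast
  then obtain a n where a: "g = (\<lambda>t. \<Sum>i\<le>n. a i * t ^ i)"
    by (auto simp: real_polynomial_function_iff_sum)
  define p where "p = (\<Sum>i\<le>n. monom (complex_of_real (a i)) i)"
  have "cpoly_fun p t = complex_of_real (g t)" for t
    by (simp add: cpoly_fun_def p_def a poly_sum poly_monom)
  then have "cmod (complex_of_real (f t) - cpoly_fun p t) < e" if "t \<in> X" for t
    using g(2)[OF that] by (metis norm_of_real of_real_diff)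
  then show ?thesis using that by blast
qed

lemma complex_continuous_approx_poly:
  assumes X: "compact X" and f: "continuous_on X f" and e: "0 < e"
  obtains p where "\<And>t. t \<in> X \<Longrightarrow> cmod (f t - cpoly_fun p t) < e"
proof -
  have "0 < e / 2" using e by simp
  obtain p where p: "\<And>t. t \<in> X \<Longrightarrow> cmod (complex_of_real (Re (f t)) - cpoly_fun p t) < e / 2"
    using real_continuous_approx_poly[OF X _ \<open>0 < e / 2\<close>] continuous_on_Re[OF f] by metis
  obtain q where q: "\<And>t. t \<in> X \<Longrightarrow> cmod (complex_of_real (Im (f t)) - cpoly_fun q t) < e / 2"
    using real_continuous_approx_poly[OF X _ \<open>0 < e / 2\<close>] continuous_on_Im[OF f] by metis
  have "cmod (f t - cpoly_fun (p + smult \<i> q) t) < e" if "t \<in> X" for t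
  proof -
    have "f t - cpoly_fun (p + smult \<i> q) t = (complex_of_real (Re (f t)) - cpoly_fun p t)
        + \<i> * (complex_of_real (Im (f t)) - cpoly_fun q t)"
      using complex_eq[of "f t"] by (simp add: cpoly_fun_def algebra_simps)
    also have "cmod \<dots> \<le> cmod (complex_of_real (Re (f t)) - cpoly_fun p t)
        + cmod (\<i> * (complex_of_real (Im (f t)) - cpoly_fun q t))"
      by (rule norm_triangle_ineq)
    also have "\<dots> < e / 2 + e / 2"
      using p[OF that] q[OF that] by (simp add: norm_mult)
    finally show ?thesis by simp
  qed
  then show ?thesis using that by blast
qed

lemma represents_exists:
  fixes S :: "'a :: complex_hilbert \<Rightarrow>\<^sub>L 'a"
  assumes S: "hermitian S" and f: "continuous_on (bspec S) f"
  obtains B where "represents S f B"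
proof -
  have "\<exists>p. \<forall>t\<in>bspec S. cmod (f t - cpoly_fun p t) < 1 / real (Suc n)" for n
    using complex_continuous_approx_poly[OF compact_bspec[OF S] f, of "1 / real (Suc n)"]
    by (metis of_nat_0_less_iff zero_less_Suc zero_less_divide_1_iff)
  then obtain p where p: "\<And>n t. t \<in> bspec S \<Longrightarrow> cmod (f t - cpoly_fun (p n) t) < 1 / real (Suc n)"
    by metis
  have lim: "uniform_limit (bspec S) (\<lambda>n. cpoly_fun (p n)) f sequentially"
  proof (rule uniform_limitI)
    fix e :: real assume "0 < e"
    then obtain N where N: "inverse (real (Suc N)) < e" using reals_Archimedean by blast
    have "dist (cpoly_fun (p n) t) (f t) < e" if "N \<le> n" "t \<in> bspec S" for n t
    proof -
      have "1 / real (Suc n) \<le> inverse (real (Suc N))"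
        using that(1) by (simp add: inverse_eq_divide frac_le)
      then show ?thesis using p[OF that(2), of n] N by (simp add: dist_norm norm_minus_commute)
    qed
    then show "\<forall>\<^sub>F n in sequentially. \<forall>t\<in>bspec S. dist (cpoly_fun (p n) t) (f t) < e"
      by (auto simp: eventually_sequentially)
  qed
  then show ?thesis using pop_convergent[OF S lim] that by (metis represents_def)
qed

lemma represents_norm_le:
  fixes S :: "'a :: complex_hilbert \<Rightarrow>\<^sub>L 'a"
  assumes S: "hermitian S" and rep: "represents S f B" and C: "0 \<le> C"
    and bound: "\<And>t. t \<in> bspec S \<Longrightarrow> cmod (f t) \<le> C"
  shows "norm B \<le> C"
proof (rule field_le_epsilon)
  fix e :: real assume e: "0 < e"
  obtain p where p: "uniform_limit (bspec S) (\<lambda>n. cpoly_fun (p n)) f sequentially"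
      "(\<lambda>n. pop S (p n)) \<longlonglongrightarrow> B"
    using rep by (auto simp: represents_def)
  have "\<forall>\<^sub>F n in sequentially. norm (pop S (p n)) \<le> C + e"
    using uniform_limitD[OF p(1) e]
  proof eventually_elim
    case (elim n)
    show ?case
    proof (rule norm_pop_le[OF S])
      fix t assume t: "t \<in> bspec S"
      have "cmod (cpoly_fun (p n) t) \<le> cmod (f t) + dist (cpoly_fun (p n) t) (f t)"
        by (metis dist_norm norm_triangle_sub)
      then show "cmod (poly (p n) (complex_of_real t)) \<le> C + e"
        using bound[OF t] bspec[OF elim t] by (simp add: cpoly_fun_def)
    qed (use C e in simp)
  qed
  then show "norm B \<le> C + e"
    by (rule tendsto_upperbound[OF tendsto_norm[OF p(2)]]) simp
qed

text \<open>Pointwise limit of \<open>norm_pop_ge\<close>. Besides half of the isometry it supplies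
  the boundedness of \<open>f\<close> on the spectrum that uniform limits of products
  require.\<close>

lemma represents_norm_ge:
  fixes S :: "'a :: complex_hilbert \<Rightarrow>\<^sub>L 'a"
  assumes S: "hermitian S" and rep: "represents S f B" and t: "t \<in> bspec S"
  shows "cmod (f t) \<le> norm B"
proof -
  obtain p where p: "uniform_limit (bspec S) (\<lambda>n. cpoly_fun (p n)) f sequentially"
      "(\<lambda>n. pop S (p n)) \<longlonglongrightarrow> B"
    using rep by (auto simp: represents_def)
  have "(\<lambda>n. cpoly_fun (p n) t) \<longlonglongrightarrow> f t"
    by (rule tendsto_uniform_limitI[OF p(1) t])
  moreover have "\<forall>\<^sub>F n in sequentially. cmod (cpoly_fun (p n) t) \<le> norm (pop S (p n))"
    unfolding cpoly_fun_def by (intro always_eventually allI norm_pop_ge S t)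
  ultimately show ?thesis
    by (intro tendsto_le[OF _ tendsto_norm[OF p(2)] tendsto_norm]) simp_all
qed

lemma represents_add:
  assumes "represents S f A" "represents S g B"
  shows "represents S (\<lambda>t. f t + g t) (A + B)"
proof -
  obtain p q where *: "uniform_limit (bspec S) (\<lambda>n. cpoly_fun (p n)) f sequentially"
      "(\<lambda>n. pop S (p n)) \<longlonglongrightarrow> A"
      "uniform_limit (bspec S) (\<lambda>n. cpoly_fun (q n)) g sequentially" "(\<lambda>n. pop S (q n)) \<longlonglongrightarrow> B"
    using assms by (auto simp: represents_def)
  have "cpoly_fun (p n + q n) = (\<lambda>t. cpoly_fun (p n) t + cpoly_fun (q n) t)" for n
    by (simp add: cpoly_fun_def fun_eq_iff)
  then show ?thesis
    unfolding represents_def using uniform_limit_add[OF *(1,3)] tendsto_add[OF *(2,4)]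
    by (intro exI[of _ "\<lambda>n. p n + q n"]) (simp add: pop_add)
qed

lemma represents_mult:
  fixes S :: "'a :: complex_hilbert \<Rightarrow>\<^sub>L 'a"
  assumes S: "hermitian S" and rep: "represents S f A" "represents S g B"
  shows "represents S (\<lambda>t. f t * g t) (A o\<^sub>L B)"
proof -
  obtain p q where *: "uniform_limit (bspec S) (\<lambda>n. cpoly_fun (p n)) f sequentially"
      "(\<lambda>n. pop S (p n)) \<longlonglongrightarrow> A"
      "uniform_limit (bspec S) (\<lambda>n. cpoly_fun (q n)) g sequentially" "(\<lambda>n. pop S (q n)) \<longlonglongrightarrow> B"
    using rep by (auto simp: represents_def)
  have "cpoly_fun (p n * q n) = (\<lambda>t. cpoly_fun (p n) t * cpoly_fun (q n) t)" for n
    by (simp add: cpoly_fun_def fun_eq_iff)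
  moreover have "uniform_limit (bspec S) (\<lambda>n t. cpoly_fun (p n) t * cpoly_fun (q n) t)
      (\<lambda>t. f t * g t) sequentially"
    using represents_norm_ge[OF S rep(1)] represents_norm_ge[OF S rep(2)]
    by (intro uniform_lim_mult *(1,3)) (auto simp: bounded_iff)
  moreover have "(\<lambda>n. pop S (p n) o\<^sub>L pop S (q n)) \<longlonglongrightarrow> (A o\<^sub>L B)"
    by (intro bounded_bilinear.tendsto[OF bounded_bilinear_blinfun_compose] *(2,4))
  ultimately show ?thesis
    unfolding represents_def
    by (intro exI[of _ "\<lambda>n. p n * q n"]) (simp add: pop_mult[OF hermitian_bounded_operators[OF S]])
qed

lemma represents_scale:
  fixes S :: "'a :: complex_hilbert \<Rightarrow>\<^sub>L 'a"
  assumes S: "hermitian S" and rep: "represents S f A"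
  shows "represents S (\<lambda>t. c * f t) (scaleC_blinfun c A)"
proof -
  have "pop S [:c:] o\<^sub>L A = scaleC_blinfun c A"
    by (rule blinfun_eqI) (simp add: pop_const)
  with represents_mult[OF S represents_poly[of S "[:c:]"] rep] show ?thesis
    by (simp add: cpoly_fun_def)
qed

text \<open>The difference represents a function vanishing on the spectrum, so its norm is 0.
  Agreement is asked for on \<open>bspec S\<close> only, which is how functions that differ
  elsewhere get identified.\<close>

lemma represents_unique:
  fixes S :: "'a :: complex_hilbert \<Rightarrow>\<^sub>L 'a"
  assumes S: "hermitian S" and rep: "represents S f A" "represents S g B"
    and eq: "\<And>t. t \<in> bspec S \<Longrightarrow> f t = g t"
  shows "A = B"
proof -
  have "represents S (\<lambda>t. f t + (-1) * g t) (A + scaleC_blinfun (-1) B)"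
    by (intro represents_add represents_scale S rep)
  then have "norm (A + scaleC_blinfun (-1) B) \<le> 0"
    by (rule represents_norm_le[OF S]) (simp_all add: eq)
  moreover have "scaleC_blinfun (-1) B = - B"
    by (rule blinfun_eqI) (simp add: scaleC_minus_one blinfun.bilinear_simps)
  ultimately show ?thesis by simp
qed

text \<open>Conjugating the coefficients of the approximating polynomials gives operators that
  converge to the adjoint; its existence is part of the claim and comes from this
  construction.\<close>

lemma represents_adjoint:
  fixes S :: "'a :: complex_hilbert \<Rightarrow>\<^sub>L 'a"
  assumes S: "hermitian S" and rep: "represents S f A"
  shows "\<exists>B. represents S (\<lambda>t. cnj (f t)) B \<and>
    (\<forall>x y. cinner (blinfun_apply A x) y = cinner x (blinfun_apply B y))"
proof -
  obtain p where p: "uniform_limit (bspec S) (\<lambda>n. cpoly_fun (p n)) f sequentially"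
      "(\<lambda>n. pop S (p n)) \<longlonglongrightarrow> A"
    using rep by (auto simp: represents_def)
  have "uniform_limit (bspec S) (\<lambda>n. cpoly_fun (map_poly cnj (p n))) (\<lambda>t. cnj (f t)) sequentially"
    using p(1) unfolding uniform_limit_iff
    by (simp add: cpoly_fun_def poly_map_cnj dist_norm flip: complex_cnj_diff)
  moreover from pop_convergent[OF S this] obtain B where B: "(\<lambda>n. pop S (map_poly cnj (p n))) \<longlonglongrightarrow> B" .
  ultimately have "represents S (\<lambda>t. cnj (f t)) B"
    by (auto simp: represents_def)
  moreover have "cinner (blinfun_apply A x) y = cinner x (blinfun_apply B y)" for x y
  proof (rule LIMSEQ_unique)
    show "(\<lambda>n. cinner (blinfun_apply (pop S (p n)) x) y) \<longlonglongrightarrow> cinner (blinfun_apply A x) y"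
      by (intro tendsto_cinner blinfun.tendsto p(2) tendsto_const)
    show "(\<lambda>n. cinner (blinfun_apply (pop S (p n)) x) y) \<longlonglongrightarrow> cinner x (blinfun_apply B y)"
      unfolding cinner_pop[OF S] by (intro tendsto_cinner blinfun.tendsto B tendsto_const)
  qed
  ultimately show ?thesis by blast
qed

lemma represents_hermitian:
  fixes S :: "'a :: complex_hilbert \<Rightarrow>\<^sub>L 'a"
  assumes S: "hermitian S" and rep: "represents S f A"
    and real: "\<And>t. t \<in> bspec S \<Longrightarrow> f t \<in> \<real>"
  shows "hermitian A"
proof -
  obtain B where B: "represents S (\<lambda>t. cnj (f t)) B"
      "\<And>x y. cinner (blinfun_apply A x) y = cinner x (blinfun_apply B y)"
    using represents_adjoint[OF S rep] by blast
  moreover have "A = B"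
    using represents_unique[OF S rep B(1)] real by (simp add: Reals_cnj_iff)
  ultimately show ?thesis by (simp add: hermitian_def)
qed

text \<open>Commuting with \<open>S\<close> passes to polynomials in \<open>S\<close> and then to
  limits. Square roots taken from the calculus inherit this property, on which their uniqueness
  rests.\<close>

lemma represents_commute:
  assumes rep: "represents S f B" and A: "A \<in> bounded_operators" "A o\<^sub>L S = S o\<^sub>L A"
  shows "A o\<^sub>L B = B o\<^sub>L A"
proof -
  obtain p where p: "(\<lambda>n. pop S (p n)) \<longlonglongrightarrow> B"
    using rep by (auto simp: represents_def)
  show ?thesis
  proof (rule LIMSEQ_unique)
    show "(\<lambda>n. A o\<^sub>L pop S (p n)) \<longlonglongrightarrow> (A o\<^sub>L B)"
      by (intro bounded_bilinear.tendsto[OF bounded_bilinear_blinfun_compose] p tendsto_const)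
    show "(\<lambda>n. A o\<^sub>L pop S (p n)) \<longlonglongrightarrow> (B o\<^sub>L A)"
      unfolding pop_commute[OF A]
      by (intro bounded_bilinear.tendsto[OF bounded_bilinear_blinfun_compose] p tendsto_const)
  qed
qed

lemma pop_in_cstar_subalgebra:
  assumes M: "cstar_subalgebra M" "S \<in> M" "id_blinfun \<in> M"
  shows "pop S p \<in> M"
  using M by (induction p) (auto simp: pop_pCons cstar_subalgebra_def)

lemma represents_in_cstar_algebra:
  assumes "represents S f B"
  shows "B \<in> cstar_algebra S"
proof -
  obtain p where p: "(\<lambda>n. pop S (p n)) \<longlonglongrightarrow> B"
    using assms by (auto simp: represents_def)
  have "B \<in> M" if M: "cstar_subalgebra M" "S \<in> M" "id_blinfun \<in> M" for M
  proof (rule closed_sequentially[OF _ _ p])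
    show "closed M" using M(1) by (simp add: cstar_subalgebra_def)
    show "pop S (p n) \<in> M" for n using pop_in_cstar_subalgebra[OF M] by blast
  qed
  then show ?thesis by (auto simp: cstar_algebra_def)
qed

lemma blinfun_adjoint_eqI:
  assumes "\<And>x y. cinner (blinfun_apply A x) y = cinner x (blinfun_apply B y)"
  shows "blinfun_adjoint A = B"
  unfolding blinfun_adjoint_def
proof (rule the_equality)
  fix C assume C: "\<forall>x y. cinner (blinfun_apply A x) y = cinner x (blinfun_apply C y)"
  show "C = B"
    by (rule blinfun_eqI, rule cinner_ext_right) (metis C assms)
qed (use assms in blast)

lemma sup_norm_le_iff:
  assumes "bounded (f ` X)" "0 \<le> C"
  shows "sup_norm X f \<le> C \<longleftrightarrow> (\<forall>x\<in>X. cmod (f x) \<le> C)"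
proof -
  have "bdd_above (insert 0 ((\<lambda>x. cmod (f x)) ` X))"
    using assms(1) by (auto simp: bounded_iff intro: bdd_aboveI2)
  then show ?thesis
    unfolding sup_norm_def using assms(2) by (subst cSup_le_iff) auto
qed

lemma sup_norm_nonneg: "bounded (f ` X) \<Longrightarrow> 0 \<le> sup_norm X f"
  unfolding sup_norm_def by (rule cSup_upper) (auto simp: bounded_iff intro: bdd_aboveI2)

lemma represents_sup_norm:
  fixes S :: "'a :: complex_hilbert \<Rightarrow>\<^sub>L 'a"
  assumes S: "hermitian S" and rep: "represents S f B"
  shows "norm B = sup_norm (bspec S) f"
proof (rule antisym)
  have bounded: "bounded (f ` bspec S)"
    using represents_norm_ge[OF S rep] by (auto simp: bounded_iff)
  show "norm B \<le> sup_norm (bspec S) f"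
    using sup_norm_le_iff[OF bounded sup_norm_nonneg[OF bounded]] sup_norm_nonneg[OF bounded]
    by (intro represents_norm_le[OF S rep]) auto
  show "sup_norm (bspec S) f \<le> norm B"
    using sup_norm_le_iff[OF bounded norm_ge_zero] represents_norm_ge[OF S rep] by blast
qed

text \<open>The choice in \<open>cfc\<close> says something only once a witness exists. Picking for
  each continuous \<open>f\<close> an operator that represents it gives one; its homomorphism laws
  are instances of uniqueness of the represented operator.\<close>

lemma cfc_hermitian:
  fixes S :: "'a :: complex_hilbert \<Rightarrow>\<^sub>L 'a"
  assumes S: "hermitian S"
  shows "isometric_star_hom (bspec S) (C_fun (bspec S)) (cstar_algebra S) (cfc S)"
    and "cfc S (\<lambda>x. 1) = id_blinfun" and "cfc S complex_of_real = S"
proof -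
  define \<Phi> where "\<Phi> f = (SOME B. represents S f B)" for f
  have \<Phi>: "represents S f (\<Phi> f)" if "f \<in> C_fun (bspec S)" for f
  proof -
    have "continuous_on (bspec S) f" using that by (simp add: C_fun_def)
    then obtain B where "represents S f B" by (rule represents_exists[OF S])
    then show ?thesis unfolding \<Phi>_def by (rule someI)
  qed
  have \<Phi>_eq: "\<Phi> f = B" if "represents S f B" for f B
    unfolding \<Phi>_def using someI[of "represents S f", OF that] represents_unique[OF S] that by blast
  have "isometric_star_hom (bspec S) (C_fun (bspec S)) (cstar_algebra S) \<Phi>"
    unfolding isometric_star_hom_def
  proof (intro conjI ballI allI)
    fix f g c assume f: "f \<in> C_fun (bspec S)" and g: "g \<in> C_fun (bspec S)"
    show "\<Phi> f \<in> cstar_algebra S" by (rule represents_in_cstar_algebra[OF \<Phi>[OF f]])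
    show "\<Phi> (\<lambda>x. f x + g x) = \<Phi> f + \<Phi> g" by (intro \<Phi>_eq represents_add \<Phi> f g)
    show "\<Phi> (\<lambda>x. c * f x) = scaleC_blinfun c (\<Phi> f)" by (intro \<Phi>_eq represents_scale S \<Phi> f)
    show "\<Phi> (\<lambda>x. f x * g x) = \<Phi> f o\<^sub>L \<Phi> g" by (intro \<Phi>_eq represents_mult S \<Phi> f g)
    obtain B where B: "represents S (\<lambda>t. cnj (f t)) B"
        "\<And>x y. cinner (blinfun_apply (\<Phi> f) x) y = cinner x (blinfun_apply B y)"
      using represents_adjoint[OF S \<Phi>[OF f]] by blast
    show "\<Phi> (\<lambda>x. cnj (f x)) = blinfun_adjoint (\<Phi> f)"
      using \<Phi>_eq[OF B(1)] blinfun_adjoint_eqI[OF B(2)] by simp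
    show "norm (\<Phi> f) = sup_norm (bspec S) f" by (rule represents_sup_norm[OF S \<Phi>[OF f]])
  qed
  moreover have "\<Phi> (\<lambda>x. 1) = id_blinfun"
  proof (rule \<Phi>_eq)
    have "pop S [:1:] = id_blinfun" by (rule blinfun_eqI) (simp add: pop_const scaleC_one)
    moreover have "cpoly_fun [:1:] = (\<lambda>x. 1)" by (simp add: cpoly_fun_def fun_eq_iff)
    ultimately show "represents S (\<lambda>x. 1) id_blinfun"
      using represents_poly[of S "[:1:]"] by simp
  qed
  moreover have "\<Phi> complex_of_real = S"
  proof (rule \<Phi>_eq)
    have "cpoly_fun [:0, 1:] = complex_of_real" by (simp add: cpoly_fun_def fun_eq_iff)
    then show "represents S complex_of_real S"
      using represents_poly[of S "[:0, 1:]"] by (simp add: pop_id)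
  qed
  ultimately have "isometric_star_hom (bspec S) (C_fun (bspec S)) (cstar_algebra S) (cfc S) \<and>
      cfc S (\<lambda>x. 1) = id_blinfun \<and> cfc S complex_of_real = S"
    unfolding cfc_def bspec_def
    by (intro someI[where P = "\<lambda>\<Phi>. isometric_star_hom _ _ _ \<Phi> \<and> \<Phi> _ = _ \<and> \<Phi> _ = _"] conjI)
  then show "isometric_star_hom (bspec S) (C_fun (bspec S)) (cstar_algebra S) (cfc S)"
    and "cfc S (\<lambda>x. 1) = id_blinfun" and "cfc S complex_of_real = S"
    by auto
qed

section \<open>Positive square roots\<close>

definition positive_blinfun :: "('a :: complex_inner \<Rightarrow>\<^sub>L 'a) \<Rightarrow> bool" where
  "positive_blinfun A \<longleftrightarrow> hermitian A \<and> (\<forall>x. 0 \<le> Re (cinner x (A x)))"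

text \<open>For \<open>t < 0\<close> positivity makes the real part of \<langle>x, (A - t)
  x\<rangle> at least \<open>- t\<close> times the squared norm of \<open>x\<close>, so
  \<open>- t\<close> is a lower bound for \<open>A - t\<close>.\<close>

lemma bspec_nonneg:
  fixes A :: "'a :: complex_hilbert \<Rightarrow>\<^sub>L 'a"
  assumes A: "positive_blinfun A" and t: "t \<in> bspec A"
  shows "0 \<le> t"
proof (rule ccontr)
  assume "\<not> 0 \<le> t"
  then have neg: "0 < - t" by simp
  have below: "- t * norm x \<le> norm (A x - t *\<^sub>R x)" for x
  proof (cases "x = 0")
    case False
    have "- t * (norm x)\<^sup>2 \<le> Re (cinner x (A x - t *\<^sub>R x))"
      using A by (simp add: positive_blinfun_def scaleR_scaleC cinner_diff_right
        cinner_scaleC_right cinner_self)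
    also have "\<dots> \<le> norm x * norm (A x - t *\<^sub>R x)"
      using cinner_cauchy_schwarz complex_Re_le_cmod order_trans by blast
    finally have "norm x * (- t * norm x) \<le> norm x * norm (A x - t *\<^sub>R x)"
      by (simp add: power2_eq_square ac_simps)
    then show ?thesis
      by (rule mult_left_le_imp_le) (use False in simp)
  qed (simp add: blinfun.bilinear_simps)
  have "hermitian A" using A by (simp add: positive_blinfun_def)
  then have "t \<notin> bspec A"
    unfolding bspec_iff[OF \<open>hermitian A\<close>] not_not by (intro exI conjI allI) (rule neg, rule below)
  then show False using t by contradiction
qed

lemma hermitian_square_root:
  fixes A :: "'a :: complex_hilbert \<Rightarrow>\<^sub>L 'a"
  assumes A: "positive_blinfun A"
  obtains B where "hermitian B" "B o\<^sub>L B = A" "represents A (\<lambda>t. complex_of_real (sqrt t)) B"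
proof -
  have herm: "hermitian A" using A by (simp add: positive_blinfun_def)
  have cont: "continuous_on (bspec A) (\<lambda>t. complex_of_real (sqrt t))"
    by (intro continuous_intros)
  obtain B where B: "represents A (\<lambda>t. complex_of_real (sqrt t)) B"
    by (rule represents_exists[OF herm cont])
  have "hermitian B"
    by (rule represents_hermitian[OF herm B]) simp
  moreover have "B o\<^sub>L B = pop A [:0, 1:]"
  proof (rule represents_unique[OF herm represents_mult[OF herm B B] represents_poly])
    fix t assume "t \<in> bspec A"
    then have "0 \<le> t" by (rule bspec_nonneg[OF A])
    then show "complex_of_real (sqrt t) * complex_of_real (sqrt t) = cpoly_fun [:0, 1:] t"
      by (simp add: cpoly_fun_def flip: of_real_mult)
  qed
  ultimately show ?thesis using that B by (simp add: pop_id)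
qed

lemma cinner_square:
  assumes "hermitian B"
  shows "cinner x (B (B x)) = complex_of_real ((norm (B x))\<^sup>2)"
  using hermitianD[OF assms, of x "B x"] by (simp add: cinner_self)

lemma positive_square_root:
  fixes A :: "'a :: complex_hilbert \<Rightarrow>\<^sub>L 'a"
  assumes A: "positive_blinfun A"
  obtains Q where "positive_blinfun Q" "Q o\<^sub>L Q = A"
    "\<And>C. C \<in> bounded_operators \<Longrightarrow> C o\<^sub>L A = A o\<^sub>L C \<Longrightarrow> C o\<^sub>L Q = Q o\<^sub>L C"
proof -
  have herm: "hermitian A" using A by (simp add: positive_blinfun_def)
  obtain Q where Q: "hermitian Q" "Q o\<^sub>L Q = A" "represents A (\<lambda>t. complex_of_real (sqrt t)) Q"
    using hermitian_square_root[OF A] by blast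
  \<comment> \<open>The fourth root \<open>W\<close> of \<open>A\<close> serves to show that
    \<open>Q\<close> is positive, being the square of a Hermitian operator.\<close>
  have cont: "continuous_on (bspec A) (\<lambda>t. complex_of_real (sqrt (sqrt t)))"
    by (intro continuous_intros)
  obtain W where W: "represents A (\<lambda>t. complex_of_real (sqrt (sqrt t))) W"
    by (rule represents_exists[OF herm cont])
  have "hermitian W"
    by (rule represents_hermitian[OF herm W]) simp
  have "W o\<^sub>L W = Q"
  proof (rule represents_unique[OF herm represents_mult[OF herm W W] Q(3)])
    fix t assume "t \<in> bspec A"
    then have "0 \<le> t" by (rule bspec_nonneg[OF A])
    then show "complex_of_real (sqrt (sqrt t)) * complex_of_real (sqrt (sqrt t)) = complex_of_real (sqrt t)"
      by (simp flip: of_real_mult)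
  qed
  then have "cinner x (Q x) = complex_of_real ((norm (W x))\<^sup>2)" for x
    using cinner_square[OF \<open>hermitian W\<close>, of x] by auto
  then have "positive_blinfun Q"
    using Q(1) by (simp add: positive_blinfun_def)
  with Q show ?thesis using that represents_commute by blast
qed

text \<open>For a Hermitian root \<open>W\<close> of \<open>A\<close> the number \<langle>x, A
  x\<rangle> is the squared norm of \<open>W x\<close>.\<close>

lemma positive_blinfun_null:
  fixes A :: "'a :: complex_hilbert \<Rightarrow>\<^sub>L 'a"
  assumes "positive_blinfun A" "Re (cinner x (A x)) = 0"
  shows "A x = 0"
proof -
  obtain W where W: "hermitian W" "W o\<^sub>L W = A"
    using hermitian_square_root[OF assms(1)] by blast
  have "cinner x (A x) = complex_of_real ((norm (W x))\<^sup>2)"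
    using cinner_square[OF W(1), of x] W(2) by auto
  then have "W x = 0" using assms(2) by simp
  then show ?thesis using W(2) by (auto simp: blinfun.bilinear_simps)
qed

text \<open>\<open>Q'\<close> commutes with its own square \<open>A\<close>, hence with
  \<open>Q\<close>, so \<open>(Q + Q')(Q - Q') = 0\<close>. For \<open>y = Q x - Q' x\<close> the
  real parts of \<langle>y, Q y\<rangle> and \<langle>y, Q' y\<rangle> are nonnegative with sum 0,
  which gives \<open>Q y = 0\<close>, then \<open>A y = 0\<close> and \<open>y = 0\<close>.\<close>

lemma positive_square_root_unique:
  fixes A Q Q' :: "'a :: complex_hilbert \<Rightarrow>\<^sub>L 'a"
  assumes Q: "positive_blinfun Q" "Q o\<^sub>L Q = A"
    and comm: "\<And>C. C \<in> bounded_operators \<Longrightarrow> C o\<^sub>L A = A o\<^sub>L C \<Longrightarrow> C o\<^sub>L Q = Q o\<^sub>L C"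
    and Q': "positive_blinfun Q'" "Q' o\<^sub>L Q' = A" and inj: "\<And>x. A x = 0 \<Longrightarrow> x = 0"
  shows "Q' = Q"
proof (rule blinfun_eqI)
  fix x
  have QQ: "Q (Q y) = A y" "Q' (Q' y) = A y" for y
    using Q(2) Q'(2) by (metis blinfun_apply_blinfun_compose)+
  have "Q' o\<^sub>L A = A o\<^sub>L Q'"
    by (rule blinfun_eqI) (simp flip: QQ(2))
  then have "Q' o\<^sub>L Q = Q o\<^sub>L Q'"
    using comm Q'(1) hermitian_bounded_operators by (auto simp: positive_blinfun_def)
  then have QQ': "Q' (Q y) = Q (Q' y)" for y
    by (metis blinfun_apply_blinfun_compose)
  define y where "y = Q x - Q' x"
  have "Q y + Q' y = 0"
    by (simp add: y_def blinfun.bilinear_simps QQ QQ')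
  then have "Re (cinner y (Q y)) + Re (cinner y (Q' y)) = 0"
    by (metis cinner_add_right cinner_zero_right plus_complex.sel(1) zero_complex.sel(1))
  then have "Re (cinner y (Q y)) = 0"
    using Q(1) Q'(1) unfolding positive_blinfun_def by (smt (verit))
  then have "Q y = 0" by (rule positive_blinfun_null[OF Q(1)])
  then have "y = 0" using inj[of y] by (simp add: blinfun.bilinear_simps flip: QQ(1))
  then show "Q' x = Q x" by (simp add: y_def)
qed

text \<open>The orthogonal complement of the range of a Hermitian operator is its kernel.\<close>

lemma hermitian_dense_range:
  fixes Q :: "'a :: complex_hilbert \<Rightarrow>\<^sub>L 'a"
  assumes Q: "hermitian Q" and inj: "\<And>x. Q x = 0 \<Longrightarrow> x = 0"
  shows "closure (range Q) = UNIV"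
proof (rule csubspace_dense)
  have "0 = Q 0" "Q x + Q y = Q (x + y)" "c *\<^sub>C Q x = Q (c *\<^sub>C x)" for x y c
    using bounded_operators_scaleC[OF hermitian_bounded_operators[OF Q]]
    by (simp_all add: blinfun.bilinear_simps)
  then show "csubspace (range Q)"
    unfolding csubspace_iff by (metis (no_types, lifting) rangeE rangeI)
  fix y assume "\<And>x. x \<in> range Q \<Longrightarrow> cinner x y = 0"
  then have "cinner x (Q y) = cinner x 0" for x
    using hermitianD[OF Q, of x y] by simp
  then have "Q y = 0" by (rule cinner_ext_right)
  then show "y = 0" by (rule inj)
qed

section \<open>Inverses of injective Hermitian operators and their unbounded square roots\<close>

lemma self_adjoint_converse_blinfun_graph:
  fixes Q :: "'a :: complex_hilbert \<Rightarrow>\<^sub>L 'a"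
  assumes Q: "hermitian Q" and inj: "\<And>x. Q x = 0 \<Longrightarrow> x = 0"
  shows "self_adjoint (converse (blinfun_graph Q))"
  unfolding self_adjoint_def
proof (intro conjI)
  have "x = y" if "Q x = Q y" for x y
    using inj[of "x - y"] that by (simp add: blinfun.bilinear_simps)
  then show "linear_operator (converse (blinfun_graph Q))"
    unfolding linear_operator_def
    using bounded_operators_scaleC[OF hermitian_bounded_operators[OF Q]]
    by (auto intro!: csubspace_graphI simp: single_valued_def blinfun.bilinear_simps)
  have "Domain (converse (blinfun_graph Q)) = range Q"
    by (auto simp: blinfun_graph_def)
  then show "densely_defined (converse (blinfun_graph Q))"
    by (simp add: densely_defined_def hermitian_dense_range[OF Q inj])
  show "op_adjoint (converse (blinfun_graph Q)) = converse (blinfun_graph Q)"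
  proof (intro set_eqI, clarify)
    fix y z
    have "(y, z) \<in> op_adjoint (converse (blinfun_graph Q)) \<longleftrightarrow> (\<forall>w. cinner y w = cinner z (Q w))"
      by (auto simp: op_adjoint_def blinfun_graph_def)
    also have "\<dots> \<longleftrightarrow> (\<forall>w. cinner y w = cinner (Q z) w)"
      by (simp add: hermitianD[OF Q])
    also have "\<dots> \<longleftrightarrow> y = Q z"
      using cinner_ext_left by metis
    finally show "(y, z) \<in> op_adjoint (converse (blinfun_graph Q)) \<longleftrightarrow>
        (y, z) \<in> converse (blinfun_graph Q)"
      by simp
  qed
qed

lemma positive_operator_converse_blinfun_graph:
  "positive_blinfun Q \<Longrightarrow> positive_operator (converse (blinfun_graph Q))"
proof -
  assume Q: "positive_blinfun Q"
  have "cinner (Q y) y \<in> \<real>\<^sub>\<ge>\<^sub>0" for y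
  proof -
    have "cinner (Q y) y = cinner y (Q y)" using Q by (simp add: positive_blinfun_def hermitianD)
    moreover from this have "cnj (cinner y (Q y)) = cinner y (Q y)" by (metis cinner_commute)
    ultimately show ?thesis
      using Q by (simp add: complex_nonneg_Reals_iff positive_blinfun_def complex_eq_iff)
  qed
  then show ?thesis by (auto simp: positive_operator_def)
qed

text \<open>The work lies in uniqueness: a positive self-adjoint \<open>B\<close> whose square is
  the inverse of \<open>R\<close> is injective, and its inverse is everywhere defined and bounded.
  That inverse is a positive root of \<open>R\<close>, hence equal to \<open>Q\<close> by uniqueness
  among bounded operators.\<close>

lemma op_sqrt_converse_blinfun_graph:
  fixes Q R :: "'a :: complex_hilbert \<Rightarrow>\<^sub>L 'a"
  assumes Q: "positive_blinfun Q" "Q o\<^sub>L Q = R"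
    and comm: "\<And>C. C \<in> bounded_operators \<Longrightarrow> C o\<^sub>L R = R o\<^sub>L C \<Longrightarrow> C o\<^sub>L Q = Q o\<^sub>L C"
    and inj: "\<And>x. R x = 0 \<Longrightarrow> x = 0"
  shows "op_sqrt (converse (blinfun_graph R)) = converse (blinfun_graph Q)"
  unfolding op_sqrt_def
proof (rule the_equality)
  have QQ: "Q (Q y) = R y" for y using Q(2) by auto
  have "x = 0" if "Q x = 0" for x
    using inj[of x] that by (simp add: blinfun.bilinear_simps flip: QQ)
  then have "self_adjoint (converse (blinfun_graph Q))"
    using Q(1) by (intro self_adjoint_converse_blinfun_graph) (auto simp: positive_blinfun_def)
  moreover have "op_comp (converse (blinfun_graph Q)) (converse (blinfun_graph Q))
      = converse (blinfun_graph R)"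
    by (auto simp: op_comp_def relcomp_unfold set_eq_iff QQ)
  ultimately show "self_adjoint (converse (blinfun_graph Q)) \<and>
      positive_operator (converse (blinfun_graph Q)) \<and>
      op_comp (converse (blinfun_graph Q)) (converse (blinfun_graph Q)) = converse (blinfun_graph R)"
    using positive_operator_converse_blinfun_graph[OF Q(1)] by blast
next
  fix B assume "self_adjoint B \<and> positive_operator B \<and> op_comp B B = converse (blinfun_graph R)"
  then have sa: "self_adjoint B" and pos: "positive_operator B"
    and BB: "\<And>x w. (\<exists>y. (x, y) \<in> B \<and> (y, w) \<in> B) \<longleftrightarrow> x = R w"
    by (auto simp: op_comp_def set_eq_iff relcomp_unfold)
  note B = csubspace_graph[OF self_adjoint_csubspace[OF sa]]
  have B_inj: "x = x'" if "(x, w) \<in> B" "(x', w) \<in> B" for x x' w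
  proof -
    have "(x - x', 0) \<in> B" using B(4)[OF that] by simp
    then have "x - x' = R 0" using BB[of "x - x'" 0] B(1) by blast
    then show ?thesis by (simp add: blinfun.bilinear_simps)
  qed
  \<comment> \<open>The square of \<open>B\<close> sends \<open>R w\<close> to \<open>w\<close>
    through an intermediate point, which by injectivity of \<open>B\<close> is
    \<open>x\<close>.\<close>
  have RB: "(R w, x) \<in> B" if "(x, w) \<in> B" for x w
    using BB[of "R w" w] B_inj that by metis
  have "csubspace (converse B)"
    using B by (intro csubspace_graphI) auto
  moreover have "\<exists>x. (w, x) \<in> converse B" for w
    using BB[of "R w" w] by auto
  moreover have "norm x \<le> sqrt (norm R) * norm w" if "(w, x) \<in> converse B" for w x
  proof (rule power2_le_imp_le)
    \<comment> \<open>Symmetry of \<open>B\<close> for the pairs \<open>(R w, x)\<close> and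
      \<open>(x, w)\<close>.\<close>
    have "(norm x)\<^sup>2 = Re (cinner (R w) w)"
      using self_adjoint_symmetric[OF sa RB, of x w x w] that by (simp add: norm_sq_eq)
    also have "\<dots> \<le> norm (R w) * norm w"
      using cinner_cauchy_schwarz complex_Re_le_cmod order_trans by blast
    also have "\<dots> \<le> (norm R * norm w) * norm w"
      by (intro mult_right_mono norm_blinfun) simp
    finally show "(norm x)\<^sup>2 \<le> (sqrt (norm R) * norm w)\<^sup>2"
      by (simp add: power_mult_distrib) (simp add: power2_eq_square mult.assoc)
  qed simp
  ultimately obtain Q' where Q': "blinfun_graph Q' = converse B"
    by (rule everywhere_defined_blinfun)
  then have BQ: "(x, w) \<in> B \<longleftrightarrow> x = Q' w" for x w
    by (metis blinfun_graph_iff converse_iff)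
  have "hermitian Q'"
    unfolding hermitian_def using self_adjoint_symmetric[OF sa, of "Q' _" _ "Q' _"] BQ by metis
  moreover from this have "0 \<le> Re (cinner x (Q' x))" for x
    using pos BQ[of "Q' x" x]
    by (auto simp: positive_operator_def complex_nonneg_Reals_iff hermitianD)
  ultimately have "positive_blinfun Q'" by (simp add: positive_blinfun_def)
  moreover have "Q' o\<^sub>L Q' = R"
  proof (rule blinfun_eqI)
    fix w
    have "R w = Q' (Q' w)" using BB[of "R w" w] BQ by auto
    then show "(Q' o\<^sub>L Q') w = R w" by simp
  qed
  ultimately have "Q' = Q"
    using positive_square_root_unique[OF Q comm] inj by blast
  then show "B = converse (blinfun_graph Q)"
    using Q' by auto
qed

section \<open>The bounded transform\<close>

lemma self_adjoint_cinner_real: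
  assumes "self_adjoint T" "(x, y) \<in> T"
  shows "Im (cinner x y) = 0"
  using self_adjoint_symmetric[OF assms assms(2)] cinner_commute[of x y]
  by (simp add: complex_eq_iff)

text \<open>\<langle>x, y\<rangle> is real, so the inner product of \<open>y\<close> and
  \<open>z *\<^sub>C x\<close> has real part 0 and Pythagoras applies.\<close>

lemma norm_shift_imaginary:
  assumes T: "self_adjoint T" "(x, y) \<in> T" and z: "z = \<i> \<or> z = - \<i>"
  shows "norm x \<le> norm (y - z *\<^sub>C x)"
proof -
  have "Re (cinner y (z *\<^sub>C x)) = 0"
    using self_adjoint_cinner_real[OF T] cinner_commute[of y x] z
    by (auto simp: cinner_scaleC_right)
  then have "(norm x)\<^sup>2 \<le> (norm (y - z *\<^sub>C x))\<^sup>2"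
    using z by (auto simp: norm_diff_sq norm_scaleC)
  then show ?thesis by (rule power2_le_imp_le) simp
qed

lemma self_adjoint_resolvent_imaginary:
  fixes T :: "'a :: complex_hilbert operator"
  assumes T: "self_adjoint T" and z: "z = \<i> \<or> z = - \<i>"
  obtains B where "B \<in> bounded_operators" "\<And>w. (B w, w + z *\<^sub>C B w) \<in> T"
proof -
  have below: "1 * norm x \<le> norm (y - z *\<^sub>C x)" if "(x, y) \<in> T" for x y
    using norm_shift_imaginary[OF T that z] by simp
  have "x = 0" if "(x, cnj z *\<^sub>C x) \<in> T" for x
    using norm_shift_imaginary[OF T that, of "cnj z"] z by auto
  from self_adjoint_resolvent[OF T zero_less_one below this] obtain B where
    B: "B \<in> bounded_operators" "blinfun_graph B = converse {(x, y - z *\<^sub>C x) | x y. (x, y) \<in> T}"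
    by blast
  have "(B w, w + z *\<^sub>C B w) \<in> T" for w
  proof -
    have "(w, B w) \<in> blinfun_graph B" by simp
    then obtain y where "(B w, y) \<in> T" "w = y - z *\<^sub>C B w"
      unfolding B(2) by auto
    then show ?thesis by (metis diff_add_cancel)
  qed
  with B(1) show ?thesis using that by blast
qed

text \<open>\<open>R = (I + T\<^sup>2)\<^sup>-\<^sup>1\<close> and \<open>Z = T R\<close>\<close>

locale resolvent_pair =
  fixes T :: "'a :: complex_hilbert operator" and R Z :: "'a \<Rightarrow>\<^sub>L 'a"
  assumes self_adjoint: "self_adjoint T"
    and R_Z: "\<And>x. (R x, Z x) \<in> T"
    and Z_R: "\<And>x. (Z x, x - R x) \<in> T"

text \<open>Since \<open>(T - \<i>)(T + \<i>) = T\<^sup>2 + I\<close>, the operator \<open>R\<close>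
  is the product of the resolvents \<open>A\<close> at \<i> and \<open>B\<close> at -\<i>; the
  formula \<open>Z = B + \<i> R\<close> comes from \<open>T A = I + \<i> A\<close>.\<close>

lemma resolvent_pair_exists:
  fixes T :: "'a :: complex_hilbert operator"
  assumes T: "self_adjoint T"
  obtains R Z where "resolvent_pair T R Z"
proof -
  note T' = csubspace_graph[OF self_adjoint_csubspace[OF T]]
  obtain A :: "'a \<Rightarrow>\<^sub>L 'a" where A: "\<And>w. (A w, w + \<i> *\<^sub>C A w) \<in> T"
    using self_adjoint_resolvent_imaginary[OF T, of \<i>] by blast
  obtain B :: "'a \<Rightarrow>\<^sub>L 'a" where B: "\<And>w. (B w, w + (- \<i>) *\<^sub>C B w) \<in> T"
    using self_adjoint_resolvent_imaginary[OF T, of "- \<i>"] by blast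
  define R where "R = A o\<^sub>L B"
  define Z where "Z = B + scaleC_blinfun \<i> R"
  have RZ: "(R w, Z w) \<in> T" for w
    using A[of "B w"] by (simp add: R_def Z_def blinfun.bilinear_simps)
  have "(Z w, w - R w) \<in> T" for w
  proof -
    have "w + (- \<i>) *\<^sub>C B w + \<i> *\<^sub>C Z w = w - R w"
      by (simp add: Z_def blinfun.bilinear_simps scaleC_add_right scaleC_minus_left scaleC_scaleC
        scaleC_minus_one)
    moreover have "B w + \<i> *\<^sub>C R w = Z w"
      by (simp add: Z_def blinfun.bilinear_simps)
    ultimately show ?thesis
      using T'(2)[OF B[of w] T'(3)[OF RZ[of w], of \<i>]] by (simp only:)
  qed
  with T RZ have "resolvent_pair T R Z" by (intro resolvent_pair.intro)
  then show ?thesis by (rule that)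
qed

context resolvent_pair
begin

lemmas graph = csubspace_graph[OF self_adjoint_csubspace[OF self_adjoint]]
lemmas symmetric = self_adjoint_symmetric[OF self_adjoint]

text \<open>Uniqueness of the solution of \<open>x + T (T x) = w\<close>: the differences
  \<open>a\<close> and \<open>b\<close> satisfy \<open>T a = b\<close> and \<open>T b = - a\<close>,
  and symmetry of \<open>T\<close> makes the sum of their squared norms 0.\<close>

lemma R_Z_eqI:
  assumes "(x, y) \<in> T" "(y, z) \<in> T" "w = x + z"
  shows "R w = x" "Z w = y"
proof -
  define a b where "a = x - R w" and "b = y - Z w"
  have ab: "(a, b) \<in> T" unfolding a_def b_def by (rule graph(4)[OF assms(1) R_Z])
  have "z - (w - R w) = - a" using assms(3) by (simp add: a_def)
  then have ba: "(b, - a) \<in> T" unfolding b_def using graph(4)[OF assms(2) Z_R, of w] by simp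
  have "- cinner a a = cinner b b"
    using symmetric[OF ab ba] by (simp add: cinner_minus_right)
  from arg_cong[OF this, of Re] have "(norm a)\<^sup>2 + (norm b)\<^sup>2 = 0" by (simp add: norm_sq_eq)
  then have "a = 0" "b = 0" by (simp_all add: sum_power2_eq_zero_iff)
  then show "R w = x" "Z w = y" by (simp_all add: a_def b_def)
qed

text \<open>Splitting \<open>w\<close> as \<open>R w + T (Z w)\<close> and moving \<open>T\<close>
  across. The right side becomes its conjugate when \<open>v\<close> and \<open>w\<close> are
  exchanged, which is why \<open>R\<close> is Hermitian and positive.\<close>

lemma cinner_R_Z: "cinner (R v) w = cinner (R v) (R w) + cinner (Z v) (Z w)"
  using symmetric[OF R_Z Z_R, of v w] by (simp add: cinner_diff_right diff_eq_eq add.commute)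

lemma cinner_R: "cinner (R x) x = complex_of_real ((norm (R x))\<^sup>2 + (norm (Z x))\<^sup>2)"
  by (simp add: cinner_R_Z[of x x] cinner_self)

lemma hermitian_R: "hermitian R"
  unfolding hermitian_def
proof (intro allI)
  fix v w
  have "cinner v (R w) = cinner (R v) (R w) + cinner (Z v) (Z w)"
    using symmetric[OF Z_R R_Z, of v w] by (simp add: cinner_diff_left)
  then show "cinner (R v) w = cinner v (R w)" by (simp add: cinner_R_Z[of v w])
qed

lemma hermitian_Z: "hermitian Z"
  unfolding hermitian_def
proof (intro allI)
  fix v w
  have "cinner (Z v) w - cinner (Z v) (R w) = cinner v (Z w) - cinner (R v) (Z w)"
    using symmetric[OF Z_R Z_R, of v w] by (simp add: cinner_diff_left cinner_diff_right)
  moreover have "cinner (R v) (Z w) = cinner (Z v) (R w)"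
    by (rule symmetric[OF R_Z R_Z])
  ultimately show "cinner (Z v) w = cinner v (Z w)" by simp
qed

lemma positive_R: "positive_blinfun R"
  unfolding positive_blinfun_def
proof (intro conjI allI hermitian_R)
  show "0 \<le> Re (cinner x (R x))" for x
    using cinner_R[of x] by (simp add: hermitianD[OF hermitian_R])
qed

lemma norm_R_Z_sq: "(norm (R x))\<^sup>2 + (norm (Z x))\<^sup>2 \<le> norm (R x) * norm x"
proof -
  have "(norm (R x))\<^sup>2 + (norm (Z x))\<^sup>2 = Re (cinner (R x) x)"
    by (simp add: cinner_R)
  also have "\<dots> \<le> norm (R x) * norm x"
    using cinner_cauchy_schwarz complex_Re_le_cmod order_trans by blast
  finally show ?thesis .
qed

lemma norm_R_le: "norm (R x) \<le> norm x"
proof (rule ccontr)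
  assume *: "\<not> norm (R x) \<le> norm x"
  then have "norm (R x) * norm x < norm (R x) * norm (R x)"
    by (intro mult_strict_left_mono) (auto intro: le_less_trans[OF norm_ge_zero])
  then show False using norm_R_Z_sq[of x] by (simp add: power2_eq_square) (smt (verit) zero_le_square)
qed

lemma norm_Z_le: "norm (Z x) \<le> norm x"
proof (rule power2_le_imp_le)
  have "norm (R x) * norm x \<le> norm x * norm x"
    by (intro mult_right_mono norm_R_le) simp
  then show "(norm (Z x))\<^sup>2 \<le> (norm x)\<^sup>2"
    using norm_R_Z_sq[of x] zero_le_power2[of "norm (R x)"]
    unfolding power2_eq_square by linarith
qed simp

lemma R_injective: "R x = 0 \<Longrightarrow> x = 0"
proof -
  assume R: "R x = 0"
  then have "(norm (Z x))\<^sup>2 \<le> 0" using norm_R_Z_sq[of x] by simp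
  then have "Z x = 0" by simp
  then have "(0, x) \<in> T" using Z_R[of x] R by simp
  with graph(1) show "x = 0" using self_adjoint_single_valued[OF self_adjoint] by blast
qed

text \<open>The vectors \<open>Z x\<close> and \<open>x - R x\<close> solve the system that
  determines \<open>R y\<close> and \<open>Z y\<close>. These are the identities
  \<open>R T = Z\<close> and \<open>Z T = I - R\<close> on the domain of \<open>T\<close>.\<close>

lemma R_T_eq:
  assumes "(x, y) \<in> T"
  shows "R y = Z x" "Z y = x - R x"
  using R_Z_eqI[OF Z_R graph(4)[OF assms R_Z], of y] by simp_all

lemma R_Z_commute: "R (Z x) = Z (R x)" and Z_Z: "Z (Z x) = R x - R (R x)"
  using R_T_eq[OF R_Z, of x] by simp_all

lemma op_plus_Id_square: "op_plus Id (op_comp T T) = converse (blinfun_graph R)"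
proof (intro set_eqI, clarify)
  fix x w
  have "(x, w) \<in> op_plus Id (op_comp T T) \<longleftrightarrow> (\<exists>y z. (x, y) \<in> T \<and> (y, z) \<in> T \<and> w = x + z)"
    by (auto simp: op_plus_def op_comp_def relcomp_unfold)
  also have "\<dots> \<longleftrightarrow> x = R w"
  proof
    assume "x = R w"
    then have "(x, Z w) \<in> T \<and> (Z w, w - x) \<in> T \<and> w = x + (w - x)" using R_Z Z_R by simp
    then show "\<exists>y z. (x, y) \<in> T \<and> (y, z) \<in> T \<and> w = x + z" by blast
  next
    assume "\<exists>y z. (x, y) \<in> T \<and> (y, z) \<in> T \<and> w = x + z"
    then obtain y z where "(x, y) \<in> T" "(y, z) \<in> T" "w = x + z" by blast
    then show "x = R w" by (rule R_Z_eqI(1)[symmetric])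
  qed
  finally show "(x, w) \<in> op_plus Id (op_comp T T) \<longleftrightarrow> (x, w) \<in> converse (blinfun_graph R)"
    by simp
qed

end

text \<open>\<open>Q = \<surd>R\<close> and \<open>S = T Q\<close>\<close>

locale transform_triple = resolvent_pair T R Z
  for T :: "'a :: complex_hilbert operator" and R Z +
  fixes Q S :: "'a \<Rightarrow>\<^sub>L 'a"
  assumes positive_Q: "positive_blinfun Q" and Q_Q: "\<And>x. Q (Q x) = R x"
    and Q_commute: "\<And>C. C \<in> bounded_operators \<Longrightarrow> C o\<^sub>L R = R o\<^sub>L C \<Longrightarrow> C o\<^sub>L Q = Q o\<^sub>L C"
    and Q_S: "\<And>x. (Q x, S x) \<in> T" and norm_S_le: "\<And>x. norm (S x) \<le> norm x"

text \<open>\<open>Q w \<mapsto> Z w\<close> is a contraction on the dense range of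
  \<open>Q\<close>. It extends by continuity, and closedness of \<open>T\<close> shows that the
  extension is \<open>T Q\<close>; so \<open>T Q\<close> is everywhere defined and bounded, and this
  is \<open>S\<close>.\<close>

lemma (in resolvent_pair) transform_triple_exists:
  obtains Q S where "transform_triple T R Z Q S"
proof -
  obtain Q where Q: "positive_blinfun Q" "Q o\<^sub>L Q = R"
    "\<And>C. C \<in> bounded_operators \<Longrightarrow> C o\<^sub>L R = R o\<^sub>L C \<Longrightarrow> C o\<^sub>L Q = Q o\<^sub>L C"
    using positive_square_root[OF positive_R] by blast
  have herm: "hermitian Q" using Q(1) by (simp add: positive_blinfun_def)
  have QQ: "Q (Q x) = R x" for x using Q(2) by auto
  have inj: "x = 0" if "Q x = 0" for x
    using R_injective[of x] that by (simp add: blinfun.bilinear_simps flip: QQ)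
  \<comment> \<open>As \<open>Q\<close> is a Hermitian root of \<open>R\<close>, the squared norm of
    \<open>Q w\<close> is \<langle>R w, w\<rangle>, which \<open>cinner_R\<close> splits into the
    squared norms of \<open>R w\<close> and \<open>Z w\<close>.\<close>
  have norm_Z: "norm (Z w) \<le> norm (Q w)" for w
  proof (rule power2_le_imp_le)
    have "(norm (Q w))\<^sup>2 = (norm (R w))\<^sup>2 + (norm (Z w))\<^sup>2"
      using cinner_square[OF herm, of w] cinner_R[of w] hermitianD[OF hermitian_R, of w w]
      by (simp add: QQ of_real_eq_iff[where 'a = complex, symmetric] del: of_real_eq_iff)
    then show "(norm (Z w))\<^sup>2 \<le> (norm (Q w))\<^sup>2" by simp
  qed simp
  have ex: "\<exists>s. (Q v, s) \<in> T \<and> norm s \<le> norm v" for v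
  proof -
    have "v \<in> closure (range Q)" by (simp add: hermitian_dense_range[OF herm inj])
    then obtain w' where w': "\<And>n. w' n \<in> range Q" "w' \<longlonglongrightarrow> v"
      unfolding closure_sequential by blast
    have "\<forall>n. \<exists>u. w' n = Q u" using w'(1) by blast
    then obtain w where w: "\<forall>n. w' n = Q (w n)" unfolding choice_iff by blast
    then have "w' = (\<lambda>n. Q (w n))" by (intro ext) simp
    then have lim: "(\<lambda>n. Q (w n)) \<longlonglongrightarrow> v" using w'(2) by simp
    have "Cauchy (\<lambda>n. Z (w n))"
    proof (rule metric_CauchyI)
      fix e :: real assume "0 < e"
      then obtain N where N: "\<And>m n. N \<le> m \<Longrightarrow> N \<le> n \<Longrightarrow> dist (Q (w m)) (Q (w n)) < e"
        using metric_CauchyD[OF LIMSEQ_imp_Cauchy[OF lim]] by metis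
      have "dist (Z (w m)) (Z (w n)) \<le> dist (Q (w m)) (Q (w n))" for m n
        using norm_Z[of "w m - w n"] by (simp add: dist_norm blinfun.bilinear_simps)
      with N show "\<exists>M. \<forall>m\<ge>M. \<forall>n\<ge>M. dist (Z (w m)) (Z (w n)) < e"
        by (meson le_less_trans)
    qed
    then obtain s where s: "(\<lambda>n. Z (w n)) \<longlonglongrightarrow> s"
      by (auto simp: Cauchy_convergent_iff convergent_def)
    have "(\<lambda>n. (Q (Q (w n)), Z (w n))) \<longlonglongrightarrow> (Q v, s)"
      by (intro tendsto_Pair s blinfun.tendsto tendsto_const lim)
    then have "(Q v, s) \<in> T"
      using self_adjoint_closed[OF self_adjoint] R_Z unfolding QQ
      by (rule_tac closed_sequentially) auto
    moreover have "norm s \<le> norm v"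
      by (rule tendsto_le[OF _ tendsto_norm[OF lim] tendsto_norm[OF s]]) (auto simp: norm_Z)
    ultimately show ?thesis by blast
  qed
  define G where "G = {(v, s). (Q v, s) \<in> T}"
  have "csubspace G"
    using graph bounded_operators_scaleC[OF hermitian_bounded_operators[OF herm]]
    by (intro csubspace_graphI) (auto simp: G_def blinfun.bilinear_simps)
  moreover have "\<exists>s. (v, s) \<in> G" for v using ex by (auto simp: G_def)
  moreover have "norm s \<le> 1 * norm v" if "(v, s) \<in> G" for v s
    using ex[of v] that self_adjoint_single_valued[OF self_adjoint] by (auto simp: G_def)
  ultimately obtain S where S: "blinfun_graph S = G"
    by (rule everywhere_defined_blinfun)
  have QS: "(Q x, S x) \<in> T" for x
    using S by (auto simp: G_def set_eq_iff)
  moreover have "norm (S x) \<le> norm x" for x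
    using ex[of x] QS self_adjoint_single_valued[OF self_adjoint] by blast
  ultimately have "transform_triple T R Z Q S"
    using Q QQ by unfold_locales auto
  then show ?thesis using that by blast
qed

context transform_triple
begin

lemma hermitian_Q: "hermitian Q"
  using positive_Q by (simp add: positive_blinfun_def)

lemma Q_injective: "Q x = 0 \<Longrightarrow> x = 0"
  using R_injective[of x] by (simp add: blinfun.bilinear_simps flip: Q_Q)

lemma dense_range_Q: "closure (range Q) = UNIV"
  by (rule hermitian_dense_range[OF hermitian_Q Q_injective])

lemma S_Q: "S (Q x) = Z x"
  using self_adjoint_single_valued[OF self_adjoint Q_S[of "Q x"]] R_Z[of x] by (simp add: Q_Q)

text \<open>\<open>Z\<close> commutes with \<open>R\<close>, hence with its root \<open>Q\<close> by
  \<open>Q_commute\<close>.\<close>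

lemma Q_Z: "Q (Z x) = Z (Q x)"
proof -
  have "Z o\<^sub>L R = R o\<^sub>L Z"
    by (rule blinfun_eqI) (simp add: R_Z_commute)
  then have "Z o\<^sub>L Q = Q o\<^sub>L Z"
    by (rule Q_commute[OF hermitian_bounded_operators[OF hermitian_Z]])
  then show ?thesis by (metis blinfun_apply_blinfun_compose)
qed

lemma Q_S_commute: "Q (S x) = S (Q x)"
proof -
  have "closed {x. Q (S x) = S (Q x)}"
    by (intro closed_Collect_eq continuous_intros)
  moreover have "range Q \<subseteq> {x. Q (S x) = S (Q x)}"
    by (auto simp: S_Q Q_Z)
  ultimately show ?thesis
    using closure_minimal dense_range_Q by blast
qed

text \<open>For \<open>w\<close> in the range of \<open>Q\<close> this is symmetry of
  \<open>T\<close> combined with \<open>Q_S_commute\<close>; both sides are continuous and that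
  range is dense.\<close>

lemma hermitian_S: "hermitian S"
  unfolding hermitian_def
proof (intro allI)
  fix v w
  have "closed {w. cinner (S v) w = cinner v (S w)}"
    by (intro closed_Collect_eq continuous_on_cinner continuous_intros)
  moreover have "cinner (S v) (Q w) = cinner v (S (Q w))" for w
    using symmetric[OF Q_S Q_S, of v w] by (simp add: hermitianD[OF hermitian_Q] Q_S_commute)
  then have "range Q \<subseteq> {w. cinner (S v) w = cinner v (S w)}" by auto
  ultimately show "cinner (S v) w = cinner v (S w)"
    using closure_minimal dense_range_Q by blast
qed

text \<open>Multiplied by the injective \<open>R = Q^2\<close>, the left side becomes
  \<open>Z (Z x)\<close>, which \<open>Z_Z\<close> evaluates.\<close>

lemma S_S: "S (S x) = x - R x"
proof -
  have "R (S (S x)) = Z (Z x)"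
    by (simp add: Q_S_commute S_Q flip: Q_Q)
  then have "R (S (S x) - (x - R x)) = 0"
    by (simp add: Z_Z blinfun.bilinear_simps)
  then show ?thesis using R_injective by fastforce
qed

lemma S_S_injective: "S (S x) = x \<Longrightarrow> x = 0"
  using R_injective[of x] by (simp add: S_S)

text \<open>The root of \<open>I + T\<^sup>2\<close> is the inverse of \<open>Q\<close>, so the
  composite in the definition is \<open>T Q\<close>.\<close>

lemma bounded_transform_eq: "bounded_transform T = S"
proof -
  have "Q o\<^sub>L Q = R" by (rule blinfun_eqI) (simp add: Q_Q)
  then have "op_sqrt (op_plus Id (op_comp T T)) = converse (blinfun_graph Q)"
    unfolding op_plus_Id_square
    by (rule op_sqrt_converse_blinfun_graph[OF positive_Q _ Q_commute R_injective])
  moreover have "op_comp T (converse (converse (blinfun_graph Q))) = blinfun_graph S"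
    using Q_S self_adjoint_single_valued[OF self_adjoint]
    by (auto simp: op_comp_def relcomp_unfold set_eq_iff)
  ultimately show ?thesis
    unfolding bounded_transform_def
    by (intro the_equality) (auto intro: blinfun_graph_inject)
qed

text \<open>\<open>(Q + c)(Q - c) = R - c^2\<close>, and positivity of \<open>Q\<close> makes
  \<open>Q + c\<close> bounded below by \<open>c\<close>.\<close>

lemma norm_Q_shift_le:
  assumes "0 < c"
  shows "c * norm (Q x - c *\<^sub>R x) \<le> norm (R x - c\<^sup>2 *\<^sub>R x)"
proof -
  define y where "y = Q x - c *\<^sub>R x"
  have "Q y + c *\<^sub>R y = R x - c\<^sup>2 *\<^sub>R x"
    by (simp add: y_def blinfun.bilinear_simps Q_Q scaleR_diff_right power2_eq_square)
  moreover have "c * (norm y)\<^sup>2 \<le> norm y * norm (Q y + c *\<^sub>R y)"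
  proof -
    have "c * (norm y)\<^sup>2 \<le> Re (cinner y (Q y + c *\<^sub>R y))"
      using positive_Q by (simp add: positive_blinfun_def scaleR_scaleC cinner_add_right
        cinner_scaleC_right cinner_self)
    also have "\<dots> \<le> norm y * norm (Q y + c *\<^sub>R y)"
      using cinner_cauchy_schwarz complex_Re_le_cmod order_trans by blast
    finally show ?thesis .
  qed
  then have *: "norm y * (c * norm y) \<le> norm y * norm (Q y + c *\<^sub>R y)"
    by (simp add: power2_eq_square ac_simps)
  have "c * norm y \<le> norm (Q y + c *\<^sub>R y)"
  proof (cases "y = 0")
    case False
    show ?thesis by (rule mult_left_le_imp_le[OF *]) (use False in simp)
  qed simp
  ultimately show ?thesis by (simp add: y_def)
qed

text \<open>To the spectral parameter \<open>t\<close> of \<open>T\<close> correspond the values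
  \<open>c\<close>, \<open>s\<close>, \<open>c^2\<close> and \<open>t c^2\<close> of
  \<open>Q\<close>, \<open>S\<close>, \<open>R\<close> and \<open>Z\<close>. If \<open>x\<close> is
  nearly an eigenvector of \<open>T\<close> for \<open>t\<close>, it is nearly one of each of these;
  if it is nearly one of \<open>S\<close> for \<open>s\<close>, then \<open>Q x\<close> is nearly
  one of \<open>T\<close>. So lower bounds transfer in both directions.\<close>

lemma real_spectrum_eq: "t \<in> real_spectrum T \<longleftrightarrow> t / sqrt (1 + t\<^sup>2) \<in> bspec S"
proof -
  define c where "c = 1 / sqrt (1 + t\<^sup>2)"
  define s where "s = t * c"
  have sqrt_pos: "0 < sqrt (1 + t\<^sup>2)" by (simp add: add_pos_nonneg)
  have c: "0 < c" "c \<le> 1"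
    by (simp_all add: c_def add_pos_nonneg)
  have c2: "c\<^sup>2 * (1 + t\<^sup>2) = 1"
    using sqrt_pos by (simp add: c_def power_divide)
  then have s2: "s\<^sup>2 = 1 - c\<^sup>2" by (simp add: s_def power_mult_distrib algebra_simps)
  have s1: "\<bar>s\<bar> \<le> 1" using s2 by (simp add: abs_square_le_1[symmetric])
  have "(\<exists>\<delta>>0. \<forall>x y. (x, y) \<in> T \<longrightarrow> \<delta> * norm x \<le> norm (y - t *\<^sub>R x)) \<longleftrightarrow>
      (\<exists>\<delta>>0. \<forall>x. \<delta> * norm x \<le> norm (S x - s *\<^sub>R x))"
  proof
    assume "\<exists>\<delta>>0. \<forall>x. \<delta> * norm x \<le> norm (S x - s *\<^sub>R x)"
    then obtain \<delta> where \<delta>: "0 < \<delta>" "\<And>x. \<delta> * norm x \<le> norm (S x - s *\<^sub>R x)" by blast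
    \<comment> \<open>\<open>K\<close> bounds the error of \<open>R x\<close> against
      \<open>c^2\<close> times \<open>x\<close>, and \<open>L\<close> adds the resulting bounds for
      \<open>Z x\<close> and \<open>Q x\<close>, all relative to the norm of
      \<open>w\<close>.\<close>
    define K where "K = 1 + \<bar>t\<bar>"
    define L where "L = 1 + \<bar>t\<bar> * K + K / c"
    have K: "0 < K" by (simp add: K_def add_pos_nonneg)
    have L: "0 < L" using K c by (simp add: L_def add_pos_nonneg)
    have "(c * \<delta> / L) * norm x \<le> norm (y - t *\<^sub>R x)" if xy: "(x, y) \<in> T" for x y
    proof -
      define w where "w = y - t *\<^sub>R x"
      have Rw: "R w = Z x - t *\<^sub>R R x" and Zw: "Z w = x - R x - t *\<^sub>R Z x"
        using R_T_eq[OF xy] by (simp_all add: w_def blinfun.bilinear_simps)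
      have Zx: "Z x = R w + t *\<^sub>R R x" by (simp add: Rw)
      have "x - R x = Z w + t *\<^sub>R R w + t\<^sup>2 *\<^sub>R R x"
        by (simp add: Rw Zw scaleR_diff_right power2_eq_square)
      then have "x = (1 + t\<^sup>2) *\<^sub>R R x + (Z w + t *\<^sub>R R w)"
        by (simp add: scaleR_add_left algebra_simps)
      then have "c\<^sup>2 *\<^sub>R x = c\<^sup>2 *\<^sub>R (1 + t\<^sup>2) *\<^sub>R R x + c\<^sup>2 *\<^sub>R (Z w + t *\<^sub>R R w)"
        by (metis scaleR_add_right)
      then have Rx: "R x - c\<^sup>2 *\<^sub>R x = - (c\<^sup>2 *\<^sub>R (Z w + t *\<^sub>R R w))"
        by (simp add: c2)
      have "norm (Z w + t *\<^sub>R R w) \<le> norm (Z w) + \<bar>t\<bar> * norm (R w)"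
        by (metis norm_scaleR norm_triangle_ineq)
      also have "\<dots> \<le> norm w + \<bar>t\<bar> * norm w"
        by (intro add_mono mult_left_mono norm_Z_le norm_R_le) simp
      finally have "norm (Z w + t *\<^sub>R R w) \<le> K * norm w" by (simp add: K_def algebra_simps)
      moreover have "c\<^sup>2 \<le> 1" using c by (simp add: power_le_one)
      ultimately have "c\<^sup>2 * norm (Z w + t *\<^sub>R R w) \<le> 1 * (K * norm w)"
        by (intro mult_mono) auto
      then have R_bound: "norm (R x - c\<^sup>2 *\<^sub>R x) \<le> K * norm w"
        unfolding Rx by simp
      have "Z x - (t * c\<^sup>2) *\<^sub>R x = R w + t *\<^sub>R (R x - c\<^sup>2 *\<^sub>R x)"
        by (simp add: Zx scaleR_diff_right)
      also have "norm \<dots> \<le> norm (R w) + \<bar>t\<bar> * norm (R x - c\<^sup>2 *\<^sub>R x)"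
        by (metis norm_scaleR norm_triangle_ineq)
      also have "\<dots> \<le> norm w + \<bar>t\<bar> * (K * norm w)"
        by (intro add_mono mult_left_mono norm_R_le R_bound) simp
      finally have Z_bound: "norm (Z x - (t * c\<^sup>2) *\<^sub>R x) \<le> norm w + \<bar>t\<bar> * (K * norm w)" .
      have Q_bound: "norm (Q x - c *\<^sub>R x) \<le> (K / c) * norm w"
        using order_trans[OF norm_Q_shift_le[OF c(1), of x] R_bound] c by (simp add: field_simps)
      \<comment> \<open>\<open>S Q = Z\<close> expresses the defect of \<open>S\<close> through
        those of \<open>Z\<close> and \<open>Q\<close>.\<close>
      have "c *\<^sub>R (S x - s *\<^sub>R x) = (Z x - (t * c\<^sup>2) *\<^sub>R x) - S (Q x - c *\<^sub>R x)"
        by (simp add: blinfun.bilinear_simps S_Q scaleR_diff_right s_def power2_eq_square ac_simps)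
      also have "norm \<dots> \<le> norm (Z x - (t * c\<^sup>2) *\<^sub>R x) + norm (S (Q x - c *\<^sub>R x))"
        by (rule norm_triangle_ineq4)
      also have "\<dots> \<le> (norm w + \<bar>t\<bar> * (K * norm w)) + (K / c) * norm w"
        by (intro add_mono Z_bound order_trans[OF norm_S_le Q_bound])
      also have "\<dots> = L * norm w"
        by (simp add: L_def algebra_simps)
      finally have "c * norm (S x - s *\<^sub>R x) \<le> L * norm w" using c by simp
      moreover have "c * (\<delta> * norm x) \<le> c * norm (S x - s *\<^sub>R x)"
        using \<delta>(2)[of x] c by simp
      ultimately have "c * (\<delta> * norm x) \<le> L * norm w" by simp
      then show ?thesis using L by (simp add: w_def field_simps)
    qed
    moreover have "0 < c * \<delta> / L" using c \<delta> L by simp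
    ultimately show "\<exists>\<delta>>0. \<forall>x y. (x, y) \<in> T \<longrightarrow> \<delta> * norm x \<le> norm (y - t *\<^sub>R x)" by blast
  next
    assume "\<exists>\<delta>>0. \<forall>x y. (x, y) \<in> T \<longrightarrow> \<delta> * norm x \<le> norm (y - t *\<^sub>R x)"
    then obtain \<delta> where \<delta>: "0 < \<delta>" "\<And>x y. (x, y) \<in> T \<Longrightarrow> \<delta> * norm x \<le> norm (y - t *\<^sub>R x)"
      by blast
    \<comment> \<open>The lower bound for \<open>T\<close> is applied to \<open>Q x\<close>, which
      \<open>T\<close> maps to \<open>S x\<close>. The first summand bounds \<open>Q x\<close>, the
      second the error of \<open>Q x\<close> against \<open>c *\<^sub>R x\<close>.\<close>
    define M where "M = (1 + \<bar>t\<bar> * (2 / c)) / \<delta> + 2 / c"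
    have M: "0 < M" using c \<delta>(1) by (simp add: M_def add_nonneg_pos)
    have "(c / M) * norm x \<le> norm (S x - s *\<^sub>R x)" for x
    proof -
      define w where "w = S x - s *\<^sub>R x"
      have "R x - c\<^sup>2 *\<^sub>R x = s\<^sup>2 *\<^sub>R x - S (S x)"
        by (simp add: S_S s2 scaleR_diff_left)
      also have "\<dots> = - (S w + s *\<^sub>R w)"
        by (simp add: w_def blinfun.bilinear_simps scaleR_diff_right power2_eq_square)
      also have "norm \<dots> \<le> norm (S w) + \<bar>s\<bar> * norm w"
        by (metis norm_minus_cancel norm_scaleR norm_triangle_ineq)
      also have "\<dots> \<le> norm w + 1 * norm w"
        by (intro add_mono mult_right_mono norm_S_le s1) simp
      finally have "norm (R x - c\<^sup>2 *\<^sub>R x) \<le> 2 * norm w" by simp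
      with norm_Q_shift_le[OF c(1), of x] have "c * norm (Q x - c *\<^sub>R x) \<le> 2 * norm w"
        by linarith
      then have Q_bound: "norm (Q x - c *\<^sub>R x) \<le> (2 / c) * norm w"
        using c by (simp add: field_simps)
      have "S x - t *\<^sub>R Q x = w - t *\<^sub>R (Q x - c *\<^sub>R x)"
        by (simp add: w_def s_def scaleR_diff_right)
      also have "norm \<dots> \<le> norm w + \<bar>t\<bar> * norm (Q x - c *\<^sub>R x)"
        by (metis norm_scaleR norm_triangle_ineq4)
      also have "\<dots> \<le> norm w + \<bar>t\<bar> * ((2 / c) * norm w)"
        by (intro add_left_mono mult_left_mono Q_bound) simp
      finally have "norm (S x - t *\<^sub>R Q x) \<le> (1 + \<bar>t\<bar> * (2 / c)) * norm w"
        by (simp add: algebra_simps)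
      then have "\<delta> * norm (Q x) \<le> (1 + \<bar>t\<bar> * (2 / c)) * norm w"
        using \<delta>(2)[OF Q_S, of x] by linarith
      then have "norm (Q x) \<le> (1 + \<bar>t\<bar> * (2 / c)) / \<delta> * norm w"
        using \<delta>(1) by (simp add: pos_le_divide_eq mult.commute)
      moreover have "norm (c *\<^sub>R x) \<le> norm (Q x) + norm (Q x - c *\<^sub>R x)"
        by (metis norm_minus_commute norm_triangle_sub)
      ultimately have "c * norm x \<le> (1 + \<bar>t\<bar> * (2 / c)) / \<delta> * norm w + (2 / c) * norm w"
        using Q_bound c(1) by simp
      then have "c * norm x \<le> M * norm w" by (simp add: M_def distrib_right)
      then show ?thesis using M by (simp add: w_def pos_divide_le_eq mult.commute)
    qed
    moreover have "0 < c / M" using c M by simp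
    ultimately show "\<exists>\<delta>>0. \<forall>x. \<delta> * norm x \<le> norm (S x - s *\<^sub>R x)" by blast
  qed
  moreover have "t / sqrt (1 + t\<^sup>2) = s" by (simp add: s_def c_def)
  ultimately show ?thesis
    unfolding real_spectrum_iff[OF self_adjoint] bspec_iff[OF hermitian_S] by simp
qed

end

section \<open>The chosen calculus \<open>cfc\<close> as a limit of polynomials\<close>

lemma isometric_star_homD:
  assumes "isometric_star_hom X F M \<Phi>" "f \<in> F"
  shows "g \<in> F \<Longrightarrow> \<Phi> (\<lambda>x. f x + g x) = \<Phi> f + \<Phi> g"
    and "\<Phi> (\<lambda>x. c * f x) = scaleC_blinfun c (\<Phi> f)"
    and "g \<in> F \<Longrightarrow> \<Phi> (\<lambda>x. f x * g x) = \<Phi> f o\<^sub>L \<Phi> g"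
    and "norm (\<Phi> f) = sup_norm X f"
  using assms unfolding isometric_star_hom_def by blast+

text \<open>A homomorphism that sends the constant 1 to the identity and the identity function to
  \<open>S\<close> is determined on polynomials by Horner's recursion; the zero polynomial is
  reached as 0 times the constant 1.\<close>

lemma cfc_cpoly_fun:
  fixes S :: "'a :: complex_hilbert \<Rightarrow>\<^sub>L 'a"
  assumes S: "hermitian S"
  shows "cfc S (cpoly_fun p) = pop S p"
proof (induction p)
  case 0
  have "(\<lambda>x. 1) \<in> C_fun (bspec S)" by (simp add: C_fun_def)
  then have "cfc S (\<lambda>x. 0 * 1) = scaleC_blinfun 0 (cfc S (\<lambda>x. 1))"
    by (rule isometric_star_homD(2)[OF cfc_hermitian(1)[OF S]])
  moreover have "cpoly_fun 0 = (\<lambda>x. 0 * 1)" by (simp add: cpoly_fun_def fun_eq_iff)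
  ultimately show ?case
    by (auto intro!: blinfun_eqI simp: scaleC_zero_left blinfun.bilinear_simps)
next
  case (pCons a p)
  note hom = isometric_star_homD[OF cfc_hermitian(1)[OF S]]
  have cont: "(\<lambda>x. 1) \<in> C_fun (bspec S)" "(\<lambda>x. a * 1) \<in> C_fun (bspec S)"
    "complex_of_real \<in> C_fun (bspec S)" "cpoly_fun p \<in> C_fun (bspec S)"
    "(\<lambda>x. complex_of_real x * cpoly_fun p x) \<in> C_fun (bspec S)"
    by (auto simp: C_fun_def intro!: continuous_intros continuous_on_cpoly_fun)
  have "cpoly_fun (pCons a p) = (\<lambda>x. a * 1 + complex_of_real x * cpoly_fun p x)"
    by (simp add: cpoly_fun_def fun_eq_iff)
  then have "cfc S (cpoly_fun (pCons a p))
      = cfc S (\<lambda>x. a * 1) + cfc S (\<lambda>x. complex_of_real x * cpoly_fun p x)"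
    by (simp only: hom(1)[OF cont(2,5)])
  also have "\<dots> = scaleC_blinfun a id_blinfun + (S o\<^sub>L cfc S (cpoly_fun p))"
    by (simp only: hom(2)[OF cont(1)] hom(3)[OF cont(3,4)] cfc_hermitian(2,3)[OF S])
  finally show ?case by (simp add: pCons pop_pCons)
qed

text \<open>Isometry turns uniform convergence of polynomials on the spectrum into norm convergence
  of their operators, so every admissible choice of \<open>cfc\<close> has the same values on
  continuous functions.\<close>

lemma represents_cfc:
  fixes S :: "'a :: complex_hilbert \<Rightarrow>\<^sub>L 'a"
  assumes S: "hermitian S" and f: "continuous_on (bspec S) f"
  shows "represents S f (cfc S f)"
proof -
  note hom = isometric_star_homD[OF cfc_hermitian(1)[OF S]]
  obtain B where "represents S f B" by (rule represents_exists[OF S f])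
  then obtain p where p: "uniform_limit (bspec S) (\<lambda>n. cpoly_fun (p n)) f sequentially"
    by (auto simp: represents_def)
  have "(\<lambda>n. pop S (p n)) \<longlonglongrightarrow> cfc S f"
  proof (rule metric_LIMSEQ_I)
    fix e :: real assume "0 < e"
    then have "0 < e / 2" by simp
    then obtain N where N: "\<And>n t. N \<le> n \<Longrightarrow> t \<in> bspec S \<Longrightarrow> dist (cpoly_fun (p n) t) (f t) < e / 2"
      using uniform_limitD[OF p] by (metis (no_types, lifting) eventually_sequentially)
    have "dist (pop S (p n)) (cfc S f) < e" if n: "N \<le> n" for n
    proof -
      define d where "d = (\<lambda>t. cpoly_fun (p n) t + (-1) * f t)"
      have cont: "f \<in> C_fun (bspec S)" "(\<lambda>t. (-1) * f t) \<in> C_fun (bspec S)"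
        "cpoly_fun (p n) \<in> C_fun (bspec S)" "d \<in> C_fun (bspec S)"
        using f by (auto simp: C_fun_def d_def intro!: continuous_intros continuous_on_cpoly_fun)
      have "cfc S d = pop S (p n) + scaleC_blinfun (-1) (cfc S f)"
        unfolding d_def hom(1)[OF cont(3,2)] hom(2)[OF cont(1)] cfc_cpoly_fun[OF S] by (rule refl)
      also have "\<dots> = pop S (p n) - cfc S f"
        by (rule blinfun_eqI) (simp add: scaleC_minus_one blinfun.bilinear_simps)
      finally have "dist (pop S (p n)) (cfc S f) = sup_norm (bspec S) d"
        using hom(4)[OF cont(4)] by (simp add: dist_norm)
      also have "\<dots> \<le> e / 2"
      proof (rule sup_norm_le_iff[THEN iffD2])
        show bound: "\<forall>t\<in>bspec S. cmod (d t) \<le> e / 2"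
          using N[OF n] by (force simp: d_def dist_norm)
        then show "bounded (d ` bspec S)" unfolding bounded_iff by blast
      qed (use \<open>0 < e\<close> in simp)
      finally show ?thesis using \<open>0 < e\<close> by simp
    qed
    then show "\<exists>M. \<forall>n\<ge>M. dist (pop S (p n)) (cfc S f) < e" by blast
  qed
  with p show ?thesis by (auto simp: represents_def)
qed

lemma represents_bounded_operators:
  fixes S :: "'a :: complex_hilbert \<Rightarrow>\<^sub>L 'a"
  assumes "hermitian S" "represents S f A"
  shows "A \<in> bounded_operators"
  unfolding bounded_operators_def mem_Collect_eq
proof (intro allI)
  fix c x
  obtain B where B: "\<And>x y. cinner (A x) y = cinner x (B y)"
    using represents_adjoint[OF assms] by blast
  show "A (c *\<^sub>C x) = c *\<^sub>C A x"
    by (rule cinner_ext_left) (simp add: B cinner_scaleC_left)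
qed

section \<open>The map \<open>u\<close> and function spaces\<close>

text \<open>The inverse of \<^const>\<open>u_fun\<close>.\<close>

definition v_fun :: "real \<Rightarrow> real" where
  "v_fun t = t / sqrt (1 + t\<^sup>2)"

lemma one_minus_v_fun_sq: "1 - (v_fun t)\<^sup>2 = 1 / (1 + t\<^sup>2)"
  by (simp add: v_fun_def power_divide field_simps add_pos_nonneg add_nonneg_eq_0_iff)

lemma v_fun_range: "v_fun t \<in> {-1<..<1}"
proof -
  have "0 < 1 - (v_fun t)\<^sup>2"
    unfolding one_minus_v_fun_sq by (simp add: add_pos_nonneg)
  then have "\<bar>v_fun t\<bar> < 1" by (simp add: abs_square_less_1[symmetric])
  then show ?thesis by auto
qed

lemma u_v_fun: "u_fun (v_fun t) = t"
  by (simp add: u_fun_def one_minus_v_fun_sq real_sqrt_divide) (simp add: v_fun_def add_pos_nonneg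
    real_sqrt_eq_zero_cancel_iff add_nonneg_eq_0_iff)

lemma one_minus_sq_pos: "x \<in> {-1<..<1} \<Longrightarrow> 0 < 1 - (x :: real)\<^sup>2"
  by (simp add: abs_square_less_1 abs_less_iff)

lemma one_plus_u_fun_sq: "x \<in> {-1<..<1} \<Longrightarrow> 1 + (u_fun x)\<^sup>2 = 1 / (1 - x\<^sup>2)"
  using one_minus_sq_pos[of x] by (simp add: u_fun_def power_divide field_simps)

lemma v_u_fun: "x \<in> {-1<..<1} \<Longrightarrow> v_fun (u_fun x) = x"
  using one_minus_sq_pos[of x]
  by (simp add: v_fun_def one_plus_u_fun_sq real_sqrt_divide) (simp add: u_fun_def)

lemma continuous_on_v_fun: "continuous_on X v_fun"
  unfolding v_fun_def
  by (intro continuous_intros) (simp add: add_nonneg_eq_0_iff)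

lemma continuous_on_u_fun: "X \<subseteq> {-1<..<1} \<Longrightarrow> continuous_on X u_fun"
  unfolding u_fun_def using one_minus_sq_pos
  by (intro continuous_intros) fastforce

definition u_pullback :: "(real \<Rightarrow> complex) \<Rightarrow> real \<Rightarrow> complex" where
  "u_pullback h = (\<lambda>x. if x \<in> {-1<..<1} then h (u_fun x) else 0)"

text \<open>The set where the modulus of \<open>h\<close> is at least a positive
  \<open>\<epsilon>\<close> is contained in the compact support and closed in it.\<close>

lemma Cc_fun_subset_C0_fun: "Cc_fun X \<subseteq> C0_fun X"
proof
  fix h assume "h \<in> Cc_fun X"
  then have h: "continuous_on X h" "compact (X \<inter> closure {x\<in>X. h x \<noteq> 0})" (is "compact ?K")
    by (auto simp: Cc_fun_def)
  have "compact {x\<in>X. \<epsilon> \<le> cmod (h x)}" if "\<epsilon> > 0" for \<epsilon>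
  proof -
    have "continuous_on ?K h" using h(1) continuous_on_subset by blast
    moreover have "closed {z. \<epsilon> \<le> cmod z}" by (intro closed_Collect_le continuous_intros)
    ultimately have "closedin (top_of_set ?K) (?K \<inter> h -` {z. \<epsilon> \<le> cmod z})"
      by (rule continuous_closedin_preimage)
    moreover have "?K \<inter> h -` {z. \<epsilon> \<le> cmod z} = {x\<in>X. \<epsilon> \<le> cmod (h x)}"
      using closure_subset[of "{x\<in>X. h x \<noteq> 0}"] that by fastforce
    ultimately show ?thesis using h(2) closedin_compact by fastforce
  qed
  with h(1) show "h \<in> C0_fun X" by (simp add: C0_fun_def)
qed

lemma Cc_fun_mult:
  assumes f: "f \<in> C_fun X" and h: "h \<in> Cc_fun X"
  shows "(\<lambda>x. f x * h x) \<in> Cc_fun X"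
proof -
  have "{x\<in>X. f x * h x \<noteq> 0} \<subseteq> {x\<in>X. h x \<noteq> 0}" by auto
  then have "X \<inter> closure {x\<in>X. f x * h x \<noteq> 0}
      = (X \<inter> closure {x\<in>X. h x \<noteq> 0}) \<inter> closure {x\<in>X. f x * h x \<noteq> 0}"
    using closure_mono by blast
  then show ?thesis
    using f h unfolding Cc_fun_def C_fun_def
    by (auto intro!: continuous_intros compact_Int_closed simp del: mult_eq_0_iff)
qed

lemma Cc_fun_cnj: "h \<in> Cc_fun X \<Longrightarrow> (\<lambda>x. cnj (h x)) \<in> Cc_fun X"
  by (auto simp: Cc_fun_def intro!: continuous_intros)

lemma C_fun_cnj: "h \<in> C_fun X \<Longrightarrow> (\<lambda>x. cnj (h x)) \<in> C_fun X"
  by (auto simp: C_fun_def intro!: continuous_intros)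

lemma C0_fun_subset_C_fun: "C0_fun X \<subseteq> C_fun X"
  by (auto simp: C0_fun_def C_fun_def)

text \<open>A trapezoid: 1 on \<open>[-n, n]\<close>, linear over the next unit on either side, 0
  beyond. Values between 0 and 1 make the corresponding operators contractions.\<close>

definition cutoff :: "nat \<Rightarrow> real \<Rightarrow> complex" where
  "cutoff n t = complex_of_real (max 0 (min 1 (real n + 1 - \<bar>t\<bar>)))"

lemma cutoff_Cc_fun:
  assumes "closed X"
  shows "cutoff n \<in> Cc_fun X"
proof -
  have "{x\<in>X. cutoff n x \<noteq> 0} \<subseteq> {- (real n + 1) .. real n + 1}"
    by (auto simp: cutoff_def)
  then have "closure {x\<in>X. cutoff n x \<noteq> 0} \<subseteq> {- (real n + 1) .. real n + 1}"
    by (rule closure_minimal) simp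
  then have "compact (closure {x\<in>X. cutoff n x \<noteq> 0})"
    using bounded_subset[OF bounded_closed_interval] by (simp add: compact_eq_bounded_closed)
  then have "compact (X \<inter> closure {x\<in>X. cutoff n x \<noteq> 0})"
    using assms by (rule closed_Int_compact[rotated])
  moreover have "continuous_on X (cutoff n)"
    unfolding cutoff_def by (intro continuous_intros)
  ultimately show ?thesis by (simp add: Cc_fun_def)
qed

lemma cmod_cutoff_le: "cmod (cutoff n t) \<le> 1" "cmod (cutoff n t - 1) \<le> 1"
proof -
  define r where "r = max 0 (min 1 (real n + 1 - \<bar>t\<bar>))"
  have r: "0 \<le> r" "r \<le> 1" by (auto simp: r_def)
  have c: "cutoff n t = complex_of_real r" by (simp only: cutoff_def r_def)
  show "cmod (cutoff n t) \<le> 1" using r by (simp add: c)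
  have "cutoff n t - 1 = complex_of_real (r - 1)" by (simp add: c)
  then show "cmod (cutoff n t - 1) \<le> 1" using r by (simp only: norm_of_real)
qed

lemma cutoff_eq_1: "\<bar>t\<bar> \<le> real n \<Longrightarrow> cutoff n t = 1"
  by (simp add: cutoff_def)

section \<open>Functional calculus of an unbounded self-adjoint operator\<close>

text \<open>The calculus involves \<open>T\<close> only through its bounded transform and its
  spectrum, so these facts carry all that is proved inside the locale. \<open>S_S_injective\<close>
  excludes 1 and -1 as eigenvalues of \<open>S\<close>, which makes the range of
  \<open>I - S\<^sup>2\<close> dense.\<close>

locale transformed_operator =
  fixes T :: "'a :: complex_hilbert operator" and S :: "'a \<Rightarrow>\<^sub>L 'a"
  assumes bounded_transform_eq: "bounded_transform T = S"
    and hermitian_S: "hermitian S"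
    and norm_S_le: "\<And>x. norm (S x) \<le> norm x"
    and S_S_injective: "\<And>x. S (S x) = x \<Longrightarrow> x = 0"
    and real_spectrum_iff_v: "\<And>t. t \<in> real_spectrum T \<longleftrightarrow> v_fun t \<in> bspec S"

lemma self_adjoint_transformed_operator:
  fixes T :: "'a :: complex_hilbert operator"
  assumes "self_adjoint T"
  shows "transformed_operator T (bounded_transform T)"
proof -
  obtain R Z where "resolvent_pair T R Z"
    using resolvent_pair_exists[OF assms] by blast
  then obtain Q S where "transform_triple T R Z Q S"
    by (rule resolvent_pair.transform_triple_exists)
  then interpret transform_triple T R Z Q S .
  show ?thesis
    unfolding bounded_transform_eq
    by unfold_locales
      (use bounded_transform_eq hermitian_S norm_S_le S_S_injective real_spectrum_eq
        in \<open>auto simp: v_fun_def\<close>)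
qed

context transformed_operator
begin

abbreviation X where "X \<equiv> real_spectrum T"
abbreviation Y where "Y \<equiv> bspec S"
abbreviation \<Phi> where "\<Phi> \<equiv> C0_calculus T"

lemma closed_X: "closed X"
proof -
  have "X = v_fun -` Y" using real_spectrum_iff_v by auto
  moreover have "closed Y" using compact_bspec[OF hermitian_S] by (rule compact_imp_closed)
  ultimately show ?thesis
    using continuous_closed_vimage[of Y v_fun] continuous_on_v_fun[of UNIV]
    by (simp add: continuous_on_eq_continuous_at)
qed

lemma Y_abs_le: "x \<in> Y \<Longrightarrow> \<bar>x\<bar> \<le> 1"
  using bspec_abs_le[OF hermitian_S, of x] norm_blinfun_bound[of 1 S] norm_S_le by fastforce

lemma u_fun_X: "x \<in> Y \<Longrightarrow> x \<in> {-1<..<1} \<Longrightarrow> u_fun x \<in> X"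
  by (simp add: real_spectrum_iff_v v_u_fun)

text \<open>The endpoints are the issue. The set where \<open>h\<close> has modulus at least
  \<open>\<epsilon>\<close> is compact, so its image under \<open>v_fun\<close> is closed and misses
  1 and -1; near an endpoint the pullback is therefore below \<open>\<epsilon>\<close>.\<close>

lemma continuous_on_u_pullback:
  assumes h: "h \<in> C0_fun X"
  shows "continuous_on Y (u_pullback h)"
  unfolding continuous_on_iff
proof (intro ballI allI impI)
  fix x \<epsilon> :: real assume x: "x \<in> Y" and \<epsilon>: "0 < \<epsilon>"
  show "\<exists>d>0. \<forall>x'\<in>Y. dist x' x < d \<longrightarrow> dist (u_pullback h x') (u_pullback h x) < \<epsilon>"
  proof (cases "x \<in> {-1<..<1}")
    case True
    let ?Z = "Y \<inter> {-1<..<1}"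
    have "continuous_on ?Z (\<lambda>x. h (u_fun x))"
    proof (rule continuous_on_compose2[of X h])
      show "continuous_on X h" using h by (simp add: C0_fun_def)
      show "continuous_on ?Z u_fun" by (rule continuous_on_u_fun) simp
      show "u_fun ` ?Z \<subseteq> X" using u_fun_X by blast
    qed
    then obtain d1 where d1: "0 < d1"
        "\<And>x'. x' \<in> ?Z \<Longrightarrow> dist x' x < d1 \<Longrightarrow> dist (h (u_fun x')) (h (u_fun x)) < \<epsilon>"
      using IntI[OF x True] \<epsilon> unfolding continuous_on_iff by blast
    obtain d2 where d2: "0 < d2" "ball x d2 \<subseteq> {-1<..<1}"
      using True openE[of "{-1<..<1::real}" x] by auto
    show ?thesis
      using d1 d2 True
      by (intro exI[of _ "min d1 d2"]) (auto simp: u_pullback_def subset_iff dist_commute)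
  next
    case False
    define K where "K = {t\<in>X. \<epsilon> \<le> cmod (h t)}"
    have "compact K" using h \<epsilon> by (simp add: C0_fun_def K_def)
    then have "closed (v_fun ` K)"
      by (intro compact_imp_closed compact_continuous_image continuous_on_v_fun)
    moreover have "x \<notin> v_fun ` K" using False v_fun_range by blast
    ultimately obtain d where d: "0 < d" "ball x d \<subseteq> - (v_fun ` K)"
      using openE[of "- (v_fun ` K)" x] by (auto simp: open_Compl)
    have "cmod (u_pullback h x') < \<epsilon>" if x': "x' \<in> Y" "dist x' x < d" for x'
    proof (cases "x' \<in> {-1<..<1}")
      case in_interval: True
      have "x' \<notin> v_fun ` K" using d(2) x'(2) by (auto simp: dist_commute)
      then have "u_fun x' \<notin> K" using v_u_fun[OF in_interval] by (metis imageI)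
      then show ?thesis
        using u_fun_X[OF x'(1) in_interval] in_interval by (simp add: K_def u_pullback_def)
    qed (use \<epsilon> in \<open>auto simp: u_pullback_def\<close>)
    moreover have "u_pullback h x = 0" using False by (auto simp: u_pullback_def)
    ultimately show ?thesis using d(1) by (auto simp: dist_norm)
  qed
qed

lemma represents_C0: "h \<in> C0_fun X \<Longrightarrow> represents S (u_pullback h) (\<Phi> h)"
  unfolding C0_calculus_def bounded_transform_eq u_pullback_def[symmetric]
  by (intro represents_cfc hermitian_S continuous_on_u_pullback)

lemma represents_Cc: "h \<in> Cc_fun X \<Longrightarrow> represents S (u_pullback h) (\<Phi> h)"
  using represents_C0 Cc_fun_subset_C0_fun by blast

text \<open>Continuity of the pullback is read off from its being a uniform limit of polynomials, so
  sums, products and conjugates can be treated without first placing them in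
  \<open>C0_fun X\<close>.\<close>

lemma calculus_eqI:
  assumes "represents S f A" "\<And>x. f x = u_pullback h x"
  shows "\<Phi> h = A"
proof -
  have f: "f = u_pullback h" using assms(2) by blast
  have "continuous_on Y f"
  proof -
    obtain p where "uniform_limit Y (\<lambda>n. cpoly_fun (p n)) f sequentially"
      using assms(1) by (auto simp: represents_def)
    then show ?thesis
      by (rule uniform_limit_theorem[rotated]) (simp_all add: continuous_on_cpoly_fun)
  qed
  then have "represents S f (\<Phi> h)"
    unfolding C0_calculus_def bounded_transform_eq u_pullback_def[symmetric] f
    by (rule represents_cfc[OF hermitian_S])
  then show ?thesis
    using represents_unique[OF hermitian_S _ assms(1)] by blast
qed

lemma calculus_mult:
  assumes "g \<in> C0_fun X" "h \<in> C0_fun X"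
  shows "\<Phi> (\<lambda>x. g x * h x) = \<Phi> g o\<^sub>L \<Phi> h"
  using represents_mult[OF hermitian_S represents_C0[OF assms(1)] represents_C0[OF assms(2)]]
  by (rule calculus_eqI) (simp add: u_pullback_def)

lemma calculus_mult_apply:
  assumes "g \<in> C0_fun X" "h \<in> C0_fun X"
  shows "\<Phi> g (\<Phi> h x) = \<Phi> (\<lambda>x. g x * h x) x"
  by (simp add: calculus_mult[OF assms])

lemma cinner_calculus:
  assumes "h \<in> C0_fun X"
  shows "cinner (\<Phi> h x) y = cinner x (\<Phi> (\<lambda>t. cnj (h t)) y)"
proof -
  obtain B where B: "represents S (\<lambda>t. cnj (u_pullback h t)) B"
    "\<And>x y. cinner (\<Phi> h x) y = cinner x (B y)"
    using represents_adjoint[OF hermitian_S represents_C0[OF assms]] by blast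
  have "\<Phi> (\<lambda>t. cnj (h t)) = B"
    by (rule calculus_eqI[OF B(1)]) (simp add: u_pullback_def)
  then show ?thesis using B(2) by simp
qed

lemma calculus_cong:
  assumes g: "g \<in> C0_fun X" and h: "h \<in> C0_fun X" and eq: "\<And>t. t \<in> X \<Longrightarrow> g t = h t"
  shows "\<Phi> g = \<Phi> h"
  using represents_C0[OF g] represents_C0[OF h]
  by (rule represents_unique[OF hermitian_S]) (auto simp: u_pullback_def eq u_fun_X)

text \<open>The two sets of values differ at most by the value 0 at 1 and -1, which the 0 inserted
  in \<open>sup_norm\<close> absorbs.\<close>

lemma sup_norm_u_pullback: "sup_norm Y (u_pullback h) = sup_norm X h"
proof -
  have "insert 0 ((\<lambda>x. cmod (u_pullback h x)) ` Y) = insert 0 ((\<lambda>t. cmod (h t)) ` X)"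
  proof (intro equalityI subsetI)
    fix r assume "r \<in> insert 0 ((\<lambda>x. cmod (u_pullback h x)) ` Y)"
    then show "r \<in> insert 0 ((\<lambda>t. cmod (h t)) ` X)"
      using u_fun_X by (auto simp: u_pullback_def)
  next
    fix r assume "r \<in> insert 0 ((\<lambda>t. cmod (h t)) ` X)"
    then consider "r = 0" | t where "t \<in> X" "r = cmod (h t)" by auto
    then show "r \<in> insert 0 ((\<lambda>x. cmod (u_pullback h x)) ` Y)"
    proof cases
      case (2 t)
      then have "v_fun t \<in> Y" "r = cmod (u_pullback h (v_fun t))"
        using v_fun_range[of t] by (auto simp: real_spectrum_iff_v u_pullback_def u_v_fun)
      then show ?thesis by blast
    qed simp
  qed
  then show ?thesis by (simp add: sup_norm_def)
qed

lemma isometric_star_hom_C0_calculus: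
  "isometric_star_hom X (C0_fun X) (cstar_algebra S) \<Phi>"
  unfolding isometric_star_hom_def
proof (intro conjI ballI allI)
  fix f g c assume f: "f \<in> C0_fun X" and g: "g \<in> C0_fun X"
  note rep = represents_C0[OF f] represents_C0[OF g]
  show "\<Phi> f \<in> cstar_algebra S"
    by (rule represents_in_cstar_algebra[OF rep(1)])
  show "\<Phi> (\<lambda>x. f x + g x) = \<Phi> f + \<Phi> g"
    by (rule calculus_eqI[OF represents_add[OF rep]]) (simp add: u_pullback_def)
  show "\<Phi> (\<lambda>x. c * f x) = scaleC_blinfun c (\<Phi> f)"
    by (rule calculus_eqI[OF represents_scale[OF hermitian_S rep(1)]]) (simp add: u_pullback_def)
  show "\<Phi> (\<lambda>x. f x * g x) = \<Phi> f o\<^sub>L \<Phi> g"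
    by (rule calculus_mult[OF f g])
  show "\<Phi> (\<lambda>x. cnj (f x)) = blinfun_adjoint (\<Phi> f)"
    by (rule sym, rule blinfun_adjoint_eqI, rule cinner_calculus[OF f])
  show "norm (\<Phi> f) = sup_norm X f"
    using represents_sup_norm[OF hermitian_S rep(1)] by (simp add: sup_norm_u_pullback)
qed

lemma calculus_cutoff_tendsto: "(\<lambda>n. \<Phi> (cutoff n) x) \<longlonglongrightarrow> x"
proof (rule metric_LIMSEQ_I)
  fix e :: real assume e: "0 < e"
  define R where "R = id_blinfun - (S o\<^sub>L S)"
  have R_apply: "R z = z - S (S z)" for z
    by (simp add: R_def blinfun.bilinear_simps)
  have herm: "hermitian R"
    unfolding hermitian_def
    by (simp add: R_apply cinner_diff_left cinner_diff_right hermitianD[OF hermitian_S])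
  have "closure (range R) = UNIV"
    by (rule hermitian_dense_range[OF herm]) (use S_S_injective in \<open>auto simp: R_apply\<close>)
  then have "x \<in> closure (range R)" by simp
  then obtain z where z: "dist (R z) x < e / 3"
    using e unfolding closure_approachable by (metis rangeE zero_less_divide_iff zero_less_numeral)
  note rep = represents_Cc[OF cutoff_Cc_fun[OF closed_X]]
  have "pop S [:1, 0, -1:] = R"
    by (rule blinfun_eqI)
      (simp add: R_apply blinfun.bilinear_simps scaleC_one scaleC_zero_left scaleC_minus_one)
  moreover have "cpoly_fun [:1, 0, -1:] = (\<lambda>x. complex_of_real (1 - x\<^sup>2))"
    by (simp add: cpoly_fun_def fun_eq_iff power2_eq_square)
  ultimately have rep_R: "represents S (\<lambda>x. complex_of_real (1 - x\<^sup>2)) R"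
    using represents_poly[of S "[:1, 0, -1:]"] by simp
  have contraction: "norm (\<Phi> (cutoff n)) \<le> 1" for n
    by (rule represents_norm_le[OF hermitian_S rep]) (simp_all add: u_pullback_def cmod_cutoff_le)
  \<comment> \<open>Where the cutoff differs from 1 one has \<open>\<bar>u_fun x\<bar> > n\<close>,
    hence \<open>1 - x^2 = 1 / (1 + (u_fun x)^2) \<le> 1 / (n + 1)\<close>, the last step by
    \<open>n \<le> n^2\<close>.\<close>
  have R_bound: "norm ((\<Phi> (cutoff n) o\<^sub>L R) + scaleC_blinfun (-1) R) \<le> 1 / real (Suc n)" for n
  proof (rule represents_norm_le[OF hermitian_S represents_add[OF represents_mult[OF hermitian_S rep rep_R]
        represents_scale[OF hermitian_S rep_R]]])
    fix x assume "x \<in> Y"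
    show "cmod (u_pullback (cutoff n) x * complex_of_real (1 - x\<^sup>2) + - 1 * complex_of_real (1 - x\<^sup>2))
        \<le> 1 / real (Suc n)" (is "?l \<le> _")
    proof (cases "x \<in> {-1<..<1}")
      case True
      then have "?l = cmod ((cutoff n (u_fun x) - 1) * complex_of_real (1 - x\<^sup>2))"
        by (simp add: u_pullback_def algebra_simps)
      also have "\<dots> = cmod (cutoff n (u_fun x) - 1) * (1 - x\<^sup>2)"
        using one_minus_sq_pos[OF True] by (simp only: norm_mult norm_of_real abs_of_pos)
      also have "\<dots> \<le> 1 / real (Suc n)"
      proof (cases "\<bar>u_fun x\<bar> \<le> real n")
        case False
        have "1 - x\<^sup>2 = 1 / (1 + (u_fun x)\<^sup>2)"
          by (simp add: one_plus_u_fun_sq[OF True])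
        also have "\<dots> \<le> 1 / real (Suc n)"
        proof (rule divide_left_mono)
          have "real n \<le> (real n)\<^sup>2" by (cases "n = 0") (auto intro: self_le_power)
          also have "\<dots> \<le> (u_fun x)\<^sup>2" using False by (intro abs_le_square_iff[THEN iffD1]) simp
          finally show "real (Suc n) \<le> 1 + (u_fun x)\<^sup>2" by simp
        qed (auto simp: add_pos_nonneg)
        finally have "cmod (cutoff n (u_fun x) - 1) * (1 - x\<^sup>2) \<le> 1 * (1 / real (Suc n))"
          using one_minus_sq_pos[OF True] by (intro mult_mono cmod_cutoff_le) auto
        then show ?thesis by simp
      qed (simp add: cutoff_eq_1)
      finally show ?thesis .
    next
      case False
      \<comment> \<open>Outside the open interval the spectrum can contain only 1 and -1, where the
        weight \<open>1 - x^2\<close> vanishes.\<close>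
      then have "x\<^sup>2 = 1" using Y_abs_le[OF \<open>x \<in> Y\<close>] by (auto simp: power2_eq_1_iff)
      then show ?thesis by simp
    qed
  qed simp
  obtain N where N: "3 * norm z / e < real N" using reals_Archimedean2 by blast
  have "dist (\<Phi> (cutoff n) x) x < e" if "N \<le> n" for n
  proof -
    have "3 * norm z < e * real (Suc n)"
      using N that e by (simp add: pos_divide_less_eq) (smt (verit) mult.commute mult_left_mono of_nat_mono)
    then have "norm z / real (Suc n) < e / 3" by (simp add: field_simps)
    moreover have "norm (\<Phi> (cutoff n) (R z) - R z) \<le> norm z / real (Suc n)"
    proof -
      have "\<Phi> (cutoff n) (R z) - R z = ((\<Phi> (cutoff n) o\<^sub>L R) + scaleC_blinfun (-1) R) z"
        by (simp add: blinfun.bilinear_simps scaleC_minus_one)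
      also have "norm \<dots> \<le> 1 / real (Suc n) * norm z"
        by (rule order_trans[OF norm_blinfun mult_right_mono[OF R_bound]]) simp
      finally show ?thesis by simp
    qed
    moreover have "norm (\<Phi> (cutoff n) (x - R z)) \<le> norm (x - R z)"
      using order_trans[OF norm_blinfun mult_right_mono[OF contraction]] by fastforce
    \<comment> \<open>Contractivity keeps the error of replacing \<open>x\<close> by
      \<open>R z\<close> below \<open>e / 3\<close>, uniformly in \<open>n\<close>.\<close>
    moreover have "norm (\<Phi> (cutoff n) x - x) \<le> norm (\<Phi> (cutoff n) (x - R z))
        + norm (\<Phi> (cutoff n) (R z) - R z) + norm (R z - x)"
    proof -
      have "\<Phi> (cutoff n) x - x = \<Phi> (cutoff n) (x - R z) + (\<Phi> (cutoff n) (R z) - R z) + (R z - x)"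
        by (simp add: blinfun.bilinear_simps)
      then show ?thesis by (simp only: norm_triangle_le add_right_mono norm_triangle_ineq)
    qed
    ultimately show ?thesis
      using z unfolding dist_norm norm_minus_commute[of x "R z"] by linarith
  qed
  then show "\<exists>M. \<forall>n\<ge>M. dist (\<Phi> (cutoff n) x) x < e" by blast
qed

section \<open>The description of \<open>f(T)\<close> by test functions, adjoints and
  self-adjointness\<close>

definition tested_calculus :: "(real \<Rightarrow> complex) \<Rightarrow> 'a operator" where
  "tested_calculus f = {(x, y). \<forall>g\<in>Cc_fun X. \<Phi> (\<lambda>t. f t * g t) x = \<Phi> g y}"

text \<open>Test with the cutoffs and pass to the limit. This is what makes \<open>f(T)\<close>
  single-valued.\<close>

lemma Cc_fun_separates:
  assumes "\<And>g. g \<in> Cc_fun X \<Longrightarrow> \<Phi> g x = \<Phi> g y"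
  shows "x = y"
proof -
  have "(\<lambda>n. \<Phi> (cutoff n) x) \<longlonglongrightarrow> y"
    using calculus_cutoff_tendsto[of y] assms[OF cutoff_Cc_fun[OF closed_X]] by simp
  then show ?thesis using calculus_cutoff_tendsto[of x] LIMSEQ_unique by blast
qed

text \<open>The adjoint condition is linear in the pair, so it needs checking only on the generators
  of the span. There, taking for \<open>h\<close> the conjugate of \<open>g\<close> and moving the
  operators across the inner product gives the test.\<close>

lemma op_adjoint_calculus0:
  assumes f: "f \<in> C_fun X"
  shows "op_adjoint (calculus0 T f) = tested_calculus (\<lambda>t. cnj (f t))"
proof (intro set_eqI, clarify)
  fix y z :: 'a
  define G where "G = {(\<Phi> h \<psi>, \<Phi> (\<lambda>x. f x * h x) \<psi>) | h \<psi>. h \<in> Cc_fun X}"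
  define K where "K = {p. cinner y (snd p) = cinner z (fst p)}"
  have K: "csubspace K"
    unfolding csubspace_iff K_def by (simp add: cinner_add_right cinner_scaleC_right scaleC_prod_def)
  have "(y, z) \<in> op_adjoint (calculus0 T f) \<longleftrightarrow> cspan G \<subseteq> K"
    unfolding op_adjoint_def calculus0_def G_def[symmetric] K_def by auto
  also have "\<dots> \<longleftrightarrow> G \<subseteq> K"
    using complex_vector.span_minimal[OF _ K] complex_vector.span_superset subset_trans by metis
  also have "\<dots> \<longleftrightarrow>
      (\<forall>h\<in>Cc_fun X. \<forall>\<psi>. cinner y (\<Phi> (\<lambda>x. f x * h x) \<psi>) = cinner z (\<Phi> h \<psi>))"
    unfolding G_def K_def subset_iff mem_Collect_eq by auto
  also have "\<dots> \<longleftrightarrow> (\<forall>g\<in>Cc_fun X. \<Phi> (\<lambda>t. cnj (f t) * g t) y = \<Phi> g z)"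
  proof -
    have adj: "(\<forall>\<psi>. cinner y (\<Phi> (\<lambda>x. f x * cnj (g x)) \<psi>) = cinner z (\<Phi> (\<lambda>x. cnj (g x)) \<psi>)) \<longleftrightarrow>
        \<Phi> (\<lambda>t. cnj (f t) * g t) y = \<Phi> g z" if g: "g \<in> Cc_fun X" for g
    proof -
      have C0: "g \<in> C0_fun X" "(\<lambda>t. cnj (f t) * g t) \<in> C0_fun X"
        using g Cc_fun_mult[OF C_fun_cnj[OF f] g] Cc_fun_subset_C0_fun by auto
      have "(\<forall>\<psi>. cinner y (\<Phi> (\<lambda>x. f x * cnj (g x)) \<psi>) = cinner z (\<Phi> (\<lambda>x. cnj (g x)) \<psi>)) \<longleftrightarrow>
          (\<forall>\<psi>. cinner (\<Phi> (\<lambda>t. cnj (f t) * g t) y) \<psi> = cinner (\<Phi> g z) \<psi>)"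
        by (simp add: cinner_calculus[OF C0(1)] cinner_calculus[OF C0(2)])
      also have "\<dots> \<longleftrightarrow> \<Phi> (\<lambda>t. cnj (f t) * g t) y = \<Phi> g z"
        using cinner_ext_left by metis
      finally show ?thesis .
    qed
    show ?thesis
    proof
      assume *: "\<forall>h\<in>Cc_fun X. \<forall>\<psi>. cinner y (\<Phi> (\<lambda>x. f x * h x) \<psi>) = cinner z (\<Phi> h \<psi>)"
      show "\<forall>g\<in>Cc_fun X. \<Phi> (\<lambda>t. cnj (f t) * g t) y = \<Phi> g z"
        using adj *[rule_format, OF Cc_fun_cnj] by simp
    next
      assume *: "\<forall>g\<in>Cc_fun X. \<Phi> (\<lambda>t. cnj (f t) * g t) y = \<Phi> g z"
      show "\<forall>h\<in>Cc_fun X. \<forall>\<psi>. cinner y (\<Phi> (\<lambda>x. f x * h x) \<psi>) = cinner z (\<Phi> h \<psi>)"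
      proof
        fix h assume h: "h \<in> Cc_fun X"
        from adj[OF Cc_fun_cnj[OF h]] *[rule_format, OF Cc_fun_cnj[OF h]]
        show "\<forall>\<psi>. cinner y (\<Phi> (\<lambda>x. f x * h x) \<psi>) = cinner z (\<Phi> h \<psi>)" by simp
      qed
    qed
  qed
  finally show "(y, z) \<in> op_adjoint (calculus0 T f) \<longleftrightarrow> (y, z) \<in> tested_calculus (\<lambda>t. cnj (f t))"
    by (simp add: tested_calculus_def)
qed

text \<open>Generators pass the test because the bounded calculus is multiplicative and products of
  functions commute; the test is a closed linear condition, so closed spans pass it too.\<close>

lemma calculus_eq:
  assumes f: "f \<in> C_fun X"
  shows "calculus T f = tested_calculus f"
proof
  have fg: "g \<in> C0_fun X" "(\<lambda>t. f t * g t) \<in> C0_fun X" if "g \<in> Cc_fun X" for g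
    using that Cc_fun_mult[OF f that] Cc_fun_subset_C0_fun by auto
  have linear: "\<Phi> h (c *\<^sub>C x) = c *\<^sub>C \<Phi> h x" if "h \<in> C0_fun X" for h c x
    by (rule bounded_operators_scaleC[OF represents_bounded_operators[OF hermitian_S represents_C0[OF that]]])
  have closed: "closed (tested_calculus f)"
  proof -
    have "tested_calculus f = (\<Inter>g\<in>Cc_fun X. {p. \<Phi> (\<lambda>t. f t * g t) (fst p) = \<Phi> g (snd p)})"
      by (auto simp: tested_calculus_def)
    then show ?thesis
      by (auto intro!: closed_INT closed_Collect_eq continuous_intros)
  qed
  have subspace: "csubspace (tested_calculus f)"
    by (rule csubspace_graphI) (auto simp: tested_calculus_def blinfun.bilinear_simps linear fg)
  have "(\<Phi> h \<psi>, \<Phi> (\<lambda>x. f x * h x) \<psi>) \<in> tested_calculus f" if h: "h \<in> Cc_fun X" for h \<psi>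
    unfolding tested_calculus_def
  proof clarify
    fix g assume g: "g \<in> Cc_fun X"
    have "\<Phi> (\<lambda>t. f t * g t) (\<Phi> h \<psi>) = \<Phi> (\<lambda>t. f t * g t * h t) \<psi>"
      by (rule calculus_mult_apply[OF fg(2)[OF g] fg(1)[OF h]])
    also have "(\<lambda>t. f t * g t * h t) = (\<lambda>t. g t * (f t * h t))"
      by (simp add: fun_eq_iff)
    also have "\<Phi> (\<lambda>t. g t * (f t * h t)) \<psi> = \<Phi> g (\<Phi> (\<lambda>t. f t * h t) \<psi>)"
      by (rule calculus_mult_apply[OF fg(1)[OF g] fg(2)[OF h], symmetric])
    finally show "\<Phi> (\<lambda>t. f t * g t) (\<Phi> h \<psi>) = \<Phi> g (\<Phi> (\<lambda>t. f t * h t) \<psi>)" .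
  qed
  then have "calculus0 T f \<subseteq> tested_calculus f"
    unfolding calculus0_def by (intro complex_vector.span_minimal subspace) auto
  then show "calculus T f \<subseteq> tested_calculus f"
    unfolding calculus_def using closed by (rule closure_minimal)
  show "tested_calculus f \<subseteq> calculus T f"
  proof clarify
    fix x y assume xy: "(x, y) \<in> tested_calculus f"
    \<comment> \<open>The test at \<open>cutoff n\<close> is exactly what makes this pair the
      generator belonging to \<open>cutoff n\<close> and the vector \<open>x\<close>.\<close>
    have "(\<Phi> (cutoff n) x, \<Phi> (cutoff n) y) \<in> calculus0 T f" for n
    proof -
      have "\<Phi> (cutoff n) y = \<Phi> (\<lambda>t. f t * cutoff n t) x"
        using xy cutoff_Cc_fun[OF closed_X] by (simp add: tested_calculus_def)
      then show ?thesis
        unfolding calculus0_def using cutoff_Cc_fun[OF closed_X, of n]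
        by (intro complex_vector.span_base) auto
    qed
    moreover have "(\<lambda>n. (\<Phi> (cutoff n) x, \<Phi> (cutoff n) y)) \<longlonglongrightarrow> (x, y)"
      by (intro tendsto_Pair calculus_cutoff_tendsto)
    ultimately show "(x, y) \<in> calculus T f"
      unfolding calculus_def closure_sequential
      by (intro exI[of _ "\<lambda>n. (\<Phi> (cutoff n) x, \<Phi> (cutoff n) y)"]) simp
  qed
qed

text \<open>For fixed \<open>(y, z)\<close> the adjoint condition is closed in the pair taken from
  \<open>A\<close>.\<close>

lemma op_adjoint_closure: "op_adjoint (closure A) = op_adjoint A"
proof
  show "op_adjoint (closure A) \<subseteq> op_adjoint A"
    using closure_subset[of A] by (auto simp: op_adjoint_def)
  show "op_adjoint A \<subseteq> op_adjoint (closure A)"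
  proof clarify
    fix y z assume yz: "(y, z) \<in> op_adjoint A"
    have "closed {p. cinner y (snd p) = cinner z (fst p)}"
      by (intro closed_Collect_eq continuous_on_cinner continuous_intros)
    moreover have "A \<subseteq> {p. cinner y (snd p) = cinner z (fst p)}"
      using yz by (auto simp: op_adjoint_def)
    ultimately have "closure A \<subseteq> {p. cinner y (snd p) = cinner z (fst p)}"
      by (rule closure_minimal[rotated])
    then show "(y, z) \<in> op_adjoint (closure A)"
      by (auto simp: op_adjoint_def)
  qed
qed

lemma op_adjoint_calculus:
  assumes "f \<in> C_fun X"
  shows "op_adjoint (calculus T f) = calculus T (\<lambda>t. cnj (f t))"
  using op_adjoint_calculus0[OF assms] calculus_eq[OF C_fun_cnj[OF assms]]
  by (simp add: calculus_def op_adjoint_closure)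

text \<open>Serves to replace the conjugate of \<open>f\<close> by \<open>f\<close> itself when the
  two agree on the spectrum but possibly not elsewhere.\<close>

lemma tested_calculus_cong:
  assumes "f \<in> C_fun X" "f' \<in> C_fun X" "\<And>t. t \<in> X \<Longrightarrow> f t = f' t"
  shows "tested_calculus f = tested_calculus f'"
proof -
  have "\<Phi> (\<lambda>t. f t * g t) = \<Phi> (\<lambda>t. f' t * g t)" if "g \<in> Cc_fun X" for g
    using Cc_fun_mult[OF assms(1) that] Cc_fun_mult[OF assms(2) that] Cc_fun_subset_C0_fun assms(3)
    by (intro calculus_cong) auto
  then show ?thesis by (auto simp: tested_calculus_def)
qed

text \<open>Linearity is inherited from being an adjoint, single-valuedness comes from the test
  description, and the cutoffs produce a dense set of vectors in the domain.\<close>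

lemma self_adjoint_calculus:
  assumes f: "f \<in> C_fun X" and real: "\<And>t. t \<in> X \<Longrightarrow> f t \<in> \<real>"
  shows "self_adjoint (calculus T f)" "closure (calculus0 T f) = op_adjoint (calculus0 T f)"
proof -
  have "tested_calculus (\<lambda>t. cnj (f t)) = tested_calculus f"
    by (rule tested_calculus_cong[OF C_fun_cnj[OF f] f]) (simp add: real Reals_cnj_iff[THEN iffD1])
  then have eq: "op_adjoint (calculus0 T f) = calculus T f"
    by (simp add: op_adjoint_calculus0[OF f] calculus_eq[OF f])
  then show "closure (calculus0 T f) = op_adjoint (calculus0 T f)"
    by (simp add: calculus_def)
  show "self_adjoint (calculus T f)"
    unfolding self_adjoint_def linear_operator_def
  proof (intro conjI)
    show "csubspace (calculus T f)"
      unfolding eq[symmetric] by (rule csubspace_op_adjoint)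
    show "single_valued (calculus T f)"
      unfolding calculus_eq[OF f]
      by (rule single_valuedI) (auto simp: tested_calculus_def intro: Cc_fun_separates)
    show "op_adjoint (calculus T f) = calculus T f"
      using eq by (simp add: calculus_def op_adjoint_closure)
    show "densely_defined (calculus T f)"
      unfolding densely_defined_def
    proof (intro set_eqI iffI UNIV_I)
      fix x
      have "\<Phi> (cutoff n) x \<in> Domain (calculus T f)" for n
      proof (rule DomainI)
        show "(\<Phi> (cutoff n) x, \<Phi> (\<lambda>t. f t * cutoff n t) x) \<in> calculus T f"
          unfolding calculus_def calculus0_def using cutoff_Cc_fun[OF closed_X, of n]
          by (intro closure_subset[THEN subsetD] complex_vector.span_base) auto
      qed
      then show "x \<in> closure (Domain (calculus T f))"
        unfolding closure_sequential using calculus_cutoff_tendsto[of x]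
        by (intro exI[of _ "\<lambda>n. \<Phi> (cutoff n) x"]) simp
    qed
  qed
qed

text \<open>For \<open>f\<close> in \<open>C0_fun X\<close> the test reads
  \<open>\<Phi> g (\<Phi> f x) = \<Phi> g y\<close>, and compactly supported \<open>g\<close>
  separate vectors.\<close>

lemma calculus_C0_fun:
  assumes f: "f \<in> C0_fun X"
  shows "blinfun_graph (\<Phi> f) = calculus T f"
proof -
  have fC: "f \<in> C_fun X" using f C0_fun_subset_C_fun by blast
  have "(\<forall>g\<in>Cc_fun X. \<Phi> (\<lambda>t. f t * g t) x = \<Phi> g y) \<longleftrightarrow> y = \<Phi> f x" for x y
  proof -
    have "\<Phi> (\<lambda>t. f t * g t) x = \<Phi> g (\<Phi> f x)" if "g \<in> Cc_fun X" for g
      using that Cc_fun_subset_C0_fun f by (subst calculus_mult_apply) (auto simp: mult.commute)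
    then show ?thesis using Cc_fun_separates[of y "\<Phi> f x"] by auto
  qed
  then show ?thesis
    by (auto simp: calculus_eq[OF fC] tested_calculus_def)
qed

end

theorem theorem2:
  fixes T :: "'a :: complex_hilbert operator"
  assumes "self_adjoint T"
  shows
    "(\<forall>f \<in> C_fun (real_spectrum T). (\<forall>x \<in> real_spectrum T. f x \<in> \<real>) \<longrightarrow>
        self_adjoint (calculus T f) \<and> closure (calculus0 T f) = op_adjoint (calculus0 T f)) \<and>
     (\<forall>f \<in> C_fun (real_spectrum T).
        op_adjoint (calculus T f) = calculus T (\<lambda>x. cnj (f x))) \<and>
     (\<exists>\<Phi>. (\<forall>f \<in> C0_fun (real_spectrum T). blinfun_graph (\<Phi> f) = calculus T f) \<and>
        isometric_star_hom (real_spectrum T) (C0_fun (real_spectrum T))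
          (cstar_algebra (bounded_transform T)) \<Phi>)"
proof -
  interpret transformed_operator T "bounded_transform T"
    by (rule self_adjoint_transformed_operator[OF assms])
  show ?thesis
    by (intro conjI ballI impI exI[of _ "C0_calculus T"] self_adjoint_calculus op_adjoint_calculus
      calculus_C0_fun isometric_star_hom_C0_calculus) auto
qed

end
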